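(* Let $V$ be a vertex operator algebra and let $W$ be a vector space equipped with a linear map $Y_W(\cdot,x):V\to\mathrm{Hom}(W,W((x)))\subset(\mathrm{End}\,W)[[x,x^{-1}]]$ such that $Y_W(\mathbf 1,x)=1_W$. For $v\in V$, set $$Y_W^{new}(v,x)=Y_W\left(e^{xL(1)}(-x^{-2})^{L(0)}v,x\right).$$ Then $(W,Y_W)$ is a $\phi$-coordinated $V$-module with $\phi(x,z)=\frac{x}{1+zx}$ if and only if $(W,Y_W^{new})$ is a module for $V$ viewed as a vertex algebra. Furthermore, this gives rise to an isomorphism between the category of $\phi$-coordinated $V$-modules (with $\phi(x,z)=\frac{x}{1+zx}$) and the category of $V$-modules with $V$ viewed as a vertex algebra.
   Context: All vector spaces are over $\mathbb{C}$. $V$ is a vertex operator algebra in the standard sense ($\mathbb{Z}$-graded by $L(0)$-eigenvalues with finite-dimensional homogeneous subspaces $V_{(n)}$, $V_{(n)}=0$ for $n$ sufficiently negative), with vertex operator map $Y$, vacuum $\mathbf 1$, and conformal vector $\omega$, $Y(\omega,x)=\sum_{n\in\mathbb{Z}}L(n)x^{-n-2}$. For $v\in V_{(h)}$, $(-x^{-2})^{L(0)}v=(-1)^hx^{-2h}v$, extended linearly. The map $Y_W(\cdot,x)$ is extended linearly to coefficients in $\mathbb{C}[x,x^{-1}]$. $U((x))$ is the space of formal Laurent series with finitely many negative powers; $U((x_1,x_2))=U[[x_1,x_2]][x_1^{-1},x_2^{-1}]$. Let $\delta(x)=\sum_{n\in\mathbb{Z}}x^n$; powers $(x_1\pm x_2)^n$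 are expanded in nonnegative powers of $x_2$. **$\phi$-coordinated module.** For $\phi(x,z)=\frac{x}{1+zx}$ (expanded in nonnegative powers of $z$), a $\phi$-coordinated $V$-module is a vector space $W$ with a linear map $Y_W(\cdot,x):V\to(\mathrm{End}\,W)[[x,x^{-1}]]$ such that $Y_W(v,x)w\in W((x))$ for $v\in V,w\in W$; $Y_W(\mathbf 1,x)=1_W$; and for any $u,v\in V$ there is a nonnegative integer $k$ with $(x_1-x_2)^kY_W(u,x_1)Y_W(v,x_2)\in\mathrm{Hom}(W,W((x_1,x_2)))$ and $$\left((x_1-x_2)^kY_W(u,x_1)Y_W(v,x_2)\right)|_{x_1=\phi(x_2,z)}=(\phi(x_2,z)-x_2)^kY_W(Y(u,z)v,x_2),$$ the substituted series being an element of $(\mathrm{Hom}(W,W((x_2))))[[z]]$. **Module for $V$ viewed as a vertex algebra.** A vector space $W$ (no grading required) with a linear map $Y_W(\cdot,x):V\to\mathrm{Hom}(W,W((x)))$ with $Y_W(\mathbf 1,x)=1_W$ and, for all $u,v\in V$, $$x_0^{-1}\delta\left(\tfrac{x_1-x_2}{x_0}\right)Y_W(u,x_1)Y_W(v,x_2)-x_0^{-1}\delta\left(\tfrac{x_2-x_1}{-x_0}\right)Y_W(v,x_2)Y_W(u,x_1)=x_2^{-1}\delta\left(\tfrac{x_1-x_0}{x_2}\right)Y_W(Y(u,x_0)v,x_2).$$ In both categories, morphisms are linear maps $\theta:W_1\to W_2$ with $\theta Y_{W_1}(v,x)w=Y_{W_2}(v,x)\theta(w)$ for all $v\in V$, $w\in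 W_1$. *)

theory Defs
  imports
    "HOL-Algebra.Algebraic_Closure_Type"
    "HOL-Library.Groups_Big_Fun"
    "HOL-Library.Product_Plus"
    "HOL-Library.FuncSet"
begin

section \<open>Vector spaces and formal series\<close>

text \<open>
  The vector spaces \<open>W\<close> underlying the objects of the two categories are \<open>HOL-Algebra\<close> modules over
  the field of complex numbers, so that the carrier and the operations may vary from object to object.
  (The ring multiplication of the record type plays no role.) The space underlying the vertex
  operator algebra \<open>V\<close> is fixed throughout and is a whole type with scalar multiplication \<open>scale\<close>;
  \<open>type_space scale\<close> is that same space seen as a module, used for \<open>V\<close> acting on itself.
\<close>

type_synonym 'w cspace = "(complex, 'w) module"

definition cvector_space :: "'w cspace \<Rightarrow> bool" where
  "cvector_space M \<longleftrightarrow> Module.module (ring_of_type_algebra :: complex ring) M"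

definition type_space :: "(complex \<Rightarrow> 'v \<Rightarrow> 'v) \<Rightarrow> 'v::ab_group_add cspace" where
  "type_space scale = \<lparr>carrier = UNIV, monoid.mult = (\<lambda>_ _. 0), one = 0, ring.zero = 0, add = (+), module.smult = scale\<rparr>"

text \<open>Linear maps are normalised to \<open>undefined\<close> outside the carrier, so that two linear maps which
  agree on the carrier are equal.\<close>

definition lin_maps :: "'a cspace \<Rightarrow> 'b cspace \<Rightarrow> ('a \<Rightarrow> 'b) set" where
  "lin_maps M N = {f \<in> carrier M \<rightarrow>\<^sub>E carrier N.
     (\<forall>x \<in> carrier M. \<forall>y \<in> carrier M. f (x \<oplus>\<^bsub>M\<^esub> y) = f x \<oplus>\<^bsub>N\<^esub> f y) \<and>
     (\<forall>a. \<forall>x \<in> carrier M. f (a \<odot>\<^bsub>M\<^esub> x) = a \<odot>\<^bsub>N\<^esub> f x)}"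

text \<open>The analogue of \<^const>\<open>Sum_any\<close> in a module: the sum over the support of \<open>g\<close>. Like all such sums
  it is \<open>\<zero>\<close> when the support is infinite; every use below has finite support whenever the maps
  involved satisfy the truncation conditions.\<close>

definition msum :: "'w cspace \<Rightarrow> ('i \<Rightarrow> 'w) \<Rightarrow> 'w" where
  "msum M g = finsum M g {i. g i \<noteq> \<zero>\<^bsub>M\<^esub>}"

text \<open>A formal series, infinite in all directions, is its coefficient function; the index type is
  \<^typ>\<open>int\<close> for one variable, \<^typ>\<open>int \<times> int\<close> for two, and so on. In particular the
  value of a vertex operator map \<open>Y v n\<close> is the coefficient of \<open>x\<^sup>n\<close> in \<open>Y(v,x)\<close>
  (and not the mode \<open>v\<^sub>n\<close>, the coefficient of \<open>x\<^bsup>-n-1\<^esup>\<close>).\<close>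

definition fmul :: "'w cspace \<Rightarrow> ('i::ab_group_add \<Rightarrow> complex) \<Rightarrow> ('i \<Rightarrow> 'w) \<Rightarrow> 'i \<Rightarrow> 'w" where
  "fmul M f g t = msum M (\<lambda>s. f s \<odot>\<^bsub>M\<^esub> g (t - s))"

definition cmul :: "('i::ab_group_add \<Rightarrow> complex) \<Rightarrow> ('i \<Rightarrow> complex) \<Rightarrow> 'i \<Rightarrow> complex" where
  "cmul f g t = Sum_any (\<lambda>s. f s * g (t - s))"

definition cone :: "'i::ab_group_add \<Rightarrow> complex" where
  "cone t = (if t = 0 then 1 else 0)"

definition cpow :: "('i::ab_group_add \<Rightarrow> complex) \<Rightarrow> nat \<Rightarrow> 'i \<Rightarrow> complex" where
  "cpow f k = (cmul f ^^ k) cone"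

definition laurent :: "'w cspace \<Rightarrow> (int \<Rightarrow> 'w) set" where
  "laurent M = {f. (\<forall>n. f n \<in> carrier M) \<and> (\<exists>N. \<forall>n < N. f n = \<zero>\<^bsub>M\<^esub>)}"

definition laurent2 :: "'w cspace \<Rightarrow> (int \<times> int \<Rightarrow> 'w) set" where
  "laurent2 M = {f. (\<forall>t. f t \<in> carrier M) \<and>
     (\<exists>N. \<forall>m n. m < N \<or> n < N \<longrightarrow> f (m, n) = \<zero>\<^bsub>M\<^esub>)}"

text \<open>\<open>(x - y)\<^sup>n\<close> for an integer \<open>n\<close>, expanded in nonnegative powers of \<open>y\<close>.\<close>

definition diff_pow :: "int \<Rightarrow> int \<times> int \<Rightarrow> complex" where
  "diff_pow n = (\<lambda>(a, b). if b \<ge> 0 \<and> a + b = n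
     then (- 1) ^ nat b * (of_int n gchoose nat b) else 0)"

text \<open>For \<open>\<epsilon> = \<plusminus>1\<close>, the coefficient of \<open>x\<^sup>p y\<^sup>q z\<^sup>r\<close> in
  \<open>x\<^sup>-\<^sup>1 \<delta>((y - z) / (\<epsilon> x)) = \<Sum>n. \<epsilon>\<^sup>-\<^sup>n x\<^bsup>-n-1\<^esup> (y - z)\<^sup>n\<close>:
  only \<open>n = - p - 1\<close> contributes.\<close>

definition delta :: "complex \<Rightarrow> int \<Rightarrow> int \<Rightarrow> int \<Rightarrow> complex" where
  "delta \<epsilon> p q r = \<epsilon> powi (p + 1) * diff_pow (- p - 1) (q, r)"

section \<open>Modules for a vertex algebra\<close>

type_synonym ('v, 'w) vmap = "'v \<Rightarrow> int \<Rightarrow> 'w \<Rightarrow> 'w"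

text \<open>A linear map \<open>V \<rightarrow> Hom(W, W((x)))\<close> sending the vacuum to the identity.\<close>

definition vertex_map ::
  "(complex \<Rightarrow> 'v::ab_group_add \<Rightarrow> 'v) \<Rightarrow> 'v \<Rightarrow> 'w cspace \<Rightarrow> ('v, 'w) vmap \<Rightarrow> bool" where
  "vertex_map scale vac M YW \<longleftrightarrow>
     (\<forall>v n. YW v n \<in> lin_maps M M) \<and>
     (\<forall>u v n. \<forall>w \<in> carrier M. YW (u + v) n w = YW u n w \<oplus>\<^bsub>M\<^esub> YW v n w) \<and>
     (\<forall>a v n. \<forall>w \<in> carrier M. YW (scale a v) n w = a \<odot>\<^bsub>M\<^esub> YW v n w) \<and>
     (\<forall>v. \<forall>w \<in> carrier M. (\<lambda>n. YW v n w) \<in> laurent M) \<and>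
     (\<forall>n. \<forall>w \<in> carrier M. YW vac n w = (if n = 0 then w else \<zero>\<^bsub>M\<^esub>))"

text \<open>The Jacobi identity applied to a vector \<open>w\<close>; the triple of exponents is that of
  \<open>(x\<^sub>0, x\<^sub>1, x\<^sub>2)\<close>.\<close>

definition jacobi_identity ::
  "('v, 'v) vmap \<Rightarrow> 'w cspace \<Rightarrow> ('v, 'w) vmap \<Rightarrow> 'v \<Rightarrow> 'v \<Rightarrow> 'w \<Rightarrow> bool" where
  "jacobi_identity Y M YW u v w \<longleftrightarrow> (\<forall>t :: int \<times> int \<times> int.
     fmul M (\<lambda>(p, q, r). delta 1 p q r)
       (\<lambda>(p, q, r). if p = 0 then YW u q (YW v r w) else \<zero>\<^bsub>M\<^esub>) t
     \<ominus>\<^bsub>M\<^esub> fmul M (\<lambda>(p, q, r). delta (- 1) p r q)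
       (\<lambda>(p, q, r). if p = 0 then YW v r (YW u q w) else \<zero>\<^bsub>M\<^esub>) t
     = fmul M (\<lambda>(p, q, r). delta 1 r q p)
       (\<lambda>(p, q, r). if q = 0 then YW (Y u p v) r w else \<zero>\<^bsub>M\<^esub>) t)"

definition va_module ::
  "(complex \<Rightarrow> 'v::ab_group_add \<Rightarrow> 'v) \<Rightarrow> ('v, 'v) vmap \<Rightarrow> 'v \<Rightarrow> 'w cspace \<Rightarrow> ('v, 'w) vmap \<Rightarrow> bool" where
  "va_module scale Y vac M YW \<longleftrightarrow> cvector_space M \<and> vertex_map scale vac M YW \<and>
     (\<forall>u v. \<forall>w \<in> carrier M. jacobi_identity Y M YW u v w)"

section \<open>Vertex operator algebras\<close>

definition Lop :: "('v, 'v) vmap \<Rightarrow> 'v \<Rightarrow> int \<Rightarrow> 'v \<Rightarrow> 'v" where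
  "Lop Y \<omega> n = Y \<omega> (- n - 2)"

definition weight_space ::
  "(complex \<Rightarrow> 'v::ab_group_add \<Rightarrow> 'v) \<Rightarrow> ('v, 'v) vmap \<Rightarrow> 'v \<Rightarrow> int \<Rightarrow> 'v set" where
  "weight_space scale Y \<omega> h = {v. Lop Y \<omega> 0 v = scale (of_int h) v}"

text \<open>Eigenspaces for distinct eigenvalues are independent, so \<open>graded\<close> says that \<open>V\<close> is the direct sum
  of its weight spaces.\<close>

locale vertex_operator_algebra = vector_space scale
  for scale :: "complex \<Rightarrow> 'v::ab_group_add \<Rightarrow> 'v" +
  fixes Y :: "('v, 'v) vmap" and vac \<omega> :: 'v
  assumes adjoint_module: "va_module scale Y vac (type_space scale) Y"
    and creation: "\<And>v. Y v 0 vac = v" "\<And>v n. n < 0 \<Longrightarrow> Y v n vac = 0"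
    and virasoro: "\<exists>c. \<forall>m n v.
      Lop Y \<omega> m (Lop Y \<omega> n v) - Lop Y \<omega> n (Lop Y \<omega> m v) =
        scale (of_int (m - n)) (Lop Y \<omega> (m + n) v) +
        (if m + n = 0 then scale (of_int (m ^ 3 - m) / 12 * c) v else 0)"
    and derivative: "\<And>v n u. Y (Lop Y \<omega> (- 1) v) n u = scale (of_int (n + 1)) (Y v (n + 1) u)"
    and vac_weight: "vac \<in> weight_space scale Y \<omega> 0"
    and omega_weight: "\<omega> \<in> weight_space scale Y \<omega> 2"
    and graded: "span (\<Union>h. weight_space scale Y \<omega> h) = UNIV"
    and finite_dim: "\<And>h. \<exists>B. finite B \<and> weight_space scale Y \<omega> h = span B"
    and bounded_below: "\<exists>N. \<forall>h < N. weight_space scale Y \<omega> h = {0}"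

section \<open>Modules coordinated by x / (1 + z x)\<close>

text \<open>\<open>\<phi>(x,z)\<^sup>m = x\<^sup>m (1 + z x)\<^sup>-\<^sup>m\<close> for an integer \<open>m\<close>, expanded in nonnegative powers of \<open>z\<close>;
  the pair of exponents is that of \<open>(x, z)\<close>.\<close>

definition phi_pow :: "int \<Rightarrow> int \<times> int \<Rightarrow> complex" where
  "phi_pow m = (\<lambda>(a, j). if j \<ge> 0 \<and> a = m + j then of_int (- m) gchoose nat j else 0)"

definition phi_minus_x :: "int \<times> int \<Rightarrow> complex" where
  "phi_minus_x t = phi_pow 1 t - (if t = (1, 0) then 1 else 0)"

text \<open>The series in \<open>(x\<^sub>2, z)\<close> obtained from \<open>F(x\<^sub>1, x\<^sub>2)\<close> by \<open>x\<^sub>1 = \<phi>(x\<^sub>2, z)\<close>, that is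
  \<open>\<Sum>m n. \<phi>(x\<^sub>2, z)\<^sup>m x\<^sub>2\<^sup>n F(m, n)\<close>. For \<open>F\<close> in \<^const>\<open>laurent2\<close> each coefficient
  is a finite sum.\<close>

definition subst_phi :: "'w cspace \<Rightarrow> (int \<times> int \<Rightarrow> 'w) \<Rightarrow> int \<times> int \<Rightarrow> 'w" where
  "subst_phi M F = (\<lambda>(r, j). msum M (\<lambda>(m, n). phi_pow m (r - n, j) \<odot>\<^bsub>M\<^esub> F (m, n)))"

definition phi_module ::
  "(complex \<Rightarrow> 'v::ab_group_add \<Rightarrow> 'v) \<Rightarrow> ('v, 'v) vmap \<Rightarrow> 'v \<Rightarrow> 'w cspace \<Rightarrow> ('v, 'w) vmap \<Rightarrow> bool" where
  "phi_module scale Y vac M YW \<longleftrightarrow> cvector_space M \<and> vertex_map scale vac M YW \<and>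
     (\<forall>u v. \<exists>k :: nat. \<forall>w \<in> carrier M.
       (let F = fmul M (diff_pow (int k)) (\<lambda>(m, n). YW u m (YW v n w)) in
         F \<in> laurent2 M \<and>
         subst_phi M F = fmul M (cpow phi_minus_x k) (\<lambda>(r, j). YW (Y u j v) r w)))"

section \<open>The transformed vertex operator map\<close>

text \<open>The family of \<open>L(0)\<close>-homogeneous components of \<open>v\<close>.\<close>

definition components ::
  "(complex \<Rightarrow> 'v::ab_group_add \<Rightarrow> 'v) \<Rightarrow> ('v, 'v) vmap \<Rightarrow> 'v \<Rightarrow> 'v \<Rightarrow> int \<Rightarrow> 'v" where
  "components scale Y \<omega> v = (THE f. (\<forall>h. f h \<in> weight_space scale Y \<omega> h) \<and>
     finite {h. f h \<noteq> 0} \<and> Sum_any f = v)"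

text \<open>\<open>(-x\<^bsup>-2\<^esup>)\<^bsup>L(0)\<^esup> v = \<Sum>h. (-1)\<^sup>h x\<^bsup>-2h\<^esup> v\<^sub>h\<close>, with \<open>v\<^sub>h\<close> the component of weight \<open>h\<close>.\<close>

definition L0_factor ::
  "(complex \<Rightarrow> 'v::ab_group_add \<Rightarrow> 'v) \<Rightarrow> ('v, 'v) vmap \<Rightarrow> 'v \<Rightarrow> 'v \<Rightarrow> int \<Rightarrow> 'v" where
  "L0_factor scale Y \<omega> v n = Sum_any (\<lambda>h.
     if n = - 2 * h then scale ((- 1) powi h) (components scale Y \<omega> v h) else 0)"

text \<open>\<open>e\<^bsup>xL(1)\<^esup> f(x) = \<Sum>k. x\<^sup>k L(1)\<^sup>k f(x) / k!\<close> for a Laurent polynomial \<open>f\<close> over \<open>V\<close>.\<close>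

definition exp_xL1 ::
  "(complex \<Rightarrow> 'v::ab_group_add \<Rightarrow> 'v) \<Rightarrow> ('v, 'v) vmap \<Rightarrow> 'v \<Rightarrow> (int \<Rightarrow> 'v) \<Rightarrow> int \<Rightarrow> 'v" where
  "exp_xL1 scale Y \<omega> f n = Sum_any (\<lambda>k :: nat.
     scale (1 / fact k) ((Lop Y \<omega> 1 ^^ k) (f (n - int k))))"

definition new_map ::
  "(complex \<Rightarrow> 'v::ab_group_add \<Rightarrow> 'v) \<Rightarrow> ('v, 'v) vmap \<Rightarrow> 'v \<Rightarrow> 'w cspace \<Rightarrow> ('v, 'w) vmap \<Rightarrow> ('v, 'w) vmap" where
  "new_map scale Y \<omega> M YW v n = (\<lambda>w \<in> carrier M.
     msum M (\<lambda>m. YW (exp_xL1 scale Y \<omega> (L0_factor scale Y \<omega> v) m) (n - m) w))"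

section \<open>Categories\<close>

text \<open>Hom-sets need not be disjoint, so composition and the action of a functor on morphisms take
  the objects as arguments: \<open>cmp C A B D g f\<close> is the composite of \<open>f : A \<rightarrow> B\<close> and \<open>g : B \<rightarrow> D\<close>.\<close>

record ('o, 'm) cat =
  obj :: "'o set"
  mor :: "'o \<Rightarrow> 'o \<Rightarrow> 'm set"
  idn :: "'o \<Rightarrow> 'm"
  cmp :: "'o \<Rightarrow> 'o \<Rightarrow> 'o \<Rightarrow> 'm \<Rightarrow> 'm \<Rightarrow> 'm"

definition is_category :: "('o, 'm) cat \<Rightarrow> bool" where
  "is_category C \<longleftrightarrow>
     (\<forall>A \<in> obj C. idn C A \<in> mor C A A) \<and>
     (\<forall>A \<in> obj C. \<forall>B \<in> obj C. \<forall>D \<in> obj C. \<forall>f \<in> mor C A B. \<forall>g \<in> mor C B D.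
        cmp C A B D g f \<in> mor C A D) \<and>
     (\<forall>A \<in> obj C. \<forall>B \<in> obj C. \<forall>f \<in> mor C A B.
        cmp C A A B f (idn C A) = f \<and> cmp C A B B (idn C B) f = f) \<and>
     (\<forall>A \<in> obj C. \<forall>B \<in> obj C. \<forall>D \<in> obj C. \<forall>E \<in> obj C.
        \<forall>f \<in> mor C A B. \<forall>g \<in> mor C B D. \<forall>h \<in> mor C D E.
        cmp C A D E h (cmp C A B D g f) = cmp C A B E (cmp C B D E h g) f)"

definition is_functor ::
  "('o, 'm) cat \<Rightarrow> ('p, 'n) cat \<Rightarrow> ('o \<Rightarrow> 'p) \<Rightarrow> ('o \<Rightarrow> 'o \<Rightarrow> 'm \<Rightarrow> 'n) \<Rightarrow> bool" where
  "is_functor C D Fo Fm \<longleftrightarrow>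
     (\<forall>A \<in> obj C. Fo A \<in> obj D \<and> Fm A A (idn C A) = idn D (Fo A)) \<and>
     (\<forall>A \<in> obj C. \<forall>B \<in> obj C. \<forall>f \<in> mor C A B. Fm A B f \<in> mor D (Fo A) (Fo B)) \<and>
     (\<forall>A \<in> obj C. \<forall>B \<in> obj C. \<forall>E \<in> obj C. \<forall>f \<in> mor C A B. \<forall>g \<in> mor C B E.
        Fm A E (cmp C A B E g f) = cmp D (Fo A) (Fo B) (Fo E) (Fm B E g) (Fm A B f))"

definition category_isomorphism ::
  "('o, 'm) cat \<Rightarrow> ('p, 'n) cat \<Rightarrow> ('o \<Rightarrow> 'p) \<Rightarrow> ('o \<Rightarrow> 'o \<Rightarrow> 'm \<Rightarrow> 'n) \<Rightarrow> bool" where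
  "category_isomorphism C D Fo Fm \<longleftrightarrow> is_category C \<and> is_category D \<and> is_functor C D Fo Fm \<and>
     (\<exists>Go Gm. is_functor D C Go Gm \<and>
       (\<forall>A \<in> obj C. Go (Fo A) = A) \<and> (\<forall>A \<in> obj D. Fo (Go A) = A) \<and>
       (\<forall>A \<in> obj C. \<forall>B \<in> obj C. \<forall>f \<in> mor C A B. Gm (Fo A) (Fo B) (Fm A B f) = f) \<and>
       (\<forall>A \<in> obj D. \<forall>B \<in> obj D. \<forall>f \<in> mor D A B. Fm (Go A) (Go B) (Gm A B f) = f))"

text \<open>The category whose objects are the pairs \<open>(W, Y\<^sub>W)\<close> satisfying \<open>P\<close>, for \<open>W\<close> any complex vector
  space with carrier in the type \<open>'w\<close>.\<close>

type_synonym ('v, 'w) vobj = "'w cspace \<times> ('v, 'w) vmap"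

definition vmor :: "('v, 'w) vobj \<Rightarrow> ('v, 'w) vobj \<Rightarrow> ('w \<Rightarrow> 'w) set" where
  "vmor A B = {\<theta> \<in> lin_maps (fst A) (fst B).
     \<forall>v n. \<forall>w \<in> carrier (fst A). \<theta> (snd A v n w) = snd B v n (\<theta> w)}"

definition vcat :: "('w cspace \<Rightarrow> ('v, 'w) vmap \<Rightarrow> bool) \<Rightarrow> (('v, 'w) vobj, 'w \<Rightarrow> 'w) cat" where
  "vcat P = \<lparr>obj = {A. P (fst A) (snd A)}, mor = vmor,
     idn = (\<lambda>A. \<lambda>w \<in> carrier (fst A). w),
     cmp = (\<lambda>A B D g f. compose (carrier (fst A)) g f)\<rparr>"

definition phi_module_cat where
  "phi_module_cat scale Y vac = vcat (phi_module scale Y vac)"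

definition va_module_cat where
  "va_module_cat scale Y vac = vcat (va_module scale Y vac)"

end

theory Submission
  imports Defs "HOL-Library.Function_Algebras"
begin

text \<open>
  A linear functional \<open>l\<close> on \<open>W\<close> turns the series \<open>Y\<^sub>W(u,x\<^sub>1)Y\<^sub>W(v,x\<^sub>2)w\<close> and \<open>Y\<^sub>W(Y(u,z)v,x\<^sub>2)w\<close> into series
  with complex coefficients, and functionals separate points. Both definitions of a module then say
  that \<open>F(x\<^sub>1,x\<^sub>2) = (x\<^sub>1 - x\<^sub>2)\<^sup>k l(Y\<^sub>W(u,x\<^sub>1)Y\<^sub>W(v,x\<^sub>2)w)\<close> has finitely many negative powers and that its
  expansion at the diagonal \<open>x\<^sub>1 = x\<^sub>2\<close>, in the coordinate \<open>z\<close> with \<open>x\<^sub>1 = x\<^sub>2 + z\<close> or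
  \<open>x\<^sub>1 = x\<^sub>2/(1 + z x\<^sub>2)\<close>, is given by \<open>Y\<^sub>W(Y(u,z)v,x\<^sub>2)\<close>. For ordinary modules commutativity, and hence
  the Jacobi identity, follows from this by skew symmetry in \<open>V\<close>. For a fixed total degree in
  \<open>x\<^sub>1, x\<^sub>2\<close> one may set \<open>x\<^sub>2 = 1\<close>; the two coordinates are then exchanged by the involution
  \<open>z \<mapsto> -z/(1 + z)\<close>, and its effect on \<open>Y(u,z)v\<close> is undone by \<open>e\<^bsup>xL(1)\<^esup>(-x\<^bsup>-2\<^esup>)\<^bsup>L(0)\<^esup>\<close> because of
  \<open>e\<^bsup>tL(1)\<^esup> Y(u,z) e\<^bsup>-tL(1)\<^esup> = Y(e\<^bsup>t(1-tz)L(1)\<^esup> (1-tz)\<^bsup>-2L(0)\<^esup> u, z/(1-tz))\<close>.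
\<close>

section \<open>Formal series with complex coefficients\<close>

subsection \<open>Binomial series and the inversion of the coordinate\<close>

text \<open>Truncation in both variables makes every homogeneous part of F a power of x2 times a
  Laurent polynomial in x1/x2, and a Laurent polynomial is determined by its Taylor expansion at 1.
  So no convergence or analytic continuation enters: a change of coordinate is composition with a
  formal power series. The coordinate of phi is z = 1/x1 - 1/x2, the ordinary difference after x is
  replaced by 1/x; this is why the operator that undoes the change is the one known from
  contragredient modules. On t = 1 + z the involution is the passage from t to 1/t. A parameter
  \<open>s\<close> with values 1 and -1 keeps both coordinates in one statement, so that the two
  implications of the theorem are instances of a single transport lemma. The difficulty in that
  lemma is that \<open>e^(xL(1))\<close> replaces the pair u, v by all pairs L(1)^i u, L(1)^j v,
  each with its own monomial in x1 and x2. Homogeneous vectors and local nilpotency of L(1) make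
  these pairs finite in number, so that one exponent k serves them all.\<close>

definition binser :: "int \<Rightarrow> complex fps" where
  "binser m = fps_binomial (of_int m)"

lemma binser_nth [simp]: "binser m $ n = of_int m gchoose n"
  by (simp add: binser_def)

lemma binser_0 [simp]: "binser 0 = 1"
  by (simp add: binser_def)

lemma binser_add: "binser (a + b) = binser a * binser b"
  by (simp add: binser_def fps_binomial_add_mult)

lemma binser_1: "binser 1 = 1 + fps_X"
  by (simp add: binser_def fps_binomial_1)

lemma binser_uminus: "binser a * binser (- a) = 1"
  using binser_add[of a "- a"] by simp

text \<open>This is \<open>-X/(1+X)\<close>, written so that \<open>1 + inversion\<close> is visibly
  the inverse of \<open>1 + X\<close>.\<close>

definition inversion :: "complex fps" where
  "inversion = binser (- 1) - 1"

lemma inversion_eq: "inversion = - (fps_X * binser (- 1))"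
proof -
  have "(1 + fps_X) * binser (- 1) = 1"
    using binser_uminus[of 1] by (simp add: binser_1)
  then show ?thesis
    unfolding inversion_def by (simp add: algebra_simps)
qed

lemma inversion_nth_0 [simp]: "inversion $ 0 = 0"
  by (simp add: inversion_def)

lemma binser_power: "binser a ^ n = binser (int n * a)"
  by (induction n) (simp_all add: binser_add algebra_simps)

lemma inversion_power: "inversion ^ i = (- 1) ^ i * (fps_X ^ i * binser (- int i))"
proof -
  have dist: "(c * (y * z)) ^ i = c ^ i * (y ^ i * z ^ i)" for c y z :: "complex fps"
    by (simp add: power_mult_distrib)
  have e: "inversion = (- 1) * (fps_X * binser (- 1))"
    using inversion_eq by simp
  have b: "binser (- 1) ^ i = binser (- int i)"
    using binser_power[of "- 1" i] by (rule trans) (rule arg_cong[where f = binser], simp)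
  show ?thesis
    by (subst e, subst dist, subst b) (rule refl)
qed

text \<open>Since \<open>1 + inversion\<close> is \<open>1/(1+X)\<close>, composition inverts each
  positive power; negative exponents follow because composition is multiplicative.\<close>

lemma binser_compose_inversion: "binser m oo inversion = binser (- m)"
proof -
  have pos: "binser (int n) oo inversion = binser (- int n)" for n
  proof (induction n)
    case (Suc n)
    have "binser (int (Suc n)) = (1 + fps_X) * binser (int n)"
      using binser_add[of 1 "int n"] by (simp add: binser_1)
    then have "binser (int (Suc n)) oo inversion = ((1 + fps_X) oo inversion) * (binser (int n) oo inversion)"
      by (simp add: fps_compose_mult_distrib)
    also have "(1 + fps_X) oo inversion = binser (- 1)"
      by (simp add: fps_compose_add_distrib fps_X_fps_compose_startby0 inversion_def)
    also have "binser (- 1) * (binser (int n) oo inversion) = binser (- int (Suc n))"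
      using binser_add[of "- 1" "- int n"] Suc by simp
    finally show ?case .
  qed simp
  show ?thesis
  proof (cases "m \<ge> 0")
    case True
    with pos[of "nat m"] show ?thesis by simp
  next
    case False
    have "(binser (- m) oo inversion) * (binser m oo inversion) = 1"
      using binser_uminus[of "- m"]
      by (metis fps_compose_1 fps_compose_mult_distrib inversion_nth_0 minus_minus)
    moreover have "binser (- m) oo inversion = binser m"
      using pos[of "nat (- m)"] False by simp
    ultimately have inv: "binser m * (binser m oo inversion) = 1" by simp
    have "binser m oo inversion = (binser m * binser (- m)) * (binser m oo inversion)"
      by (simp only: binser_uminus mult_1_left)
    also have "\<dots> = (binser m * (binser m oo inversion)) * binser (- m)"
      by (simp only: mult_ac)
    finally show ?thesis by (simp only: inv mult_1_left)
  qed
qed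

text \<open>The power \<open>inversion^i\<close> is \<open>(-1)^i X^i (1+X)^(-i)\<close>, so the
  prefactor merely changes the exponent of the binomial series. The coefficients of skew symmetry
  and of the conjugation by L(1) are recognised through this formula.\<close>

lemma binser_times_compose_nth:
  "(binser c * (A oo inversion)) $ n =
     (\<Sum>i\<le>n. A $ i * ((- 1) ^ i * (of_int (c - int i) gchoose (n - i))))"
proof -
  have coeff: "(binser c * inversion ^ i) $ n =
      (if i \<le> n then (- 1) ^ i * (of_int (c - int i) gchoose (n - i)) else 0)" for i
  proof -
    have "fps_const ((- 1) ^ i) = (- 1 :: complex fps) ^ i"
      by (metis fps_const_power fps_const_neg fps_const_1_eq_1)
    moreover have "binser (c - int i) = binser c * binser (- int i)"
      using binser_add[of c "- int i"] by simp
    ultimately have "binser c * inversion ^ i = fps_const ((- 1) ^ i) * (fps_X ^ i * binser (c - int i))"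
      by (simp only: inversion_power mult_ac)
    then show ?thesis by (simp only: fps_mult_left_const_nth fps_X_power_mult_nth binser_nth) simp
  qed
  have low: "(inversion ^ i) $ s = 0" if "s < i" for i s
    using that by (simp add: startsby_zero_power_prefix)
  have "(binser c * (A oo inversion)) $ n =
      (\<Sum>s\<le>n. binser c $ (n - s) * (\<Sum>i\<le>s. A $ i * (inversion ^ i) $ s))"
    by (subst mult.commute, simp only: fps_mult_nth fps_compose_nth atLeast0AtMost)
       (simp add: mult.commute)
  also have "\<dots> = (\<Sum>s\<le>n. binser c $ (n - s) * (\<Sum>i\<le>n. A $ i * (inversion ^ i) $ s))"
  proof (rule sum.cong[OF refl], rule arg_cong[where f = "(*) _"])
    fix s assume "s \<in> {..n}"
    then show "(\<Sum>i\<le>s. A $ i * (inversion ^ i) $ s) = (\<Sum>i\<le>n. A $ i * (inversion ^ i) $ s)"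
      by (intro sum.mono_neutral_left) (auto simp: low)
  qed
  also have "\<dots> = (\<Sum>i\<le>n. A $ i * (\<Sum>s\<le>n. (inversion ^ i) $ s * binser c $ (n - s)))"
    unfolding sum_distrib_left by (subst sum.swap) (simp add: mult_ac)
  also have "\<dots> = (\<Sum>i\<le>n. A $ i * (binser c * inversion ^ i) $ n)"
    by (subst mult.commute[of "binser c"]) (simp only: fps_mult_nth atLeast0AtMost)
  finally show ?thesis unfolding coeff by simp
qed

subsection \<open>Powers of the difference of two variables\<close>

type_synonym series2 = "int \<Rightarrow> int \<Rightarrow> complex"

text \<open>The product with \<open>(x1 - x2)^n\<close>, expanded in nonnegative powers of
  \<open>x2\<close>. A lower bound on the second exponents of \<open>P\<close>
  (\<open>bounded_snd\<close>) makes the support of the sum finite.\<close>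

definition diff_times :: "int \<Rightarrow> series2 \<Rightarrow> series2" where
  "diff_times n P a b =
     Sum_any (\<lambda>i::nat. (- 1) ^ i * (of_int n gchoose i) * P (a - n + int i) (b - int i))"

definition bounded2 :: "int \<Rightarrow> series2 \<Rightarrow> bool" where
  "bounded2 N F \<longleftrightarrow> (\<forall>m n. m < N \<or> n < N \<longrightarrow> F m n = 0)"

definition bounded_snd :: "int \<Rightarrow> series2 \<Rightarrow> bool" where
  "bounded_snd N P \<longleftrightarrow> (\<forall>m n. n < N \<longrightarrow> P m n = 0)"

lemma bounded_sndI: "(\<And>m n. n < N \<Longrightarrow> P m n = 0) \<Longrightarrow> bounded_snd N P"
  by (simp add: bounded_snd_def)

lemma bounded_sndD: "bounded_snd N P \<Longrightarrow> n < N \<Longrightarrow> P m n = 0"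
  by (simp add: bounded_snd_def)

lemma bounded2_mono: "bounded2 N F \<Longrightarrow> N' \<le> N \<Longrightarrow> bounded2 N' F"
  by (auto simp: bounded2_def)

lemma diff_times_eq_sum:
  assumes "bounded_snd N P" and "b - N < int B"
  shows "diff_times n P a b =
    (\<Sum>i<B. (- 1) ^ i * (of_int n gchoose i) * P (a - n + int i) (b - int i))"
  unfolding diff_times_def
proof (rule Sum_any.expand_superset)
  show "{i. (- 1) ^ i * (of_int n gchoose i) * P (a - n + int i) (b - int i) \<noteq> 0} \<subseteq> {..<B}"
    using assms(2) bounded_sndD[OF assms(1)] by (force simp: not_less)
qed simp

lemma diff_times_bounded:
  assumes "bounded_snd N P" and "b < N"
  shows "diff_times n P a b = 0"
  using assms(2) by (simp add: diff_times_def bounded_sndD[OF assms(1)])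

lemma diff_times_0:
  assumes "bounded_snd N P"
  shows "diff_times 0 P = P"
proof (intro ext)
  fix a b
  have "diff_times 0 P a b = (\<Sum>i<Suc (nat (b - N)). (- 1) ^ i * (of_int 0 gchoose i) * P (a - 0 + int i) (b - int i))"
    by (rule diff_times_eq_sum[OF assms]) auto
  then show "diff_times 0 P a b = P a b"
    by (subst (asm) sum.lessThan_Suc_shift) (simp add: gbinomial_0)
qed

lemma diff_times_Suc:
  assumes "bounded_snd N P"
  shows "diff_times (n + 1) P a b = diff_times n P (a - 1) b - diff_times n P a (b - 1)"
proof -
  define B where "B = Suc (nat (b - N))"
  have pascal: "(of_int (n + 1) gchoose Suc i) = (of_int n gchoose i) + (of_int n gchoose Suc i :: complex)" for i
    by (simp add: gbinomial_Suc_Suc)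
  have "diff_times (n + 1) P a b =
      (\<Sum>i<Suc B. (- 1) ^ i * (of_int (n + 1) gchoose i) * P (a - (n + 1) + int i) (b - int i))"
    by (rule diff_times_eq_sum[OF assms]) (auto simp: B_def)
  also have "\<dots> = P (a - 1 - n) b + (\<Sum>i<B. (- 1) ^ Suc i * (of_int (n + 1) gchoose Suc i) * P (a - n + int i) (b - 1 - int i))"
    by (subst sum.lessThan_Suc_shift) (simp add: algebra_simps)
  also have "\<dots> = (P (a - 1 - n) b + (\<Sum>i<B. (- 1) ^ Suc i * (of_int n gchoose Suc i) * P (a - n + int i) (b - 1 - int i)))
      - (\<Sum>i<B. (- 1) ^ i * (of_int n gchoose i) * P (a - n + int i) (b - 1 - int i))"
    unfolding pascal by (simp add: algebra_simps sum_subtractf sum.distrib sum_negf)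
  also have "P (a - 1 - n) b + (\<Sum>i<B. (- 1) ^ Suc i * (of_int n gchoose Suc i) * P (a - n + int i) (b - 1 - int i)) =
      (\<Sum>i<Suc B. (- 1) ^ i * (of_int n gchoose i) * P (a - 1 - n + int i) (b - int i))"
    by (subst sum.lessThan_Suc_shift) (simp add: algebra_simps)
  also have "\<dots> = diff_times n P (a - 1) b"
    by (rule diff_times_eq_sum[OF assms, symmetric]) (auto simp: B_def)
  also have "(\<Sum>i<B. (- 1) ^ i * (of_int n gchoose i) * P (a - n + int i) (b - 1 - int i)) = diff_times n P a (b - 1)"
    by (rule diff_times_eq_sum[OF assms, symmetric]) (auto simp: B_def)
  finally show ?thesis .
qed

text \<open>The recursion for the coefficients of a product with \<open>x1 - x2\<close> determines
  those with second exponent \<open>b\<close> from those with \<open>b - 1\<close>, and truncation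
  supplies the start.\<close>

lemma diff_unique:
  fixes G H :: series2
  assumes G: "bounded_snd N G" and H: "bounded_snd N H"
    and eq: "\<And>a b. G (a - 1) b - G a (b - 1) = H (a - 1) b - H a (b - 1)"
  shows "G a b = H a b"
proof -
  have "G a (N - 1 + int i) = H a (N - 1 + int i)" for i a
  proof (induction i arbitrary: a)
    case (Suc i)
    show ?case using eq[of "a + 1" "N - 1 + int (Suc i)"] Suc[of "a + 1"] by (simp add: algebra_simps)
  qed (simp add: bounded_sndD[OF G] bounded_sndD[OF H])
  from this[of a "nat (b - (N - 1))"] show ?thesis
    by (cases "b < N") (auto simp: bounded_sndD[OF G] bounded_sndD[OF H])
qed

text \<open>Coefficients of the expansion of \<open>(x - y)\<^bsup>-M-1\<^esup> F\<close> in nonnegative powers of \<open>y\<close>.\<close>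

lemma diff_times_neg:
  fixes a b k N :: int and P F :: series2
  assumes P: "bounded_snd N P"
    and F: "diff_times k P = F" and N: "bounded_snd N F"
    and B: "b + int M - N < int B"
  shows "diff_times (k - int (Suc M)) P a b =
    (\<Sum>i<B. of_nat (i choose M) * F (a + 1 + int i) (b + int M - int i))"
  using B
proof (induction M arbitrary: a b B)
  case 0
  define S where "S = (\<lambda>a b. \<Sum>i<nat (b - N + 1). F (a + 1 + int i) (b - int i))"
  have S_eq: "S a b = (\<Sum>i<B. F (a + 1 + int i) (b - int i))" if "b - N < int B" for a b B
    unfolding S_def by (rule sum.mono_neutral_left) (use that in \<open>auto intro!: bounded_sndD[OF N]\<close>)
  have "diff_times (k - 1) P a b = S a b" for a b
  proof (rule diff_unique[where N = N])
    fix a b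
    have 1: "S (a - 1) b = F a b + (\<Sum>i<nat (b - N). F (a + 1 + int i) (b - 1 - int i))"
      by (subst S_eq[where B = "Suc (nat (b - N))"], simp, subst sum.lessThan_Suc_shift) (simp add: algebra_simps)
    have 2: "S a (b - 1) = (\<Sum>i<nat (b - N). F (a + 1 + int i) (b - 1 - int i))"
      by (rule S_eq) simp
    from 1 2 have "S (a - 1) b - S a (b - 1) = F a b" by simp
    then show "diff_times (k - 1) P (a - 1) b - diff_times (k - 1) P a (b - 1) =
      S (a - 1) b - S a (b - 1)"
      using diff_times_Suc[OF P, where n = "k - 1" and a = a and b = b] F by simp
  next
    show "bounded_snd N (diff_times (k - 1) P)"
      by (rule bounded_sndI) (rule diff_times_bounded[OF P])
  next
    show "bounded_snd N S"
      by (rule bounded_sndI) (simp add: S_def)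
  qed
  with S_eq[where b = b and B = B and a = a] 0 show ?case by simp
next
  case (Suc M)
  let ?D = "diff_times (k - int (Suc (Suc M))) P"
  define S where "S = (\<lambda>a b. \<Sum>i<nat (b + int (Suc M) - N + 1). of_nat (i choose Suc M) * F (a + 1 + int i) (b + int (Suc M) - int i))"
  have S_eq: "S a b = (\<Sum>i<B. of_nat (i choose Suc M) * F (a + 1 + int i) (b + int (Suc M) - int i))"
    if "b + int (Suc M) - N < int B" for a b B
    unfolding S_def by (rule sum.mono_neutral_left) (use that in \<open>auto intro!: bounded_sndD[OF N]\<close>)
  \<comment> \<open>Both sides are truncated below in the second variable and have the same product
    with \<open>x1 - x2\<close>; for \<open>S\<close> this is Pascal's rule after a shift of the
    summation index.\<close>
  have "?D a b = S a b" for a b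
  proof (rule diff_unique[where N = N])
    fix a b
    define B where "B = nat (b + int M - N) + 1"
    have B: "b + int M - N < int B" by (simp add: B_def)
    have "S (a - 1) b = (\<Sum>i<Suc B. of_nat (i choose Suc M) * F (a - 1 + 1 + int i) (b + int (Suc M) - int i))"
      by (rule S_eq) (use B in auto)
    also have "\<dots> = (\<Sum>i<B. of_nat (Suc i choose Suc M) * F (a + 1 + int i) (b + int M - int i))"
      by (subst sum.lessThan_Suc_shift) (simp add: algebra_simps)
    finally have 1: "S (a - 1) b = \<dots>" .
    have 2: "S a (b - 1) = (\<Sum>i<B. of_nat (i choose Suc M) * F (a + 1 + int i) (b + int M - int i))"
      using S_eq[where b = "b - 1" and B = B and a = a] B by (simp add: algebra_simps)
    have "S (a - 1) b - S a (b - 1) = (\<Sum>i<B. of_nat (i choose M) * F (a + 1 + int i) (b + int M - int i))"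
      unfolding 1 2 by (simp add: sum_subtractf[symmetric] algebra_simps)
    also have "\<dots> = diff_times (k - int (Suc M)) P a b"
      using Suc.IH[OF B] by simp
    also have "\<dots> = ?D (a - 1) b - ?D a (b - 1)"
      using diff_times_Suc[OF P, where n = "k - int (Suc (Suc M))" and a = a and b = b] by (simp add: algebra_simps)
    finally show "?D (a - 1) b - ?D a (b - 1) =
      S (a - 1) b - S a (b - 1)" by simp
  next
    show "bounded_snd N ?D"
      by (rule bounded_sndI) (rule diff_times_bounded[OF P])
  next
    show "bounded_snd N S"
    proof (rule bounded_sndI)
      fix a b assume "b < N"
      \<comment> \<open>Only indices \<open>i <= M\<close> reach second exponents that are at least
        \<open>N\<close>, and for these the binomial coefficient vanishes.\<close>
      have "S a b = (\<Sum>i<Suc M. of_nat (i choose Suc M) * F (a + 1 + int i) (b + int (Suc M) - int i))"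
        by (rule S_eq) (use \<open>b < N\<close> in simp)
      also have "\<dots> = 0"
        by (rule sum.neutral) (simp add: binomial_eq_0)
      finally show "S a b = 0" .
    qed
  qed
  with S_eq[where b = b and B = B and a = a] Suc show ?case by simp
qed

lemma diff_times_nat:
  "diff_times (int k) P a b =
    (\<Sum>i\<le>k. (- 1) ^ i * of_nat (k choose i) * P (a - int k + int i) (b - int i))"
proof -
  have "diff_times (int k) P a b =
      (\<Sum>i\<le>k. (- 1) ^ i * (of_int (int k) gchoose i) * P (a - int k + int i) (b - int i))"
    unfolding diff_times_def
    by (rule Sum_any.expand_superset) (auto simp: binomial_gbinomial[symmetric] binomial_eq_0_iff not_less[symmetric])
  then show ?thesis by (simp add: binomial_gbinomial)
qed

subsection \<open>Generating functions along antidiagonals\<close>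

text \<open>The part of \<open>F\<close> of total degree \<open>d\<close> at
  \<open>x1 = (1+z)^s\<close>, \<open>x2 = 1\<close>, as a power series in \<open>z\<close>.\<close>

definition antidiag_gen :: "int \<Rightarrow> series2 \<Rightarrow> int \<Rightarrow> complex fps" where
  "antidiag_gen s F d = Abs_fps (\<lambda>j. Sum_any (\<lambda>m. (of_int (s * m) gchoose j) * F m (d - m)))"

text \<open>The finite set \<open>A\<close> is left free so that sums over different windows of
  exponents can be compared on a common one.\<close>

lemma antidiag_gen_eq_sum:
  assumes "bounded2 N F" and "finite A" and "{N..d - N} \<subseteq> A"
  shows "antidiag_gen s F d = (\<Sum>m\<in>A. binser (s * m) * fps_const (F m (d - m)))"
proof (rule fps_ext)
  fix j
  have "F m (d - m) = 0" if "m \<notin> A" for m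
  proof -
    have "m < N \<or> d - m < N"
    proof (rule ccontr)
      assume "\<not> (m < N \<or> d - m < N)"
      then have "m \<in> {N..d - N}" by simp
      with assms(3) that show False by blast
    qed
    then show ?thesis using assms(1) by (auto simp: bounded2_def)
  qed
  then have "antidiag_gen s F d $ j = (\<Sum>m\<in>A. (of_int (s * m) gchoose j) * F m (d - m))"
    unfolding antidiag_gen_def
    by (simp, intro Sum_any.expand_superset) (use assms in auto)
  then show "antidiag_gen s F d $ j = (\<Sum>m\<in>A. binser (s * m) * fps_const (F m (d - m))) $ j"
    by (simp add: fps_sum_nth)
qed

lemma antidiag_gen_uminus:
  assumes "bounded2 N F"
  shows "antidiag_gen (- s) F d = antidiag_gen s F d oo inversion"
  unfolding antidiag_gen_eq_sum[OF assms finite_atLeastAtMost_int order_refl]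
  by (simp add: fps_compose_sum_distrib fps_compose_mult_distrib binser_compose_inversion)

lemma antidiag_gen_shift:
  assumes "bounded2 N F"
  shows "antidiag_gen s (\<lambda>m n. F (m - a) (n - b)) d = binser (s * a) * antidiag_gen s F (d - a - b)"
proof -
  define N' where "N' = min (N + a) (N + b)"
  have b': "bounded2 N' (\<lambda>m n. F (m - a) (n - b))"
    using assms by (auto simp: bounded2_def N'_def)
  have "antidiag_gen s (\<lambda>m n. F (m - a) (n - b)) d =
      (\<Sum>m\<in>{N'..d - N'} \<union> {N + a..d - b - N}. binser (s * m) * fps_const (F (m - a) (d - m - b)))"
    by (rule antidiag_gen_eq_sum[OF b']) auto
  also have "\<dots> = (\<Sum>m\<in>(\<lambda>m. m - a) ` ({N'..d - N'} \<union> {N + a..d - b - N}).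
      binser (s * a) * (binser (s * m) * fps_const (F m (d - a - b - m))))"
    by (subst sum.reindex) (auto simp: inj_on_def binser_add[symmetric] mult.assoc[symmetric] algebra_simps intro!: sum.cong)
  also have "\<dots> = binser (s * a) * antidiag_gen s F (d - a - b)"
  proof -
    have "x \<in> (\<lambda>m. m - a) ` ({N'..d - N'} \<union> {N + a..d - b - N})" if "x \<in> {N..d - a - b - N}" for x
      using that by (intro image_eqI[of _ _ "x + a"]) auto
    then show ?thesis
      unfolding sum_distrib_left[symmetric]
      by (subst antidiag_gen_eq_sum[OF assms, where A = "(\<lambda>m. m - a) ` ({N'..d - N'} \<union> {N + a..d - b - N})"]) auto
  qed
  finally show ?thesis .
qed

lemma antidiag_gen_add:
  assumes "bounded2 N F" "bounded2 N G"
  shows "antidiag_gen s (\<lambda>m n. F m n + G m n) d = antidiag_gen s F d + antidiag_gen s G d"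
proof -
  have "bounded2 N (\<lambda>m n. F m n + G m n)" using assms by (simp add: bounded2_def)
  from this assms show ?thesis
    by (simp add: antidiag_gen_eq_sum[OF _ finite_atLeastAtMost_int order_refl] sum.distrib[symmetric]
        fps_const_add[symmetric] algebra_simps del: fps_const_add)
qed

lemma antidiag_gen_scale:
  assumes "bounded2 N F"
  shows "antidiag_gen s (\<lambda>m n. c * F m n) d = fps_const c * antidiag_gen s F d"
proof -
  have "bounded2 N (\<lambda>m n. c * F m n)" using assms by (simp add: bounded2_def)
  from this assms show ?thesis
    by (simp add: antidiag_gen_eq_sum[OF _ finite_atLeastAtMost_int order_refl] sum_distrib_left
        fps_const_mult[symmetric] mult_ac del: fps_const_mult)
qed

lemma antidiag_gen_diff:
  assumes "bounded2 N F"
  shows "antidiag_gen s (\<lambda>m n. F (m - 1) n - F m (n - 1)) d = (binser s - 1) * antidiag_gen s F (d - 1)"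
proof -
  have b: "bounded2 N (\<lambda>m n. F (m - 1) (n - 0))" "bounded2 N (\<lambda>m n. F (m - 0) (n - 1))"
    using assms by (auto simp: bounded2_def)
  then have b3: "bounded2 N (\<lambda>m n. (- 1) * F (m - 0) (n - 1))" by (simp add: bounded2_def)
  have "antidiag_gen s (\<lambda>m n. F (m - 1) (n - 0) + (- 1) * F (m - 0) (n - 1)) d =
      binser s * antidiag_gen s F (d - 1) - antidiag_gen s F (d - 1)"
    unfolding antidiag_gen_add[OF b(1) b3] antidiag_gen_scale[OF b(2)] antidiag_gen_shift[OF assms]
    by (simp add: fps_const_neg[symmetric] del: fps_const_neg)
  then show ?thesis by (simp add: algebra_simps)
qed

text \<open>Exchanging the variables replaces \<open>m\<close> by \<open>d - m\<close>, and
  \<open>(1+z)^(d-m)\<close> is \<open>(1+z)^d\<close> times an inverted power. This is the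
  mechanism behind commutativity.\<close>

lemma antidiag_gen_swap:
  assumes "bounded2 N F"
  shows "antidiag_gen 1 (\<lambda>m n. F n m) d = binser d * (antidiag_gen 1 F d oo inversion)"
proof -
  have "bounded2 N (\<lambda>m n. F n m)" using assms by (auto simp: bounded2_def)
  then have "antidiag_gen 1 (\<lambda>m n. F n m) d = (\<Sum>m\<in>{N..d - N}. binser m * fps_const (F (d - m) m))"
    using antidiag_gen_eq_sum[of N "\<lambda>m n. F n m" "{N..d - N}" d 1] by simp
  also have "\<dots> = (\<Sum>m\<in>{N..d - N}. binser d * (binser (- m) * fps_const (F m (d - m))))"
    by (rule sum.reindex_bij_witness[of _ "\<lambda>m. d - m" "\<lambda>m. d - m"])
       (auto simp: binser_add[symmetric] mult.assoc[symmetric])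
  also have "\<dots> = binser d * antidiag_gen (- 1) F d"
    by (simp add: antidiag_gen_eq_sum[OF assms finite_atLeastAtMost_int order_refl] sum_distrib_left)
  finally show ?thesis using antidiag_gen_uminus[OF assms, of 1] by simp
qed

text \<open>A Laurent polynomial is determined by its Taylor expansion at 1. After multiplication by
  \<open>(1+z)^(-N)\<close> all exponents are nonnegative, and the coefficients of the powers of
  \<open>z\<close> form a triangular system, solved from the top exponent downwards.\<close>

lemma antidiag_gen_inject:
  assumes F: "bounded2 N F" and G: "bounded2 N G" and eq: "\<And>d. antidiag_gen 1 F d = antidiag_gen 1 G d"
  shows "F = G"
proof (intro ext)
  fix m n :: int
  define d where "d = m + n"
  define f where "f = (\<lambda>m. F m (d - m) - G m (d - m))"
  have out: "f m = 0" if "m \<notin> {N..d - N}" for m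
    using that F G by (auto simp: f_def bounded2_def)
  have "(\<Sum>m=N..d - N. binser m * fps_const (f m)) = 0"
    using eq[of d] unfolding f_def
    by (simp add: antidiag_gen_eq_sum[OF F finite_atLeastAtMost_int order_refl]
        antidiag_gen_eq_sum[OF G finite_atLeastAtMost_int order_refl]
        fps_const_sub[symmetric] right_diff_distrib sum_subtractf del: fps_const_sub)
  then have "binser (- N) * (\<Sum>m=N..d - N. binser m * fps_const (f m)) = 0" by simp
  then have "(\<Sum>m=N..d - N. binser (m - N) * fps_const (f m)) = 0"
    by (simp add: sum_distrib_left mult.assoc[symmetric] binser_add[symmetric])
  then have "(\<Sum>m=N..d - N. binser (m - N) * fps_const (f m)) $ j = 0" for j by simp
  then have mom: "(\<Sum>m=N..d - N. (of_int (m - N) gchoose j) * f m) = 0" for j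
    by (simp add: fps_sum_nth)
  have zero: "f (N + int i) = 0" for i
  proof (induction "nat (d - N - N) - i" arbitrary: i rule: less_induct)
    case less
    show ?case
    proof (cases "N + int i \<le> d - N")
      case True
      \<comment> \<open>In the moment of order \<open>i\<close>, smaller exponents have a vanishing
        binomial coefficient and larger ones vanish by induction, so only
        \<open>f (N + int i)\<close> remains.\<close>
      have "(of_int (m - N) gchoose i) * f m = 0" if "m \<in> {N..d - N}" "m \<noteq> N + int i" for m
      proof (cases "m < N + int i")
        case True
        define l where "l = nat (m - N)"
        have "m - N = int l" "l < i" using True that by (auto simp: l_def)
        then have "(of_int (m - N) gchoose i :: complex) = 0"
          by (simp add: binomial_gbinomial[symmetric] binomial_eq_0)
        then show ?thesis by simp
      next
        case False
        then have "f (N + int (nat (m - N))) = 0"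
          using that True by (intro less) auto
        then show ?thesis using that False by simp
      qed
      then have "(\<Sum>m=N..d - N. (of_int (m - N) gchoose i) * f m) = (\<Sum>m\<in>{N + int i}. (of_int (m - N) gchoose i) * f m)"
        using True by (intro sum.mono_neutral_right) auto
      then show ?thesis using mom[of i] by (simp add: binomial_gbinomial[symmetric])
    qed (simp add: out)
  qed
  have "f m = 0"
    using zero[of "nat (m - N)"] out[of m] by (cases "m \<ge> N") auto
  then have "F m (d - m) = G m (d - m)" unfolding f_def by (rule eq_iff_diff_eq_0[THEN iffD2])
  moreover have "d - m = n" by (simp add: d_def)
  ultimately show "F m n = G m n" by (simp only:)
qed

subsection \<open>Expansions at the diagonal\<close>

text \<open>The coordinate at the diagonal is \<open>x\<^sub>1 = x\<^sub>2 + z\<close> for \<open>s = 1\<close> and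
  \<open>x\<^sub>1 = x\<^sub>2 / (1 + z x\<^sub>2)\<close> for \<open>s = -1\<close>; since everything is homogeneous, \<open>x\<^sub>2\<close> is set to \<open>1\<close>
  and \<open>(x\<^sub>1 - x\<^sub>2)\<^sup>k\<close> becomes \<open>z\<^sup>k\<close> times \<open>coord_unit s k\<close>.\<close>

definition coord_unit :: "int \<Rightarrow> nat \<Rightarrow> complex fps" where
  "coord_unit s k = (if s = 1 then 1 else (- 1) ^ k * binser (- int k))"

text \<open>The variable \<open>z\<close> is homogeneous of degree \<open>s\<close>: it is
  \<open>x1 - x2\<close> for \<open>s = 1\<close> and \<open>1/x1 - 1/x2\<close> for
  \<open>s = -1\<close>. So the total degree and the power of \<open>z\<close> determine the power
  of \<open>x2\<close>. The shift by \<open>k\<close> is the factor \<open>z^k\<close> that clears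
  the pole.\<close>

definition expansion_series :: "int \<Rightarrow> nat \<Rightarrow> series2 \<Rightarrow> int \<Rightarrow> complex fps" where
  "expansion_series s k Q d = Abs_fps (\<lambda>i. Q (int i - int k) (d - int k - s * (int i - int k)))"

text \<open>A power series sees only the exponents \<open>j >= -k\<close>, so the absence of deeper
  poles in \<open>Q\<close> has to be demanded separately.\<close>

definition expands :: "int \<Rightarrow> nat \<Rightarrow> series2 \<Rightarrow> series2 \<Rightarrow> bool" where
  "expands s k F Q \<longleftrightarrow> (\<forall>j r. j < - int k \<longrightarrow> Q j r = 0) \<and>
     (\<forall>d. antidiag_gen s F d = coord_unit s k * expansion_series s k Q d)"

lemma expansion_series_nth [simp]:
  "expansion_series s k Q d $ i = Q (int i - int k) (d - int k - s * (int i - int k))"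
  by (simp add: expansion_series_def)

lemma coord_unit_Suc: "coord_unit s (Suc k) = coord_unit s 1 * coord_unit s k"
  by (auto simp: coord_unit_def binser_add[symmetric] mult_ac)

lemma binser_minus_1:
  assumes "s = 1 \<or> s = - 1"
  shows "binser s - 1 = fps_X * coord_unit s 1"
  using assms inversion_eq by (auto simp: coord_unit_def binser_1 inversion_def)

text \<open>The inversion interchanges the two coordinates, so \<open>z^k\<close> times one unit is
  carried to \<open>z^k\<close> times the other; the correction is the quotient of
  \<open>z^k\<close> by \<open>inversion^k\<close>.\<close>

lemma coord_unit_compose:
  assumes "s = 1 \<or> s = - 1"
  shows "coord_unit s k oo inversion = coord_unit (- s) k * ((- 1) ^ k * binser (int k))"
proof (cases "s = 1")
  case True
  have "(- 1) ^ k * binser (- int k) * ((- 1) ^ k * binser (int k)) =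
      ((- 1) ^ k * (- 1) ^ k) * (binser (int k) * binser (- int k))"
    by (simp only: mult_ac)
  also have "\<dots> = 1" by (simp only: binser_uminus power_mult_distrib[symmetric]) simp
  finally show ?thesis using True by (simp add: coord_unit_def)
next
  case False
  have "(- 1) ^ k oo inversion = (- 1 oo inversion) ^ k"
    by (simp add: fps_compose_power)
  also have "- 1 oo inversion = - 1"
    using fps_compose_uminus[of 1 inversion] by simp
  finally show ?thesis using False assms
    by (simp add: coord_unit_def fps_compose_mult_distrib binser_compose_inversion)
qed

text \<open>A further factor \<open>x1 - x2\<close> becomes \<open>z\<close> times
  \<open>coord_unit s 1\<close>. The factor \<open>z\<close> shifts the expansion by one place, and
  the new lowest coefficient is zero by the pole condition in \<open>expands\<close>.\<close>

lemma expands_Suc: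
  assumes s: "s = 1 \<or> s = - 1" and P: "bounded_snd N P"
    and F: "bounded2 N (diff_times (int k) P)" and e: "expands s k (diff_times (int k) P) Q"
  shows "bounded2 N (diff_times (int (Suc k)) P)" and "expands s (Suc k) (diff_times (int (Suc k)) P) Q"
proof -
  let ?F = "diff_times (int k) P"
  have eq: "diff_times (int (Suc k)) P = (\<lambda>m n. ?F (m - 1) n - ?F m (n - 1))"
    using diff_times_Suc[OF P, of "int k"] by (intro ext) (simp add: add.commute)
  show "bounded2 N (diff_times (int (Suc k)) P)"
    using F unfolding eq by (simp add: bounded2_def)
  have "antidiag_gen s (diff_times (int (Suc k)) P) d =
      coord_unit s (Suc k) * expansion_series s (Suc k) Q d" for d
  proof -
    have "fps_X * expansion_series s k Q (d - 1) = expansion_series s (Suc k) Q d"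
    proof (rule fps_ext)
      fix i show "(fps_X * expansion_series s k Q (d - 1)) $ i = expansion_series s (Suc k) Q d $ i"
        using e by (cases i) (auto simp: expands_def algebra_simps)
    qed
    moreover have "antidiag_gen s (diff_times (int (Suc k)) P) d =
        fps_X * coord_unit s 1 * (coord_unit s k * expansion_series s k Q (d - 1))"
      unfolding eq antidiag_gen_diff[OF F] binser_minus_1[OF s] using e by (simp add: expands_def)
    ultimately show ?thesis by (metis coord_unit_Suc mult.assoc mult.commute)
  qed
  then show "expands s (Suc k) (diff_times (int (Suc k)) P) Q"
    using e by (auto simp: expands_def)
qed

lemma expands_add:
  assumes "bounded2 N F" "bounded2 N F'" "expands s k F Q" "expands s k F' Q'"
  shows "expands s k (\<lambda>m n. F m n + F' m n) (\<lambda>j r. Q j r + Q' j r)"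
proof -
  have "expansion_series s k (\<lambda>j r. Q j r + Q' j r) d = expansion_series s k Q d + expansion_series s k Q' d" for d
    by (rule fps_ext) simp
  then show ?thesis using assms by (auto simp: expands_def antidiag_gen_add algebra_simps)
qed

lemma expands_scale:
  assumes "bounded2 N F" "expands s k F Q"
  shows "expands s k (\<lambda>m n. c * F m n) (\<lambda>j r. c * Q j r)"
proof -
  have "expansion_series s k (\<lambda>j r. c * Q j r) d = fps_const c * expansion_series s k Q d" for d
    by (rule fps_ext) simp
  then show ?thesis using assms by (auto simp: expands_def antidiag_gen_scale mult_ac)
qed

text \<open>The exponents are those produced by the factors \<open>x\<^sub>1\<^bsup>s\<alpha>\<^esup> x\<^sub>2\<^bsup>s\<beta>\<^esup>\<close>, where
  \<open>x\<^sub>1 = x\<^sub>2 (1 + z)\<^bsup>\<plusminus>1\<^esup>\<close>.\<close>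

lemma expands_transform:
  fixes s :: int and \<alpha> \<beta> :: "'x \<Rightarrow> int" and F Q :: "'x \<Rightarrow> series2"
  assumes s: "s = 1 \<or> s = - 1" and A: "finite A"
    and F: "\<And>x. x \<in> A \<Longrightarrow> bounded2 N (F x)" and e: "\<And>x. x \<in> A \<Longrightarrow> expands s k (F x) (Q x)"
    and Q'0: "\<And>j r. j < - int k \<Longrightarrow> Q' j r = 0"
    and Q': "\<And>n r. Q' (int n - int k) r = (\<Sum>x\<in>A. c x * (\<Sum>i\<le>n. (- 1) ^ (i + k) *
        (of_int (- \<alpha> x - (int i - int k)) gchoose (n - i)) *
        Q x (int i - int k) (r - s * ((int n - int k) + (int i - int k) + \<alpha> x + \<beta> x))))"
    and F': "\<And>m n. F' m n = (\<Sum>x\<in>A. c x * F x (m - s * \<alpha> x) (n - s * \<beta> x))"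
  shows "expands (- s) k F' Q'"
proof -
  have s2: "s * (s * a) = a" for a using s by auto
  obtain N' where N': "\<And>x. x \<in> A \<Longrightarrow> N' \<le> N + s * \<alpha> x \<and> N' \<le> N + s * \<beta> x"
  proof
    fix x assume "x \<in> A"
    then show "Min (insert 0 ((\<lambda>x. N + s * \<alpha> x) ` A \<union> (\<lambda>x. N + s * \<beta> x) ` A)) \<le> N + s * \<alpha> x \<and>
      Min (insert 0 ((\<lambda>x. N + s * \<alpha> x) ` A \<union> (\<lambda>x. N + s * \<beta> x) ` A)) \<le> N + s * \<beta> x"
      using A by (auto intro!: Min_le)
  qed
  have bx: "bounded2 N' (\<lambda>m n. F x (m - s * \<alpha> x) (n - s * \<beta> x))" if "x \<in> A" for x
    using F[OF that] N'[OF that] by (auto simp: bounded2_def)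
  have sums: "bounded2 N' (\<lambda>m n. (\<Sum>x\<in>S. c x * F x (m - s * \<alpha> x) (n - s * \<beta> x))) \<and>
     antidiag_gen (- s) (\<lambda>m n. (\<Sum>x\<in>S. c x * F x (m - s * \<alpha> x) (n - s * \<beta> x))) d =
      (\<Sum>x\<in>S. fps_const (c x) * antidiag_gen (- s) (\<lambda>m n. F x (m - s * \<alpha> x) (n - s * \<beta> x)) d)"
    if "S \<subseteq> A" for S d
    using finite_subset[OF that A] that
  proof (induction S rule: finite_induct)
    case empty
    show ?case by (auto simp: bounded2_def antidiag_gen_def intro!: fps_ext)
  next
    case (insert x S)
    have "bounded2 N' (\<lambda>m n. c x * F x (m - s * \<alpha> x) (n - s * \<beta> x))"
      using bx[of x] insert.prems by (simp add: bounded2_def)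
    with insert show ?case
      by (auto simp: antidiag_gen_add antidiag_gen_scale[OF bx] simp del: antidiag_gen_def) (auto simp: bounded2_def)
  qed
  have unit: "coord_unit s k oo inversion = coord_unit (- s) k * ((- 1) ^ k * binser (int k))"
    by (rule coord_unit_compose[OF s])
  have "antidiag_gen (- s) F' d = coord_unit (- s) k * expansion_series (- s) k Q' d" for d
  proof -
    let ?A = "\<lambda>x. expansion_series s k (Q x) (d - s * \<alpha> x - s * \<beta> x)"
    have "antidiag_gen (- s) F' d =
        (\<Sum>x\<in>A. fps_const (c x) * antidiag_gen (- s) (\<lambda>m n. F x (m - s * \<alpha> x) (n - s * \<beta> x)) d)"
      using sums[OF order_refl] by (simp add: F'[abs_def])
    also have "\<dots> = (\<Sum>x\<in>A. coord_unit (- s) k * (fps_const (c x * (- 1) ^ k) * (binser (int k - \<alpha> x) * (?A x oo inversion))))"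
    proof (rule sum.cong[OF refl])
      fix x assume x: "x \<in> A"
      \<comment> \<open>At \<open>x1 = (1+z)^(-s)\<close> the monomial
        \<open>x1^(s \<alpha>)\<close> is \<open>(1+z)^(-\<alpha>)\<close> because
        \<open>s * s = 1\<close>; with \<open>x2 = 1\<close> the exponent \<beta> survives only in
        the degree.\<close>
      have "antidiag_gen (- s) (\<lambda>m n. F x (m - s * \<alpha> x) (n - s * \<beta> x)) d =
          binser (- \<alpha> x) * (antidiag_gen s (F x) (d - s * \<alpha> x - s * \<beta> x) oo inversion)"
        using antidiag_gen_shift[OF F[OF x], of "- s" "s * \<alpha> x" "s * \<beta> x" d] antidiag_gen_uminus[OF F[OF x], of s]
        by (simp add: s2)
      also have "\<dots> = binser (- \<alpha> x) * ((coord_unit (- s) k * ((- 1) ^ k * binser (int k))) * (?A x oo inversion))"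
        using e[OF x] unit by (simp add: expands_def fps_compose_mult_distrib)
      also have "\<dots> = coord_unit (- s) k * ((- 1) ^ k * (binser (- \<alpha> x) * binser (int k)) * (?A x oo inversion))"
        by (simp only: mult_ac)
      also have "binser (- \<alpha> x) * binser (int k) = binser (int k - \<alpha> x)"
        by (simp add: binser_add[symmetric])
      also have "(- 1) ^ k = fps_const ((- 1 :: complex) ^ k)"
        by (metis fps_const_power fps_const_neg fps_const_1_eq_1)
      finally show "fps_const (c x) * antidiag_gen (- s) (\<lambda>m n. F x (m - s * \<alpha> x) (n - s * \<beta> x)) d =
          coord_unit (- s) k * (fps_const (c x * (- 1) ^ k) * (binser (int k - \<alpha> x) * (?A x oo inversion)))"
        by (simp only: fps_const_mult[symmetric] mult_ac)
    qed
    also have "\<dots> = coord_unit (- s) k * (\<Sum>x\<in>A. fps_const (c x * (- 1) ^ k) * (binser (int k - \<alpha> x) * (?A x oo inversion)))"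
      by (simp only: sum_distrib_left)
    also have "(\<Sum>x\<in>A. fps_const (c x * (- 1) ^ k) * (binser (int k - \<alpha> x) * (?A x oo inversion))) =
        expansion_series (- s) k Q' d"
    proof (rule fps_ext)
      fix n
      \<comment> \<open>The upper entry \<open>k - \<alpha> - i\<close> given by
        \<open>binser_times_compose_nth\<close> is the \<open>- \<alpha> - (i - k)\<close> in the
        hypothesis on \<open>Q'\<close>.\<close>
      have "(fps_const (c x * (- 1) ^ k) * (binser (int k - \<alpha> x) * (?A x oo inversion))) $ n =
          c x * (\<Sum>i\<le>n. (- 1) ^ (i + k) * (of_int (- \<alpha> x - (int i - int k)) gchoose (n - i)) *
            Q x (int i - int k) (d - int k + s * (int n - int k) - s * ((int n - int k) + (int i - int k) + \<alpha> x + \<beta> x)))" for x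
        unfolding fps_mult_left_const_nth binser_times_compose_nth mult.assoc sum_distrib_left
        by (rule sum.cong[OF refl]) (simp add: power_add algebra_simps)
      moreover have "expansion_series (- s) k Q' d $ n = Q' (int n - int k) (d - int k + s * (int n - int k))"
        by simp
      ultimately show "(\<Sum>x\<in>A. fps_const (c x * (- 1) ^ k) * (binser (int k - \<alpha> x) * (?A x oo inversion))) $ n =
          expansion_series (- s) k Q' d $ n"
        by (simp only: fps_sum_nth Q')
    qed
    finally show ?thesis .
  qed
  with Q'0 show ?thesis by (auto simp: expands_def)
qed

subsection \<open>The Jacobi identity and expansions\<close>

text \<open>Here \<open>P\<close>, \<open>P2\<close> and \<open>Q\<close> are matrix coefficients of \<open>Y\<^sub>W(u,x\<^sub>1)Y\<^sub>W(v,x\<^sub>2)\<close>,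
  \<open>Y\<^sub>W(v,x\<^sub>1)Y\<^sub>W(u,x\<^sub>2)\<close> and \<open>Y\<^sub>W(Y(u,z)v,x\<^sub>2)\<close>; the identity is the coefficient of
  \<open>x\<^sub>0\<^bsup>-n-1\<^esup>x\<^sub>1\<^sup>ax\<^sub>2\<^sup>b\<close>.\<close>

definition scalar_jacobi :: "series2 \<Rightarrow> series2 \<Rightarrow> series2 \<Rightarrow> bool" where
  "scalar_jacobi P P2 Q \<longleftrightarrow> (\<forall>n a b.
     diff_times n P a b - (- 1) powi n * diff_times n P2 b a =
     Sum_any (\<lambda>p::nat. (of_int (- a - 1) gchoose p) * Q (- n - 1 - int p) (b + 1 + a + int p)))"

text \<open>The two terms expand the same negative power \<open>(x1 - x2)^(-M-1)\<close> in opposite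
  regions. Their difference is a derivative of a delta function: the two half-infinite sums join to
  one over the whole antidiagonal, with weights \<open>m - a - 1\<close> over \<open>M\<close>, and
  that is a Taylor coefficient at the diagonal.\<close>

lemma jacobi_side_eq_gen:
  fixes a b :: int and M :: nat
  assumes P: "bounded_snd N P" and P2: "bounded_snd N P2"
    and comm: "\<And>a b. diff_times (int k) P2 a b = (- 1) ^ k * diff_times (int k) P b a"
    and bF: "bounded2 N (diff_times (int k) P)"
  defines "n \<equiv> int k - int (Suc M)"
  shows "diff_times n P a b - (- 1) powi n * diff_times n P2 b a =
    (binser (- a - 1) * antidiag_gen 1 (diff_times (int k) P) (a + b + int (Suc M))) $ M"
proof -
  let ?F = "diff_times (int k) P"
  define d where "d = a + b + int (Suc M)"
  define B where "B = nat (\<bar>a\<bar> + \<bar>b\<bar> + \<bar>N\<bar> + \<bar>d\<bar> + int M) + 1"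
  let ?g = "\<lambda>m. (of_int (m - a - 1) gchoose M) * ?F m (d - m)"
  have F: "bounded_snd N ?F" "bounded_snd N (diff_times (int k) P2)"
    using bF by (auto intro!: bounded_sndI simp: comm bounded2_def)
  have 1: "diff_times n P a b = (\<Sum>m\<in>{a + 1..a + int B}. ?g m)"
  proof -
    have "diff_times n P a b = (\<Sum>i<B. of_nat (i choose M) * ?F (a + 1 + int i) (b + int M - int i))"
      unfolding n_def by (rule diff_times_neg[OF P refl F(1)]) (auto simp: B_def)
    also have "\<dots> = (\<Sum>m\<in>{a + 1..a + int B}. ?g m)"
      by (rule sum.reindex_bij_witness[of _ "\<lambda>m. nat (m - a - 1)" "\<lambda>i. a + 1 + int i"])
         (auto simp: binomial_gbinomial d_def algebra_simps)
    finally show ?thesis .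
  qed
  have 2: "(- 1) powi n * diff_times n P2 b a = - (\<Sum>m\<in>{a + int M + 1 - int B..a + int M}. ?g m)"
  proof -
    have sg: "(- 1) powi n * (- 1) ^ k = - ((- 1 :: complex) ^ M)"
    proof -
      have "(- 1) powi n * (- 1) ^ k = ((- 1) powi (n + int k) :: complex)"
        by (simp add: power_int_add)
      also have "n + int k = 2 * (int k - int (Suc M)) + int (Suc M)" by (simp add: n_def)
      also have "(- 1) powi (2 * (int k - int (Suc M)) + int (Suc M)) = ((- 1) powi 2) powi (int k - int (Suc M)) * ((- 1) ^ Suc M :: complex)"
        by (subst power_int_add, simp, subst power_int_mult, subst power_int_of_nat) (rule refl)
      finally show ?thesis by simp
    qed
    have "diff_times n P2 b a = (\<Sum>i<B. of_nat (i choose M) * diff_times (int k) P2 (b + 1 + int i) (a + int M - int i))"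
      unfolding n_def by (rule diff_times_neg[OF P2 refl F(2)]) (auto simp: B_def)
    also have "\<dots> = (\<Sum>i<B. (- 1) ^ k * (of_nat (i choose M) * ?F (a + int M - int i) (b + 1 + int i)))"
      by (simp add: comm mult_ac)
    finally have "(- 1) powi n * diff_times n P2 b a =
        (\<Sum>i<B. (- 1) powi n * (- 1) ^ k * (of_nat (i choose M) * ?F (a + int M - int i) (b + 1 + int i)))"
      by (simp add: sum_distrib_left mult_ac)
    also have "\<dots> = - (\<Sum>i<B. (- 1) ^ M * (of_nat (i choose M) * ?F (a + int M - int i) (b + 1 + int i)))"
      unfolding sg by (simp add: sum_negf)
    also have "(\<Sum>i<B. (- 1) ^ M * (of_nat (i choose M) * ?F (a + int M - int i) (b + 1 + int i))) =
        (\<Sum>m\<in>{a + int M + 1 - int B..a + int M}. ?g m)"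
    proof (rule sum.reindex_bij_witness[of _ "\<lambda>m. nat (a + int M - m)" "\<lambda>i. a + int M - int i"])
      fix i assume "i \<in> {..<B}"
      \<comment> \<open>Upper negation identifies the binomial of the opposite expansion with that
        of the first; its sign cancels the \<open>(- 1) ^ M\<close> left over by
        \<open>sg\<close>.\<close>
      have "(of_int (a + int M - int i - a - 1) gchoose M :: complex) = (- (of_int (1 + int i - int M)) gchoose M)"
        by (rule arg_cong[where f = "\<lambda>x. x gchoose M"]) simp
      also have "\<dots> = (- 1) ^ M * (of_int (int i) gchoose M)"
        by (subst gbinomial_minus) simp
      finally show "?g (a + int M - int i) = (- 1) ^ M * (of_nat (i choose M) * ?F (a + int M - int i) (b + 1 + int i))"
        by (simp add: binomial_gbinomial d_def algebra_simps)
    qed auto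
    finally show ?thesis .
  qed
  \<comment> \<open>The two half-lines overlap in these exponents, where \<open>m - a - 1\<close> is
    a natural number below \<open>M\<close>.\<close>
  have z: "?g m = 0" if "m \<in> {a + 1..a + int M}" for m
  proof -
    define l where "l = nat (m - a - 1)"
    have "m - a - 1 = int l" "l < M" using that by (auto simp: l_def)
    then have "(of_int (m - a - 1) gchoose M :: complex) = 0"
      by (simp add: binomial_gbinomial[symmetric] binomial_eq_0)
    then show ?thesis by simp
  qed
  have "(\<Sum>m\<in>{a + int M + 1 - int B..a + int M}. ?g m) = (\<Sum>m\<in>{a + int M + 1 - int B..a}. ?g m)"
    by (rule sum.mono_neutral_right, simp, simp, intro ballI z) auto
  with 1 2 have "diff_times n P a b - (- 1) powi n * diff_times n P2 b a =
      (\<Sum>m\<in>{a + int M + 1 - int B..a}. ?g m) + (\<Sum>m\<in>{a + 1..a + int B}. ?g m)"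
    by simp
  also have "\<dots> = (\<Sum>m\<in>{a + int M + 1 - int B..a} \<union> {a + 1..a + int B}. ?g m)"
    by (rule sum.union_disjoint[symmetric]) auto
  also have "\<dots> = (binser (- a - 1) * antidiag_gen 1 ?F d) $ M"
  proof -
    have "antidiag_gen 1 ?F d = (\<Sum>m\<in>{a + int M + 1 - int B..a} \<union> {a + 1..a + int B}. binser (1 * m) * fps_const (?F m (d - m)))"
      by (rule antidiag_gen_eq_sum[OF bF]) (auto simp: B_def)
    then have "binser (- a - 1) * antidiag_gen 1 ?F d =
        (\<Sum>m\<in>{a + int M + 1 - int B..a} \<union> {a + 1..a + int B}. binser (m - a - 1) * fps_const (?F m (d - m)))"
      by (simp add: sum_distrib_left mult.assoc[symmetric] binser_add[symmetric] algebra_simps)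
    then show ?thesis by (simp add: fps_sum_nth)
  qed
  finally show ?thesis by (simp add: d_def)
qed

text \<open>At \<open>n = k\<close> the pole condition kills the right-hand side of the Jacobi
  identity, which leaves commutativity after multiplication by \<open>(x1 - x2)^k\<close>. The
  truncation in \<open>x1\<close> is then inherited from the opposite product, where
  \<open>x1\<close> belongs to the inner operator.\<close>

lemma expands_of_jacobi:
  assumes P: "bounded_snd N P" and P2: "bounded_snd N P2"
    and Q: "\<And>j r. j < - int k \<Longrightarrow> Q j r = 0" and jac: "scalar_jacobi P P2 Q"
  shows "bounded2 N (diff_times (int k) P)" and "expands 1 k (diff_times (int k) P) Q"
proof -
  have comm': "diff_times (int k) P a b = (- 1) ^ k * diff_times (int k) P2 b a" for a b
    using jac[unfolded scalar_jacobi_def, rule_format, of "int k" a b] by (simp add: Q)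
  then have comm: "diff_times (int k) P2 a b = (- 1) ^ k * diff_times (int k) P b a" for a b
    by (simp add: mult.assoc[symmetric] power_mult_distrib[symmetric])
  have "diff_times (int k) P a b = 0" if "a < N" for a b
    unfolding comm' using diff_times_bounded[OF P2 that] by simp
  then show b2: "bounded2 N (diff_times (int k) P)"
    using diff_times_bounded[OF P] by (auto simp: bounded2_def)
  have "antidiag_gen 1 (diff_times (int k) P) d $ j = Q (int j - int k) (d - int j)" for d j
  proof -
    define n where "n = int k - int (Suc j)"
    \<comment> \<open>At \<open>a = -1\<close> the prefactor \<open>(1+z)^(-a-1)\<close> is 1 and
      \<open>0 gchoose p\<close> keeps only \<open>p = 0\<close>, so each Taylor coefficient is one
      instance of the identity.\<close>
    have "antidiag_gen 1 (diff_times (int k) P) d $ j =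
        diff_times n P (- 1) (d - int j) - (- 1) powi n * diff_times n P2 (d - int j) (- 1)"
      unfolding n_def
      by (subst jacobi_side_eq_gen[OF P P2 comm b2]) simp
    also have "\<dots> = Sum_any (\<lambda>p::nat. (of_int (- (- 1) - 1) gchoose p) * Q (- n - 1 - int p) (d - int j + 1 + (- 1) + int p))"
      using jac[unfolded scalar_jacobi_def] by blast
    also have "\<dots> = Sum_any (\<lambda>p::nat. if p = 0 then Q (- n - 1) (d - int j) else 0)"
      by (rule Sum_any.cong) (auto simp: gbinomial_0_left)
    finally show ?thesis by (simp add: n_def)
  qed
  then have "antidiag_gen 1 (diff_times (int k) P) d = coord_unit 1 k * expansion_series 1 k Q d" for d
    by (auto intro!: fps_ext simp: coord_unit_def)
  with Q show "expands 1 k (diff_times (int k) P) Q" by (auto simp: expands_def)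
qed

text \<open>For \<open>n < k\<close> the left-hand side depends only on Taylor coefficients at the
  diagonal, which \<open>Q\<close> prescribes; for \<open>n >= k\<close> both sides vanish, by
  commutativity and by the pole condition.\<close>

lemma jacobi_of_expands:
  assumes P: "bounded_snd N P" and P2: "bounded_snd N P2"
    and comm: "\<And>a b. diff_times (int k) P2 a b = (- 1) ^ k * diff_times (int k) P b a"
    and b2: "bounded2 N (diff_times (int k) P)" and e: "expands 1 k (diff_times (int k) P) Q"
  shows "scalar_jacobi P P2 Q"
  unfolding scalar_jacobi_def
proof (intro allI)
  fix n a b
  have Q: "Q j r = 0" if "j < - int k" for j r using e that by (simp add: expands_def)
  show "diff_times n P a b - (- 1) powi n * diff_times n P2 b a =
     Sum_any (\<lambda>p::nat. (of_int (- a - 1) gchoose p) * Q (- n - 1 - int p) (b + 1 + a + int p))"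
  proof (cases "n \<ge> int k")
    case True
    have "diff_times (int (k + i)) P2 a b = (- 1) ^ (k + i) * diff_times (int (k + i)) P b a" for i a b
    proof (induction i arbitrary: a b)
      case (Suc i)
      have "int (k + Suc i) = int (k + i) + 1" by simp
      then show ?case
        by (simp only: diff_times_Suc[OF P2] diff_times_Suc[OF P] Suc) (simp add: algebra_simps)
    qed (simp add: comm)
    from this[of "nat n - k" b a] True
    have "diff_times n P2 b a = (- 1) powi n * diff_times n P a b"
      by (simp add: power_int_def)
    moreover have "(- 1) powi n * (- 1) powi n = (1 :: complex)"
      using True by (simp add: power_int_def power_mult_distrib[symmetric])
    ultimately show ?thesis using True by (simp add: mult.assoc[symmetric] Q)
  next
    case False
    define M where "M = nat (int k - n - 1)"
    have n: "n = int k - int (Suc M)" using False by (simp add: M_def)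
    have "diff_times n P a b - (- 1) powi n * diff_times n P2 b a =
        (binser (- a - 1) * antidiag_gen 1 (diff_times (int k) P) (a + b + int (Suc M))) $ M"
      unfolding n by (rule jacobi_side_eq_gen[OF P P2 comm b2])
    also have "\<dots> = (\<Sum>p\<le>M. (of_int (- a - 1) gchoose p) * Q (- n - 1 - int p) (b + 1 + a + int p))"
      using e unfolding expands_def
      by (simp add: fps_mult_nth coord_unit_def atLeast0AtMost)
         (rule sum.cong, simp_all add: n of_nat_diff algebra_simps)
    also have "\<dots> = Sum_any (\<lambda>p::nat. (of_int (- a - 1) gchoose p) * Q (- n - 1 - int p) (b + 1 + a + int p))"
    proof (rule Sum_any.expand_superset[symmetric])
      have "Q (- n - 1 - int p) (b + 1 + a + int p) = 0" if "p > M" for p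
        by (rule Q) (use that in \<open>simp add: n\<close>)
      then show "{p. (of_int (- a - 1) gchoose p) * Q (- n - 1 - int p) (b + 1 + a + int p) \<noteq> 0} \<subseteq> {..M}"
        by (auto simp: not_less[symmetric])
    qed simp
    finally show ?thesis .
  qed
qed

text \<open>Skew symmetry between \<open>Q\<close> and \<open>Q2\<close> is the effect of
  \<open>antidiag_gen_swap\<close> on expansions. Since the expansion determines each Laurent
  polynomial, the exchange of variables lifts to \<open>F\<close> and \<open>F2\<close>.\<close>

lemma commutativity_of_expands:
  assumes b: "bounded2 N F" "bounded2 N F2" and e: "expands 1 k F Q" and e2: "expands 1 k F2 Q2"
    and skew: "\<And>n r. Q (int n - int k) r =
      (\<Sum>i\<le>n. (- 1) ^ (i + k) * (of_int (r + int (n - i)) gchoose (n - i)) * Q2 (int i - int k) (r + int (n - i)))"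
  shows "F2 a b = (- 1) ^ k * F b a"
proof -
  have "F = (\<lambda>m n. (- 1) ^ k * F2 n m)"
  proof (rule antidiag_gen_inject[OF b(1)])
    have sw: "bounded2 N (\<lambda>m n. F2 n m)" using b(2) by (auto simp: bounded2_def)
    then show "bounded2 N (\<lambda>m n. (- 1) ^ k * F2 n m)" by (auto simp: bounded2_def)
    fix d
    have "antidiag_gen 1 (\<lambda>m n. (- 1) ^ k * F2 n m) d =
        fps_const ((- 1) ^ k) * (binser d * (expansion_series 1 k Q2 d oo inversion))"
      using e2 by (simp add: antidiag_gen_scale[OF sw] antidiag_gen_swap[OF b(2)] expands_def coord_unit_def)
    also have "\<dots> = expansion_series 1 k Q d"
      unfolding fps_eq_iff fps_mult_left_const_nth binser_times_compose_nth sum_distrib_left expansion_series_nth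
      by (auto simp: skew power_add of_nat_diff algebra_simps intro!: sum.cong)
    also have "\<dots> = antidiag_gen 1 F d"
      using e by (simp add: expands_def coord_unit_def)
    finally show "antidiag_gen 1 F d = antidiag_gen 1 (\<lambda>m n. (- 1) ^ k * F2 n m) d" by simp
  qed
  then have "F b a = (- 1) ^ k * F2 a b" by (rule fun_cong[THEN fun_cong, of _ _ b a, simplified])
  then show ?thesis by (simp add: mult.assoc[symmetric] power_mult_distrib[symmetric])
qed

text \<open>With the vacuum as second vector the product is a series \<open>p(x1)\<close> alone,
  whose expansion is the Taylor series of \<open>p(x2 + z)\<close>. It will give
  \<open>Y_W(Y(a,z)1,x) = Y_W(a,x+z)\<close>.\<close>

lemma expands_vacuum:
  fixes p :: "int \<Rightarrow> complex"
  assumes p: "\<And>m. m < N \<Longrightarrow> p m = 0" and P: "P = (\<lambda>m n. if n = 0 then p m else 0)"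
    and e: "expands 1 k (diff_times (int k) P) Q"
  shows "Q (int i) r = (of_int (r + int i) gchoose i) * p (r + int i)"
proof -
  define N' where "N' = min N 0"
  have bP: "bounded2 N' P" using p by (auto simp: P N'_def bounded2_def)
  then have sP: "bounded_snd N' P" by (auto simp: bounded2_def bounded_snd_def)
  have gen: "bounded2 N' (diff_times (int k) P) \<and>
    (\<forall>d. antidiag_gen 1 (diff_times (int k) P) d = fps_X ^ k * antidiag_gen 1 P (d - int k))" for k
  proof (induction k)
    case 0
    then show ?case using bP diff_times_0[OF sP] by simp
  next
    case (Suc k)
    let ?F = "diff_times (int k) P"
    have eq: "diff_times (int (Suc k)) P = (\<lambda>m n. ?F (m - 1) n - ?F m (n - 1))"
      using diff_times_Suc[OF sP, of "int k"] by (intro ext) (simp add: add.commute)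
    from Suc have b: "bounded2 N' ?F" by simp
    then have "bounded2 N' (\<lambda>m n. ?F (m - 1) n - ?F m (n - 1))" by (simp add: bounded2_def)
    moreover have "antidiag_gen 1 (\<lambda>m n. ?F (m - 1) n - ?F m (n - 1)) d = fps_X ^ Suc k * antidiag_gen 1 P (d - int (Suc k))" for d
      unfolding antidiag_gen_diff[OF b] using Suc by (simp add: binser_1 mult.assoc algebra_simps)
    ultimately show ?case unfolding eq by simp
  qed
  have genP: "antidiag_gen 1 P d $ j = (of_int d gchoose j) * p d" for d j
  proof -
    have "antidiag_gen 1 P d $ j = Sum_any (\<lambda>m. (of_int m gchoose j) * P m (d - m))"
      by (simp add: antidiag_gen_def)
    also have "\<dots> = (\<Sum>m\<in>{d}. (of_int m gchoose j) * P m (d - m))"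
      by (rule Sum_any.expand_superset) (auto simp: P)
    finally show ?thesis by (simp add: P)
  qed
  define d where "d = r + int i + int k"
  have "expansion_series 1 k Q d $ (k + i) = (fps_X ^ k * antidiag_gen 1 P (d - int k)) $ (k + i)"
    using e gen[of k] by (simp add: expands_def coord_unit_def)
  then show ?thesis by (simp add: fps_X_power_mult_nth genP d_def)
qed

section \<open>Reduction to matrix coefficients\<close>

definition functional :: "'w cspace \<Rightarrow> ('w \<Rightarrow> complex) \<Rightarrow> bool" where
  "functional M l \<longleftrightarrow> (\<forall>x\<in>carrier M. \<forall>y\<in>carrier M. l (x \<oplus>\<^bsub>M\<^esub> y) = l x + l y) \<and>
     (\<forall>a. \<forall>x\<in>carrier M. l (a \<odot>\<^bsub>M\<^esub> x) = a * l x)"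

lemma functional_vanishing_on_subspace:
  fixes sc :: "complex \<Rightarrow> 'e::ab_group_add \<Rightarrow> 'e"
  assumes "vector_space sc" and K: "module.subspace sc K" and z: "z \<notin> K"
  shows "\<exists>g. (\<forall>x y. g (x + y) = g x + g y) \<and> (\<forall>c x. g (sc c x) = c * g x) \<and>
    (\<forall>x\<in>K. g x = (0 :: complex)) \<and> g z = 1"
proof -
  have "vector_space ((*) :: complex \<Rightarrow> _)"
    by unfold_locales (auto simp: algebra_simps)
  with assms(1) interpret vector_space_pair sc "(*) :: complex \<Rightarrow> _"
    by (rule vector_space_pair.intro)
  obtain B where B: "B \<subseteq> K" "vs1.independent B" "K \<subseteq> vs1.span B"
    by (rule vs1.maximal_independent_subset[of K])
  have span: "vs1.span B = K"
    using vs1.span_minimal[OF B(1) K] B(3) by (rule subset_antisym)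
  have ind: "vs1.independent (insert z B)"
    using B z by (intro vs1.independent_insertI) (simp_all add: span)
  obtain g where g: "Vector_Spaces.linear sc (*) g" "\<forall>b\<in>insert z B. g b = (if b = z then 1 else 0)"
    using linear_independent_extend[OF ind, of "\<lambda>b. if b = z then 1 else 0"] by blast
  interpret g: Vector_Spaces.linear sc "(*)" g by (rule g)
  have "g f = 0" if "f \<in> K" for f
  proof (rule g.eq_0_on_span)
    show "f \<in> vs1.span B" using that span by simp
    show "g b = 0" if "b \<in> B" for b using g(2) B(1) z that by auto
  qed
  then show ?thesis using g.add g.scale g(2) by (intro exI[of _ g]) simp
qed

locale complex_space =
  fixes M :: "'w cspace" (structure)
  assumes cvector_space: "cvector_space M"
begin

sublocale Module.module "ring_of_type_algebra :: complex ring" M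
  using cvector_space by (simp add: cvector_space_def)

lemma smult_in [simp, intro]: "x \<in> carrier M \<Longrightarrow> a \<odot> x \<in> carrier M"
  using smult_closed[of a x] by (simp add: ring_of_type_algebra_def)

lemma smult_add_left: "x \<in> carrier M \<Longrightarrow> (a + b) \<odot> x = a \<odot> x \<oplus> b \<odot> x"
  using smult_l_distr[of a b x] by (simp add: ring_of_type_algebra_def)

lemma smult_add_right: "x \<in> carrier M \<Longrightarrow> y \<in> carrier M \<Longrightarrow> a \<odot> (x \<oplus> y) = a \<odot> x \<oplus> a \<odot> y"
  using smult_r_distr[of a x y] by (simp add: ring_of_type_algebra_def)

lemma smult_mult: "x \<in> carrier M \<Longrightarrow> (a * b) \<odot> x = a \<odot> (b \<odot> x)"
  using smult_assoc1[of a b x] by (simp add: ring_of_type_algebra_def)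

lemma smult_1 [simp]: "x \<in> carrier M \<Longrightarrow> 1 \<odot> x = x"
  using smult_one[of x] by (simp add: ring_of_type_algebra_def)

lemma smult_0 [simp]: "x \<in> carrier M \<Longrightarrow> 0 \<odot> x = \<zero>"
  using smult_l_null[of x] by (simp add: ring_of_type_algebra_def)

lemma smult_zero [simp]: "a \<odot> \<zero> = \<zero>"
  using smult_r_null[of a] by (simp add: ring_of_type_algebra_def)

lemma smult_finsum:
  "finite A \<Longrightarrow> g \<in> A \<rightarrow> carrier M \<Longrightarrow> a \<odot> (\<Oplus>i\<in>A. g i) = (\<Oplus>i\<in>A. a \<odot> g i)"
  using finsum_smult_ldistr[of A a g] by (simp add: ring_of_type_algebra_def)

lemma functional_add: "functional M l \<Longrightarrow> x \<in> carrier M \<Longrightarrow> y \<in> carrier M \<Longrightarrow> l (x \<oplus> y) = l x + l y"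
  by (simp add: functional_def)

lemma functional_smult: "functional M l \<Longrightarrow> x \<in> carrier M \<Longrightarrow> l (a \<odot> x) = a * l x"
  by (simp add: functional_def)

lemma functional_zero: "functional M l \<Longrightarrow> l \<zero> = 0"
  using functional_add[of l \<zero> \<zero>] by simp

lemma functional_minus:
  assumes "functional M l" "x \<in> carrier M" "y \<in> carrier M"
  shows "l (x \<ominus> y) = l x - l y"
proof -
  have "l x = l ((x \<ominus> y) \<oplus> y)"
    using assms by (simp add: M.minus_eq M.add.m_assoc M.l_neg)
  then show ?thesis using assms by (simp add: functional_add)
qed

lemma functional_finsum:
  assumes "functional M l" "finite A" "g \<in> A \<rightarrow> carrier M"
  shows "l (\<Oplus>i\<in>A. g i) = (\<Sum>i\<in>A. l (g i))"
  using assms(2,3)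
  by (induction A rule: finite_induct) (auto simp: functional_zero[OF assms(1)] functional_add[OF assms(1)])

lemma msum_closed [simp, intro]:
  assumes "\<And>i. g i \<in> carrier M"
  shows "msum M g \<in> carrier M"
  unfolding msum_def using assms by (intro M.finsum_closed) auto

text \<open>The map \<open>e\<close> enumerates a finite set containing the support, so that sums
  over pairs or triples of exponents become sums over the one exponent that really varies.\<close>

lemma functional_msum:
  assumes l: "functional M l" and g: "\<And>i. g i \<in> carrier M"
    and e: "inj_on e A" "finite A" and z: "\<And>s. s \<notin> e ` A \<Longrightarrow> g s = \<zero>"
  shows "l (msum M g) = (\<Sum>i\<in>A. l (g (e i)))"
proof -
  have sub: "{i. g i \<noteq> \<zero>} \<subseteq> e ` A" using z by blast
  then have fin: "finite {i. g i \<noteq> \<zero>}" using e(2) by (meson finite_imageI finite_subset)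
  have "l (msum M g) = (\<Sum>i\<in>{i. g i \<noteq> \<zero>}. l (g i))"
    unfolding msum_def using g by (intro functional_finsum[OF l fin]) auto
  also have "\<dots> = (\<Sum>s\<in>e ` A. l (g s))"
    using sub e(2) by (intro sum.mono_neutral_left) (auto simp: functional_zero[OF l])
  also have "\<dots> = (\<Sum>i\<in>A. l (g (e i)))"
    using e(1) by (simp add: sum.reindex)
  finally show ?thesis .
qed

text \<open>\<open>M\<close> is a quotient of the space of finitely supported functions on its carrier, and a linear
  functional on all functions can be prescribed to vanish on the kernel of the quotient map.\<close>

lemma functionals_separate:
  assumes x: "x \<in> carrier M" and y: "y \<in> carrier M"
    and eq: "\<And>l. functional M l \<Longrightarrow> l x = l y"
  shows "x = y"
proof (rule ccontr)
  assume "x \<noteq> y"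
  define z where "z = x \<ominus> y"
  have "x = z \<oplus> y"
    using x y by (simp add: z_def M.minus_eq M.add.m_assoc M.l_neg)
  then have z: "z \<in> carrier M" "z \<noteq> \<zero>"
    using x y \<open>x \<noteq> y\<close> by (auto simp: z_def)
  define sc where "sc = (\<lambda>(c::complex) (f::'w \<Rightarrow> complex) x. c * f x)"
  have vs: "vector_space sc"
    by unfold_locales (auto simp: sc_def fun_eq_iff algebra_simps)
  then have mod: "Modules.module sc" by (simp add: module_iff_vector_space)
  \<comment> \<open>The quotient map on finitely supported functions. The support is an explicit
    argument, and \<open>ev_mono\<close> allows it to be enlarged.\<close>
  define ev where "ev = (\<lambda>A (f :: 'w \<Rightarrow> complex). \<Oplus>w\<in>A. f w \<odot> w)"
  define K where "K = {f :: 'w \<Rightarrow> complex. \<exists>A. finite A \<and> A \<subseteq> carrier M \<and> (\<forall>w. w \<notin> A \<longrightarrow> f w = 0) \<and> ev A f = \<zero>}"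
  have ev_mono: "ev B f = ev A f" if "A \<subseteq> B" "finite B" "B \<subseteq> carrier M" "\<forall>w. w \<notin> A \<longrightarrow> f w = 0" for A B f
    unfolding ev_def using that by (intro M.add.finprod_mono_neutral_cong_right) auto
  have ev_add: "ev A (f + g) = ev A f \<oplus> ev A g" if "finite A" "A \<subseteq> carrier M" for A f g
    unfolding ev_def using that
    by (subst M.finsum_addf[symmetric]) (auto simp: smult_add_left intro!: M.finsum_cong')
  have ev_scale: "ev A (sc c f) = c \<odot> ev A f" if "finite A" "A \<subseteq> carrier M" for A f c
    unfolding ev_def sc_def using that
    by (subst smult_finsum) (auto simp: smult_mult intro!: M.finsum_cong')
  have K: "module.subspace sc K"
    unfolding module.subspace_def[OF mod]
  proof (intro conjI ballI allI)
    show "0 \<in> K" by (auto simp: K_def ev_def intro!: exI[of _ "{}"])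
  next
    fix f g assume "f \<in> K" "g \<in> K"
    then obtain A B where AB: "finite A" "A \<subseteq> carrier M" "\<forall>w. w \<notin> A \<longrightarrow> f w = 0" "ev A f = \<zero>"
      "finite B" "B \<subseteq> carrier M" "\<forall>w. w \<notin> B \<longrightarrow> g w = 0" "ev B g = \<zero>"
      unfolding K_def by blast
    have "ev (A \<union> B) (f + g) = \<zero>"
      using ev_mono[of A "A \<union> B" f] ev_mono[of B "A \<union> B" g] AB by (simp add: ev_add)
    with AB show "f + g \<in> K"
      unfolding K_def by (auto intro!: exI[of _ "A \<union> B"])
  next
    fix c f assume "f \<in> K"
    then obtain A where A: "finite A" "A \<subseteq> carrier M" "\<forall>w. w \<notin> A \<longrightarrow> f w = 0" "ev A f = \<zero>"
      unfolding K_def by blast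
    then have "ev A (sc c f) = \<zero>" by (simp add: ev_scale)
    with A show "sc c f \<in> K" unfolding K_def by (auto simp: sc_def)
  qed
  define \<delta> where "\<delta> = (\<lambda>w v :: 'w. if v = w then 1 else 0 :: complex)"
  have ev_\<delta>: "ev A (\<delta> w) = w" if "finite A" "A \<subseteq> carrier M" "w \<in> A" for A w
    using ev_mono[of "{w}" A "\<delta> w"] that by (auto simp: \<delta>_def ev_def)
  have "\<delta> z \<notin> K"
  proof
    assume "\<delta> z \<in> K"
    then obtain A where A: "finite A" "A \<subseteq> carrier M" "\<forall>w. w \<notin> A \<longrightarrow> \<delta> z w = 0" "ev A (\<delta> z) = \<zero>"
      unfolding K_def by blast
    then have "z \<in> A" by (auto simp: \<delta>_def)
    then have "ev A (\<delta> z) = z" by (rule ev_\<delta>[OF A(1,2)])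
    with A(4) have "z = \<zero>" by (rule trans[OF sym, rotated])
    with z(2) show False by contradiction
  qed
  then obtain g where g: "\<And>x y. g (x + y) = g x + g y" "\<And>c x. g (sc c x) = c * g x"
      "\<And>x. x \<in> K \<Longrightarrow> g x = 0" "g (\<delta> z) = 1"
    using functional_vanishing_on_subspace[OF vs K] by blast
  have "functional M (\<lambda>w. g (\<delta> w))"
    unfolding functional_def
  proof (intro conjI ballI allI)
    fix v w assume vw: "v \<in> carrier M" "w \<in> carrier M"
    \<comment> \<open>A linear relation between indicator functions that evaluates to zero; as an
      element of \<open>K\<close> it is annihilated by \<open>g\<close>, which makes
      \<open>g\<close> additive on indicators.\<close>
    define f where "f = \<delta> (v \<oplus> w) + (sc (- 1) (\<delta> v) + sc (- 1) (\<delta> w))"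
    have "ev {v, w, v \<oplus> w} f = (v \<oplus> w) \<oplus> ((- 1) \<odot> v \<oplus> (- 1) \<odot> w)"
      unfolding f_def using vw by (simp add: ev_add ev_scale ev_\<delta> del: mult_minus1)
    also have "\<dots> = 1 \<odot> (v \<oplus> w) \<oplus> (- 1) \<odot> (v \<oplus> w)"
      using vw by (simp add: smult_add_right)
    also have "\<dots> = (1 + - 1) \<odot> (v \<oplus> w)"
      using vw by (simp only: smult_add_left M.add.m_closed)
    finally have "f \<in> K"
      unfolding K_def using vw
      by (auto intro!: exI[of _ "{v, w, v \<oplus> w}"]) (auto simp: f_def \<delta>_def sc_def split: if_splits)
    then have "g f = 0" by (rule g(3))
    then show "g (\<delta> (v \<oplus> w)) = g (\<delta> v) + g (\<delta> w)"
      unfolding f_def g(1,2) by (simp add: algebra_simps)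
  next
    fix a w assume w: "w \<in> carrier M"
    define f where "f = \<delta> (a \<odot> w) + sc (- a) (\<delta> w)"
    have "ev {w, a \<odot> w} f = a \<odot> w \<oplus> (- a) \<odot> w"
      unfolding f_def using w by (simp add: ev_add ev_scale ev_\<delta> del: mult_minus_left)
    also have "\<dots> = (a + - a) \<odot> w"
      using w by (simp only: smult_add_left)
    finally have "f \<in> K"
      unfolding K_def using w
      by (auto intro!: exI[of _ "{w, a \<odot> w}"]) (auto simp: f_def \<delta>_def sc_def split: if_splits)
    then have "g f = 0" by (rule g(3))
    then show "g (\<delta> (a \<odot> w)) = a * g (\<delta> w)"
      unfolding f_def g(1,2) by (simp add: algebra_simps)
  qed
  then have "g (\<delta> z) = 0"
    using functional_minus[of "\<lambda>w. g (\<delta> w)" x y] eq x y by (simp add: z_def)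
  then show False using g(4) by simp
qed

lemma zero_iff_functionals:
  "x \<in> carrier M \<Longrightarrow> x = \<zero> \<longleftrightarrow> (\<forall>l. functional M l \<longrightarrow> l x = 0)"
  using functionals_separate[of x \<zero>] functional_zero by force

end

lemma functional_lin_maps:
  assumes "functional N l" "f \<in> lin_maps M N"
  shows "functional M (\<lambda>x. l (f x))"
  using assms by (auto simp: functional_def lin_maps_def PiE_iff)

section \<open>Matrix coefficients of the Jacobi identity\<close>

definition prod_coeff :: "('v, 'w) vmap \<Rightarrow> ('w \<Rightarrow> complex) \<Rightarrow> 'v \<Rightarrow> 'v \<Rightarrow> 'w \<Rightarrow> series2" where
  "prod_coeff YW l u v w m n = l (YW u m (YW v n w))"

definition iter_coeff ::
  "('v, 'w) vmap \<Rightarrow> ('v, 'v) vmap \<Rightarrow> ('w \<Rightarrow> complex) \<Rightarrow> 'v \<Rightarrow> 'v \<Rightarrow> 'w \<Rightarrow> series2" where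
  "iter_coeff YW Y l u v w j r = l (YW (Y u j v) r w)"

abbreviation cleared_coeff :: "('v, 'w) vmap \<Rightarrow> nat \<Rightarrow> ('w \<Rightarrow> complex) \<Rightarrow> 'v \<Rightarrow> 'v \<Rightarrow> 'w \<Rightarrow> series2" where
  "cleared_coeff YW k l u v w \<equiv> diff_times (int k) (prod_coeff YW l u v w)"

locale vertex_space = complex_space M for M :: "'w cspace" (structure) +
  fixes scale :: "complex \<Rightarrow> 'v::ab_group_add \<Rightarrow> 'v" and vac :: 'v and YW :: "('v, 'w) vmap"
  assumes vertex_map: "vertex_map scale vac M YW"
begin

lemma YW_lin: "YW v n \<in> lin_maps M M"
  using vertex_map by (simp add: vertex_map_def)

lemma YW_closed [simp, intro]: "w \<in> carrier M \<Longrightarrow> YW v n w \<in> carrier M"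
  using YW_lin[of v n] by (auto simp: lin_maps_def)

lemma YW_functional: "functional M l \<Longrightarrow> functional M (\<lambda>w. l (YW v n w))"
  using functional_lin_maps YW_lin by blast

lemma YW_zero [simp]: "YW v n \<zero> = \<zero>"
  using functionals_separate[of "YW v n \<zero>" \<zero>] functional_zero YW_functional
  by (metis M.zero_closed YW_closed)

lemma YW_add: "w \<in> carrier M \<Longrightarrow> YW (u + v) n w = YW u n w \<oplus> YW v n w"
  using vertex_map by (simp add: vertex_map_def)

lemma YW_scale: "w \<in> carrier M \<Longrightarrow> YW (scale a v) n w = a \<odot> YW v n w"
  using vertex_map by (simp add: vertex_map_def)

lemma YW_vac: "w \<in> carrier M \<Longrightarrow> YW vac n w = (if n = 0 then w else \<zero>)"
  using vertex_map by (simp add: vertex_map_def)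

lemma YW_0 [simp]: "w \<in> carrier M \<Longrightarrow> YW 0 n w = \<zero>"
  using YW_add[of w 0 0 n] by simp

lemma YW_bounded: "w \<in> carrier M \<Longrightarrow> \<exists>N. \<forall>n<N. YW v n w = \<zero>"
  using vertex_map by (auto simp: vertex_map_def laurent_def)

lemma prod_coeff_bounded:
  assumes "w \<in> carrier M"
  obtains N where "\<And>l. functional M l \<Longrightarrow> bounded_snd N (prod_coeff YW l u v w)"
proof -
  obtain N where "\<forall>n<N. YW v n w = \<zero>" using YW_bounded[OF assms] by blast
  then show ?thesis
    using that[of N] by (simp add: prod_coeff_def bounded_snd_def functional_zero)
qed

definition jacobi_prod :: "'v \<Rightarrow> 'v \<Rightarrow> 'w \<Rightarrow> int \<times> int \<times> int \<Rightarrow> 'w" where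
  "jacobi_prod u v w = fmul M (\<lambda>(p, q, r). delta 1 p q r)
      (\<lambda>(p, q, r). if p = 0 then YW u q (YW v r w) else \<zero>)"

definition jacobi_opp :: "'v \<Rightarrow> 'v \<Rightarrow> 'w \<Rightarrow> int \<times> int \<times> int \<Rightarrow> 'w" where
  "jacobi_opp u v w = fmul M (\<lambda>(p, q, r). delta (- 1) p r q)
      (\<lambda>(p, q, r). if p = 0 then YW v r (YW u q w) else \<zero>)"

definition jacobi_iter :: "('v, 'v) vmap \<Rightarrow> 'v \<Rightarrow> 'v \<Rightarrow> 'w \<Rightarrow> int \<times> int \<times> int \<Rightarrow> 'w" where
  "jacobi_iter Y u v w = fmul M (\<lambda>(p, q, r). delta 1 r q p)
      (\<lambda>(p, q, r). if q = 0 then YW (Y u p v) r w else \<zero>)"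

lemma functional_jacobi_1:
  assumes l: "functional M l" and w: "w \<in> carrier M"
  shows "jacobi_prod u v w (t0, t1, t2) \<in> carrier M"
    and "l (jacobi_prod u v w (t0, t1, t2)) = diff_times (- t0 - 1) (prod_coeff YW l u v w) t1 t2"
proof -
  let ?g = "\<lambda>s. (case s of (p, q, r) \<Rightarrow> delta 1 p q r) \<odot>
      (case (t0, t1, t2) - s of (p, q, r) \<Rightarrow> if p = 0 then YW u q (YW v r w) else \<zero>)"
  have g: "?g s \<in> carrier M" for s
    using w by (auto split: prod.splits)
  show "jacobi_prod u v w (t0, t1, t2) \<in> carrier M" unfolding jacobi_prod_def fmul_def using g by blast
  obtain N where N: "\<forall>n<N. YW v n w = \<zero>" using YW_bounded[OF w] by blast
  define n where "n = - t0 - 1"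
  define B where "B = Suc (nat (t2 - N))"
  \<comment> \<open>The delta function fixes the power of \<open>x0\<close> and the total degree of
    the factor in \<open>x1, x2\<close>. What varies is the power \<open>i\<close> of
    \<open>x2\<close>, and truncation of the inner operator keeps it below \<open>B\<close>.\<close>
  define e where "e = (\<lambda>i::nat. (t0, n - int i, int i))"
  have "l (msum M ?g) = (\<Sum>i\<in>{..<B}. l (?g (e i)))"
  proof (rule functional_msum[OF l g])
    show "inj_on e {..<B}" by (auto simp: e_def inj_on_def)
    fix s assume s: "s \<notin> e ` {..<B}"
    obtain p q r where pqr: "s = (p, q, r)" by (cases s)
    show "?g s = \<zero>"
    proof (cases "p = t0 \<and> r \<ge> 0 \<and> q + r = n \<and> t2 - r \<ge> N")
      case True
      then have "s = e (nat r)" "nat r < B" by (auto simp: pqr e_def B_def)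
      with s show ?thesis by blast
    next
      case False
      then show ?thesis using N w
        by (auto simp: pqr delta_def diff_pow_def n_def)
    qed
  qed simp
  also have "\<dots> = (\<Sum>i<B. (- 1) ^ i * (of_int n gchoose i) * prod_coeff YW l u v w (t1 - n + int i) (t2 - int i))"
    by (rule sum.cong[OF refl])
       (use w in \<open>simp add: e_def delta_def diff_pow_def n_def functional_smult[OF l] prod_coeff_def algebra_simps\<close>)
  also have "\<dots> = diff_times n (prod_coeff YW l u v w) t1 t2"
  proof (rule diff_times_eq_sum[symmetric])
    show "bounded_snd N (prod_coeff YW l u v w)"
      using N by (simp add: bounded_snd_def prod_coeff_def functional_zero[OF l])
  qed (auto simp: B_def)
  finally show "l (jacobi_prod u v w (t0, t1, t2)) = diff_times (- t0 - 1) (prod_coeff YW l u v w) t1 t2"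
    by (simp add: jacobi_prod_def fmul_def n_def)
qed

lemma functional_jacobi_2:
  assumes l: "functional M l" and w: "w \<in> carrier M"
  shows "jacobi_opp u v w (t0, t1, t2) \<in> carrier M"
    and "l (jacobi_opp u v w (t0, t1, t2)) = (- 1) powi (- t0 - 1) * diff_times (- t0 - 1) (prod_coeff YW l v u w) t2 t1"
proof -
  let ?g = "\<lambda>s. (case s of (p, q, r) \<Rightarrow> delta (- 1) p r q) \<odot>
      (case (t0, t1, t2) - s of (p, q, r) \<Rightarrow> if p = 0 then YW v r (YW u q w) else \<zero>)"
  have g: "?g s \<in> carrier M" for s
    using w by (auto split: prod.splits)
  show "jacobi_opp u v w (t0, t1, t2) \<in> carrier M" unfolding jacobi_opp_def fmul_def using g by blast
  obtain N where N: "\<forall>n<N. YW u n w = \<zero>" using YW_bounded[OF w] by blast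
  define n where "n = - t0 - 1"
  have sgn: "(- 1 :: complex) powi (t0 + 1) = (- 1) powi n"
    unfolding n_def using power_int_minus_one_minus[of "t0 + 1", where 'a = complex] by simp
  define B where "B = Suc (nat (t1 - N))"
  define e where "e = (\<lambda>i::nat. (t0, int i, n - int i))"
  have "l (msum M ?g) = (\<Sum>i\<in>{..<B}. l (?g (e i)))"
  proof (rule functional_msum[OF l g])
    show "inj_on e {..<B}" by (auto simp: e_def inj_on_def)
    fix s assume s: "s \<notin> e ` {..<B}"
    obtain p q r where pqr: "s = (p, q, r)" by (cases s)
    show "?g s = \<zero>"
    proof (cases "p = t0 \<and> q \<ge> 0 \<and> q + r = n \<and> t1 - q \<ge> N")
      case True
      then have "s = e (nat q)" "nat q < B" by (auto simp: pqr e_def B_def)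
      with s show ?thesis by blast
    next
      case False
      then show ?thesis using N w
        by (auto simp: pqr delta_def diff_pow_def n_def)
    qed
  qed simp
  also have "\<dots> = (\<Sum>i<B. (- 1) powi n * ((- 1) ^ i * (of_int n gchoose i) * prod_coeff YW l v u w (t2 - n + int i) (t1 - int i)))"
  proof (rule sum.cong[OF refl])
    fix i
    have "delta (- 1) t0 (n - int i) (int i) = (- 1) powi n * ((- 1) ^ i * (of_int n gchoose i))"
      unfolding delta_def sgn n_def[symmetric] by (simp add: diff_pow_def)
    then show "l (?g (e i)) = (- 1) powi n * ((- 1) ^ i * (of_int n gchoose i) * prod_coeff YW l v u w (t2 - n + int i) (t1 - int i))"
      using w by (simp add: e_def functional_smult[OF l] prod_coeff_def algebra_simps)
  qed
  also have "\<dots> = (- 1) powi n * diff_times n (prod_coeff YW l v u w) t2 t1"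
  proof (subst diff_times_eq_sum[where N = N and B = B])
    show "bounded_snd N (prod_coeff YW l v u w)"
      using N by (simp add: bounded_snd_def prod_coeff_def functional_zero[OF l])
  next
    show "t1 - N < int B" by (simp add: B_def)
  qed (rule sum_distrib_left[symmetric])
  finally show "l (jacobi_opp u v w (t0, t1, t2)) = (- 1) powi (- t0 - 1) * diff_times (- t0 - 1) (prod_coeff YW l v u w) t2 t1"
    by (simp add: jacobi_opp_def fmul_def n_def)
qed

lemma functional_jacobi_3:
  assumes l: "functional M l" and w: "w \<in> carrier M" and K: "\<And>j. j < K \<Longrightarrow> Y u j v = 0"
  shows "jacobi_iter Y u v w (t0, t1, t2) \<in> carrier M"
    and "l (jacobi_iter Y u v w (t0, t1, t2)) = Sum_any (\<lambda>p::nat. (of_int (- t1 - 1) gchoose p) * iter_coeff YW Y l u v w (t0 - int p) (t2 + 1 + t1 + int p))"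
proof -
  let ?g = "\<lambda>s. (case s of (p, q, r) \<Rightarrow> delta 1 r q p) \<odot>
      (case (t0, t1, t2) - s of (p, q, r) \<Rightarrow> if q = 0 then YW (Y u p v) r w else \<zero>)"
  have g: "?g s \<in> carrier M" for s
    using w by (auto split: prod.splits)
  show "jacobi_iter Y u v w (t0, t1, t2) \<in> carrier M" unfolding jacobi_iter_def fmul_def using g by blast
  define B where "B = Suc (nat (t0 - K))"
  define e where "e = (\<lambda>i::nat. (int i, t1, - 1 - int i - t1))"
  have "l (msum M ?g) = (\<Sum>i\<in>{..<B}. l (?g (e i)))"
  proof (rule functional_msum[OF l g])
    show "inj_on e {..<B}" by (auto simp: e_def inj_on_def)
    fix s assume s: "s \<notin> e ` {..<B}"
    obtain p q r where pqr: "s = (p, q, r)" by (cases s)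
    show "?g s = \<zero>"
    proof (cases "q = t1 \<and> p \<ge> 0 \<and> q + p = - r - 1 \<and> t0 - p \<ge> K")
      case True
      then have "s = e (nat p)" "nat p < B" by (auto simp: pqr e_def B_def)
      with s show ?thesis by blast
    next
      case False
      then show ?thesis using K w
        by (auto simp: pqr delta_def diff_pow_def)
    qed
  qed simp
  also have "\<dots> = (\<Sum>i<B. (of_int (- t1 - 1) gchoose i) * iter_coeff YW Y l u v w (t0 - int i) (t2 + 1 + t1 + int i))"
  proof (rule sum.cong[OF refl])
    fix i
    \<comment> \<open>Upper negation: the delta function supplies \<open>(-1)^i\<close> times the
      binomial with upper entry \<open>t1 + i\<close>.\<close>
    have "(of_int (- t1 - 1) gchoose i :: complex) = (- (of_int t1 + 1) gchoose i)"
      by (rule arg_cong[where f = "\<lambda>x. x gchoose i"]) simp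
    also have "\<dots> = (- 1) ^ i * (of_int (t1 + int i) gchoose i)"
      by (subst gbinomial_minus) simp
    finally show "l (?g (e i)) = (of_int (- t1 - 1) gchoose i) * iter_coeff YW Y l u v w (t0 - int i) (t2 + 1 + t1 + int i)"
      using w by (simp add: e_def delta_def diff_pow_def functional_smult[OF l] iter_coeff_def algebra_simps)
  qed
  also have "\<dots> = Sum_any (\<lambda>p::nat. (of_int (- t1 - 1) gchoose p) * iter_coeff YW Y l u v w (t0 - int p) (t2 + 1 + t1 + int p))"
  proof (rule Sum_any.expand_superset[symmetric])
    have "iter_coeff YW Y l u v w (t0 - int p) (t2 + 1 + t1 + int p) = 0" if "p \<ge> B" for p
      using that w by (simp add: iter_coeff_def K B_def functional_zero[OF l])
    then show "{p. (of_int (- t1 - 1) gchoose p) * iter_coeff YW Y l u v w (t0 - int p) (t2 + 1 + t1 + int p) \<noteq> 0} \<subseteq> {..<B}"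
      by (auto simp: not_le[symmetric])
  qed simp
  finally show "l (jacobi_iter Y u v w (t0, t1, t2)) = Sum_any (\<lambda>p::nat. (of_int (- t1 - 1) gchoose p) * iter_coeff YW Y l u v w (t0 - int p) (t2 + 1 + t1 + int p))"
    by (simp add: jacobi_iter_def fmul_def)
qed

text \<open>The exponent \<open>t0\<close> of \<open>x0\<close> corresponds to
  \<open>n = - t0 - 1\<close>. The lower bound \<open>K\<close> makes the sum for the iterate
  finite, so that functionals may be applied term by term and then decide the vector
  equation.\<close>

lemma jacobi_identity_iff:
  assumes w: "w \<in> carrier M" and K: "\<And>j. j < K \<Longrightarrow> Y u j v = 0"
  shows "jacobi_identity Y M YW u v w \<longleftrightarrow> (\<forall>l. functional M l \<longrightarrow>
    scalar_jacobi (prod_coeff YW l u v w) (prod_coeff YW l v u w) (iter_coeff YW Y l u v w))"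
    (is "?L \<longleftrightarrow> ?R")
proof -
  let ?F1 = "jacobi_prod u v w" and ?F2 = "jacobi_opp u v w" and ?F3 = "jacobi_iter Y u v w"
  let ?J = "\<lambda>l t0 t1 t2. diff_times (- t0 - 1) (prod_coeff YW l u v w) t1 t2 -
      (- 1) powi (- t0 - 1) * diff_times (- t0 - 1) (prod_coeff YW l v u w) t2 t1 =
      Sum_any (\<lambda>p::nat. (of_int (- t1 - 1) gchoose p) * iter_coeff YW Y l u v w (t0 - int p) (t2 + 1 + t1 + int p))"
  let ?S = "\<lambda>l n a b. diff_times n (prod_coeff YW l u v w) a b - (- 1) powi n * diff_times n (prod_coeff YW l v u w) b a =
      Sum_any (\<lambda>p::nat. (of_int (- a - 1) gchoose p) * iter_coeff YW Y l u v w (- n - 1 - int p) (b + 1 + a + int p))"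
  have z: "functional M (\<lambda>_. 0)" by (simp add: functional_def)
  note c1 = functional_jacobi_1(1)[OF z w, of u v]
  note c2 = functional_jacobi_2(1)[OF z w, of u v]
  note c3 = functional_jacobi_3(1)[where Y = Y and u = u and v = v and K = K, OF z w K]
  note l1 = functional_jacobi_1(2)[OF _ w, of _ u v]
  note l2 = functional_jacobi_2(2)[OF _ w, of _ u v]
  have l3: "l (?F3 (t0, t1, t2)) = Sum_any (\<lambda>p::nat. (of_int (- t1 - 1) gchoose p) *
      iter_coeff YW Y l u v w (t0 - int p) (t2 + 1 + t1 + int p))" if "functional M l" for l t0 t1 t2
    by (rule functional_jacobi_3(2)[where K = K, OF that w]) (rule K)
  have sub: "\<And>x y. x \<in> carrier M \<Longrightarrow> y \<in> carrier M \<Longrightarrow> x \<ominus> y \<in> carrier M" by simp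
  have "?L \<longleftrightarrow> (\<forall>t0 t1 t2. ?F1 (t0, t1, t2) \<ominus> ?F2 (t0, t1, t2) = ?F3 (t0, t1, t2))"
    unfolding jacobi_identity_def jacobi_prod_def jacobi_opp_def jacobi_iter_def by simp
  also have "\<dots> \<longleftrightarrow> (\<forall>t0 t1 t2 l. functional M l \<longrightarrow> ?J l t0 t1 t2)"
  proof -
    have "?F1 (t0, t1, t2) \<ominus> ?F2 (t0, t1, t2) = ?F3 (t0, t1, t2) \<longleftrightarrow> (\<forall>l. functional M l \<longrightarrow> ?J l t0 t1 t2)" for t0 t1 t2
    proof
      assume "?F1 (t0, t1, t2) \<ominus> ?F2 (t0, t1, t2) = ?F3 (t0, t1, t2)"
      then have e: "l (?F1 (t0, t1, t2) \<ominus> ?F2 (t0, t1, t2)) = l (?F3 (t0, t1, t2))" for l by (rule arg_cong)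
      show "\<forall>l. functional M l \<longrightarrow> ?J l t0 t1 t2"
      proof (intro allI impI)
        fix l assume l: "functional M l"
        show "?J l t0 t1 t2"
          using e[of l] unfolding functional_minus[OF l c1 c2] l1[OF l] l2[OF l] l3[OF l] .
      qed
    next
      assume h: "\<forall>l. functional M l \<longrightarrow> ?J l t0 t1 t2"
      show "?F1 (t0, t1, t2) \<ominus> ?F2 (t0, t1, t2) = ?F3 (t0, t1, t2)"
      proof (rule functionals_separate[OF sub[OF c1 c2] c3])
        fix l assume l: "functional M l"
        show "l (?F1 (t0, t1, t2) \<ominus> ?F2 (t0, t1, t2)) = l (?F3 (t0, t1, t2))"
          unfolding functional_minus[OF l c1 c2] l1[OF l] l2[OF l] l3[OF l] using h l by blast
      qed
    qed
    then show ?thesis by blast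
  qed
  also have "\<dots> \<longleftrightarrow> ?R"
  proof -
    have "scalar_jacobi (prod_coeff YW l u v w) (prod_coeff YW l v u w) (iter_coeff YW Y l u v w) \<longleftrightarrow>
        (\<forall>t0 t1 t2. ?J l t0 t1 t2)" for l
      unfolding scalar_jacobi_def
    proof (intro iffI allI)
      fix n a b assume "\<forall>t0 t1 t2. ?J l t0 t1 t2"
      then have "?J l (- n - 1) a b" by blast
      then show "?S l n a b" by simp
    next
      fix t0 t1 t2
      assume h: "\<forall>n a b. ?S l n a b"
      show "?J l t0 t1 t2" using h[rule_format, of "- t0 - 1" t1 t2] by simp
    qed
    then show ?thesis by blast
  qed
  finally show ?thesis .
qed

section \<open>Matrix coefficients of the substitution x1 = phi(x2, z)\<close>

definition product_series :: "nat \<Rightarrow> 'v \<Rightarrow> 'v \<Rightarrow> 'w \<Rightarrow> int \<times> int \<Rightarrow> 'w" where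
  "product_series k u v w = fmul M (diff_pow (int k)) (\<lambda>(m, n). YW u m (YW v n w))"

lemma product_series:
  assumes w: "w \<in> carrier M"
  shows "product_series k u v w t \<in> carrier M"
    and "functional M l \<Longrightarrow> l (product_series k u v w (m, n)) = cleared_coeff YW k l u v w m n"
proof -
  let ?g = "\<lambda>t s. diff_pow (int k) s \<odot> (case t - s of (m, n) \<Rightarrow> YW u m (YW v n w))"
  have g: "?g t s \<in> carrier M" for t s
    using w by (auto split: prod.splits)
  show "product_series k u v w t \<in> carrier M"
    unfolding product_series_def fmul_def using g by blast
  assume l: "functional M l"
  define e where "e = (\<lambda>i::nat. (int k - int i, int i))"
  have "l (msum M (?g (m, n))) = (\<Sum>i\<in>{..k}. l (?g (m, n) (e i)))"
  proof (rule functional_msum[OF l g])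
    show "inj_on e {..k}" by (auto simp: e_def inj_on_def)
    fix s assume s: "s \<notin> e ` {..k}"
    obtain a b where ab: "s = (a, b)" by (cases s)
    show "?g (m, n) s = \<zero>"
    proof (cases "b \<ge> 0 \<and> a + b = int k \<and> b \<le> int k")
      case True
      then have "s = e (nat b)" "nat b \<le> k" by (auto simp: ab e_def)
      with s show ?thesis by blast
    next
      case False
      have "(of_int (int k) gchoose nat b :: complex) = 0" if "b > int k"
      proof -
        have "k < nat b" using that by simp
        then show ?thesis by (simp add: binomial_gbinomial[symmetric] binomial_eq_0)
      qed
      with False show ?thesis using w
        by (auto simp: ab diff_pow_def)
    qed
  qed simp
  also have "\<dots> = cleared_coeff YW k l u v w m n"
    unfolding diff_times_nat
    by (rule sum.cong[OF refl])
       (use w in \<open>simp add: e_def diff_pow_def functional_smult[OF l] prod_coeff_def binomial_gbinomial algebra_simps\<close>)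
  finally show "l (product_series k u v w (m, n)) = cleared_coeff YW k l u v w m n"
    by (simp add: product_series_def fmul_def)
qed

text \<open>One bound \<open>N\<close> is shared by all functionals; through
  \<open>zero_iff_functionals\<close> it becomes the truncation of the vector-valued series.\<close>

lemma product_series_laurent2_iff:
  assumes w: "w \<in> carrier M"
  shows "product_series k u v w \<in> laurent2 M \<longleftrightarrow>
    (\<exists>N. \<forall>l. functional M l \<longrightarrow> bounded2 N (cleared_coeff YW k l u v w))"
proof -
  have "product_series k u v w \<in> laurent2 M \<longleftrightarrow> (\<exists>N. \<forall>m n. m < N \<or> n < N \<longrightarrow> product_series k u v w (m, n) = \<zero>)"
    using product_series(1)[OF w] by (simp add: laurent2_def)
  also have "\<dots> \<longleftrightarrow> (\<exists>N. \<forall>m n. m < N \<or> n < N \<longrightarrow> (\<forall>l. functional M l \<longrightarrow> l (product_series k u v w (m, n)) = 0))"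
    by (simp add: zero_iff_functionals[OF product_series(1)[OF w]])
  also have "\<dots> \<longleftrightarrow> (\<exists>N. \<forall>l. functional M l \<longrightarrow> bounded2 N (cleared_coeff YW k l u v w))"
    unfolding bounded2_def using product_series(2)[OF w, of _ k u v] by (intro ex_cong1) metis
  finally show ?thesis .
qed

text \<open>The monomial \<open>phi(x,z)^m x^n\<close> contributes to \<open>z^j\<close> only with
  the power \<open>x^(m+n+j)\<close>. So the exponents \<open>r\<close> and \<open>j\<close> select
  the total degree \<open>r - j\<close>, and the sum over \<open>m\<close> is a generating function
  along that antidiagonal.\<close>

lemma subst_phi_product_series:
  assumes w: "w \<in> carrier M"
  shows "subst_phi M (product_series k u v w) (r, j) \<in> carrier M"
    and "functional M l \<Longrightarrow> bounded2 N (cleared_coeff YW k l u v w) \<Longrightarrow>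
      (\<And>m n. m < N \<or> n < N \<Longrightarrow> product_series k u v w (m, n) = \<zero>) \<Longrightarrow>
      l (subst_phi M (product_series k u v w) (r, j)) =
      (if j < 0 then 0 else antidiag_gen (- 1) (cleared_coeff YW k l u v w) (r - j) $ nat j)"
proof -
  let ?F = "product_series k u v w"
  let ?g = "\<lambda>(m, n). phi_pow m (r - n, j) \<odot> ?F (m, n)"
  have g: "?g s \<in> carrier M" for s
    using product_series(1)[OF w] by (auto split: prod.splits)
  show "subst_phi M ?F (r, j) \<in> carrier M"
    unfolding subst_phi_def using g by auto
  assume l: "functional M l" and b: "bounded2 N (cleared_coeff YW k l u v w)"
    and z: "\<And>m n. m < N \<or> n < N \<Longrightarrow> product_series k u v w (m, n) = \<zero>"
  define e where "e = (\<lambda>m. (m, r - j - m))"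
  have "l (msum M ?g) = (\<Sum>m\<in>{N..r - j - N}. l (?g (e m)))"
  proof (rule functional_msum[OF l g])
    show "inj_on e {N..r - j - N}" by (auto simp: e_def inj_on_def)
    fix s assume s: "s \<notin> e ` {N..r - j - N}"
    obtain m n where mn: "s = (m, n)" by (cases s)
    show "?g s = \<zero>"
    proof (cases "m < N \<or> n < N")
      case True
      then show ?thesis by (simp add: mn z)
    next
      case False
      have "m + n \<noteq> r - j"
      proof
        assume "m + n = r - j"
        with False have "s = e m" "m \<in> {N..r - j - N}" by (auto simp: mn e_def)
        with s show False by blast
      qed
      then show ?thesis using product_series(1)[OF w] by (simp add: mn phi_pow_def)
    qed
  qed simp
  also have "\<dots> = (if j < 0 then 0 else antidiag_gen (- 1) (cleared_coeff YW k l u v w) (r - j) $ nat j)"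
    by (subst antidiag_gen_eq_sum[OF b finite_atLeastAtMost_int order_refl])
       (auto simp: e_def phi_pow_def functional_zero[OF l] functional_smult[OF l] product_series[OF w] l fps_sum_nth)
  finally show "l (subst_phi M ?F (r, j)) =
      (if j < 0 then 0 else antidiag_gen (- 1) (cleared_coeff YW k l u v w) (r - j) $ nat j)"
    by (simp add: subst_phi_def)
qed

end

text \<open>The reason is \<open>phi(x,z) - x = x ((1+zx)^(-1) - 1)\<close>, that is,
  \<open>x\<close> times \<open>inversion\<close> evaluated at \<open>zx\<close>.\<close>

lemma phi_minus_x_eq: "phi_minus_x (a, b) = (if b \<ge> 0 \<and> a = 1 + b then inversion $ nat b else 0)"
  by (auto simp: phi_minus_x_def phi_pow_def inversion_def)

lemma cpow_phi_minus_x: "cpow phi_minus_x k (a, b) = (if b \<ge> 0 \<and> a = int k + b then (inversion ^ k) $ nat b else 0)"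
proof (induction k arbitrary: a b)
  case 0
  then show ?case by (auto simp: cpow_def cone_def zero_prod_def)
next
  case (Suc k)
  let ?f = "\<lambda>s. phi_minus_x s * cpow phi_minus_x k ((a, b) - s)"
  have "cpow phi_minus_x (Suc k) (a, b) = Sum_any ?f"
    by (simp add: cpow_def cmul_def)
  also have "\<dots> = (\<Sum>s\<in>(\<lambda>i. (1 + int i, int i)) ` {..nat b}. ?f s)"
  proof (rule Sum_any.expand_superset)
    show "{s. ?f s \<noteq> 0} \<subseteq> (\<lambda>i. (1 + int i, int i)) ` {..nat b}"
    proof
      fix s assume s: "s \<in> {s. ?f s \<noteq> 0}"
      obtain p q where pq: "s = (p, q)" by (cases s)
      have "q \<ge> 0" "p = 1 + q" "q \<le> b"
        using s by (auto simp: pq phi_minus_x_eq Suc split: if_splits)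
      then show "s \<in> (\<lambda>i. (1 + int i, int i)) ` {..nat b}"
        by (intro image_eqI[of _ _ "nat q"]) (auto simp: pq)
    qed
  qed simp
  also have "\<dots> = (\<Sum>i\<le>nat b. ?f (1 + int i, int i))"
    by (subst sum.reindex) (auto simp: inj_on_def)
  also have "\<dots> = (if b \<ge> 0 \<and> a = int (Suc k) + b then (\<Sum>i\<le>nat b. inversion $ i * (inversion ^ k) $ (nat b - i)) else 0)"
    by (cases "b \<ge> 0") (auto simp: phi_minus_x_eq Suc nat_diff_distrib intro!: sum.cong sum.neutral)
  also have "\<dots> = (if b \<ge> 0 \<and> a = int (Suc k) + b then (inversion ^ Suc k) $ nat b else 0)"
    by (simp add: fps_mult_nth atLeast0AtMost)
  finally show ?case .
qed

context vertex_space
begin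

definition iterate_series :: "('v, 'v) vmap \<Rightarrow> nat \<Rightarrow> 'v \<Rightarrow> 'v \<Rightarrow> 'w \<Rightarrow> int \<times> int \<Rightarrow> 'w" where
  "iterate_series Y k u v w = fmul M (cpow phi_minus_x k) (\<lambda>(r, j). YW (Y u j v) r w)"

lemma iterate_series:
  assumes w: "w \<in> carrier M" and K: "\<And>j. j < K \<Longrightarrow> Y u j v = 0"
  shows "iterate_series Y k u v w (r, j) \<in> carrier M"
    and "functional M l \<Longrightarrow> j - K < int B \<Longrightarrow> l (iterate_series Y k u v w (r, j)) =
      (\<Sum>b<B. (inversion ^ k) $ b * iter_coeff YW Y l u v w (j - int b) (r - int k - int b))"
proof -
  let ?g = "\<lambda>s. cpow phi_minus_x k s \<odot> (case (r, j) - s of (r, j) \<Rightarrow> YW (Y u j v) r w)"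
  have g: "?g s \<in> carrier M" for s
    using w by (auto split: prod.splits)
  show "iterate_series Y k u v w (r, j) \<in> carrier M"
    unfolding iterate_series_def fmul_def using g by blast
  assume l: "functional M l" and B: "j - K < int B"
  define e where "e = (\<lambda>b::nat. (int k + int b, int b))"
  have "l (msum M ?g) = (\<Sum>b\<in>{..<B}. l (?g (e b)))"
  proof (rule functional_msum[OF l g])
    show "inj_on e {..<B}" by (auto simp: e_def inj_on_def)
    fix s assume s: "s \<notin> e ` {..<B}"
    obtain a b where ab: "s = (a, b)" by (cases s)
    show "?g s = \<zero>"
    proof (cases "b \<ge> 0 \<and> a = int k + b \<and> b < int B")
      case True
      then have "s = e (nat b)" "nat b < B" by (auto simp: ab e_def)
      with s show ?thesis by blast
    next
      case False
      then show ?thesis using w B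
        by (auto simp: ab cpow_phi_minus_x K)
    qed
  qed simp
  also have "\<dots> = (\<Sum>b<B. (inversion ^ k) $ b * iter_coeff YW Y l u v w (j - int b) (r - int k - int b))"
    by (rule sum.cong[OF refl])
       (use w in \<open>simp add: e_def cpow_phi_minus_x functional_smult[OF l] iter_coeff_def algebra_simps\<close>)
  finally show "l (iterate_series Y k u v w (r, j)) =
      (\<Sum>b<B. (inversion ^ k) $ b * iter_coeff YW Y l u v w (j - int b) (r - int k - int b))"
    by (simp add: iterate_series_def fmul_def)
qed

end

text \<open>The left-hand side is the substitution condition of the coordinate \<open>x / (1 + z x)\<close>, read off
  coefficient by coefficient.\<close>

lemma expands_uminus_1_iff:
  assumes K: "\<And>j r. j < K \<Longrightarrow> Q j r = 0"
  shows "(\<forall>r j. (if j < 0 then 0 else antidiag_gen (- 1) F (r - j) $ nat j) =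
      (\<Sum>b<nat (j - K) + 1. (inversion ^ k) $ b * Q (j - int b) (r - int k - int b))) \<longleftrightarrow>
    expands (- 1) k F Q"
    (is "?L \<longleftrightarrow> ?R")
proof -
  have inv: "inversion ^ k = fps_X ^ k * coord_unit (- 1) k"
    by (simp add: inversion_power coord_unit_def mult_ac)
  have low: "(inversion ^ k) $ b = 0" if "b < k" for b
    using that by (simp add: startsby_zero_power_prefix)
  have one: "(inversion ^ k) $ k = (- 1) ^ k"
    unfolding inv fps_X_power_mult_nth
    by (simp add: coord_unit_def fps_mult_nth_0 fps_power_zeroth)
  have sum: "(\<Sum>b<B. (inversion ^ k) $ b * Q (j - int b) (r - int k - int b)) =
      (\<Sum>b<nat (j - K) + 1. (inversion ^ k) $ b * Q (j - int b) (r - int k - int b))" if "nat (j - K) + 1 \<le> B" for B j r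
    using that by (intro sum.mono_neutral_right) (auto intro!: K)
  have key: "(\<Sum>b<nat (j - K) + 1. (inversion ^ k) $ b * Q (j - int b) (r - int k - int b)) =
      (coord_unit (- 1) k * expansion_series (- 1) k Q (r - j)) $ nat j"
    if j: "j \<ge> 0" and Q: "\<And>j r. j < - int k \<Longrightarrow> Q j r = 0" for j r
  proof -
    have "(\<Sum>b<nat (j - K) + 1. (inversion ^ k) $ b * Q (j - int b) (r - int k - int b)) =
        (\<Sum>b<nat (j - K) + 1 + nat j + k + 1. (inversion ^ k) $ b * Q (j - int b) (r - int k - int b))"
      by (rule sum[symmetric]) simp
    also have "\<dots> = (\<Sum>b\<le>nat j + k. (inversion ^ k) $ b * Q (j - int b) (r - int k - int b))"
      using j by (intro sum.mono_neutral_right) (auto intro!: Q)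
    also have "\<dots> = (inversion ^ k * expansion_series (- 1) k Q (r - j)) $ (nat j + k)"
      unfolding fps_mult_nth atLeast0AtMost
      by (rule sum.cong[OF refl]) (use j in \<open>simp add: of_nat_diff algebra_simps\<close>)
    also have "\<dots> = (coord_unit (- 1) k * expansion_series (- 1) k Q (r - j)) $ nat j"
      unfolding inv mult.assoc fps_X_power_mult_nth by simp
    finally show ?thesis .
  qed
  show ?thesis
  proof
    assume L: ?L
    \<comment> \<open>The pole condition is forced by the identity itself. In its coefficient at
      \<open>z^(j+k)\<close> with \<open>j + k < 0\<close> the left-hand side is zero; terms with
      \<open>b < k\<close> vanish because \<open>inversion^k\<close> starts at \<open>z^k\<close>,
      those with \<open>b > k\<close> vanish by induction, and the term \<open>b = k\<close> has the
      coefficient \<open>(-1)^k\<close>.\<close>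
    have Q: "Q j r = 0" if "j < - int k" for j r
      using that
    proof (induction "nat (j - K + 1)" arbitrary: j r rule: less_induct)
      case less
      show ?case
      proof (cases "j < K")
        case False
        define B where "B = nat (j + int k - K) + 1"
        have "k < B" using False by (simp add: B_def)
        have "0 = (\<Sum>b<B. (inversion ^ k) $ b * Q (j + int k - int b) (r + 2 * int k - int k - int b))"
          using L[rule_format, where j = "j + int k" and r = "r + 2 * int k"] less.prems by (simp add: B_def)
        also have "\<dots> = (\<Sum>b\<in>{k}. (inversion ^ k) $ b * Q (j + int k - int b) (r + 2 * int k - int k - int b))"
        proof (rule sum.mono_neutral_right)
          show "\<forall>b\<in>{..<B} - {k}. (inversion ^ k) $ b * Q (j + int k - int b) (r + 2 * int k - int k - int b) = 0"
          proof
            fix b assume "b \<in> {..<B} - {k}"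
            then consider "b < k" | "b > k" by force
            then show "(inversion ^ k) $ b * Q (j + int k - int b) (r + 2 * int k - int k - int b) = 0"
            proof cases
              case 2
              then have "Q (j + int k - int b) (r + 2 * int k - int k - int b) = 0"
                using less.prems False by (intro less.hyps) auto
              then show ?thesis by simp
            qed (simp add: low)
          qed
        qed (use \<open>k < B\<close> in auto)
        finally show ?thesis by (simp add: one)
      qed (simp add: K)
    qed
    show ?R
      unfolding expands_def
    proof (intro conjI allI impI)
      fix d
      show "antidiag_gen (- 1) F d = coord_unit (- 1) k * expansion_series (- 1) k Q d"
      proof (rule fps_ext)
        fix n
        show "antidiag_gen (- 1) F d $ n = (coord_unit (- 1) k * expansion_series (- 1) k Q d) $ n"
          using L[rule_format, where j = "int n" and r = "d + int n"] key[of "int n" "d + int n", OF _ Q] by simp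
      qed
    qed (rule Q)
  next
    assume R: ?R
    then have Q: "Q j r = 0" if "j < - int k" for j r using that by (simp add: expands_def)
    show ?L
    proof (intro allI)
      fix r j
      show "(if j < 0 then 0 else antidiag_gen (- 1) F (r - j) $ nat j) =
        (\<Sum>b<nat (j - K) + 1. (inversion ^ k) $ b * Q (j - int b) (r - int k - int b))"
      proof (cases "j < 0")
        case True
        have "(inversion ^ k) $ b * Q (j - int b) (r - int k - int b) = 0" for b
          using True by (cases "b < k") (auto simp: low intro!: Q)
        then have "(\<Sum>b<nat (j - K) + 1. (inversion ^ k) $ b * Q (j - int b) (r - int k - int b)) = 0"
          by (intro sum.neutral) blast
        with True show ?thesis by (simp only: if_True)
      next
        case False
        then show ?thesis using R key[of j r, OF _ Q] by (simp add: expands_def)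
      qed
    qed
  qed
qed

context vertex_space
begin

lemma phi_condition_iff:
  assumes w: "w \<in> carrier M" and K: "\<And>j. j < K \<Longrightarrow> Y u j v = 0"
  shows "(let F = fmul M (diff_pow (int k)) (\<lambda>(m, n). YW u m (YW v n w)) in
         F \<in> laurent2 M \<and>
         subst_phi M F = fmul M (cpow phi_minus_x k) (\<lambda>(r, j). YW (Y u j v) r w)) \<longleftrightarrow>
     (\<exists>N. \<forall>l. functional M l \<longrightarrow> bounded2 N (cleared_coeff YW k l u v w)) \<and>
     (\<forall>l. functional M l \<longrightarrow> expands (- 1) k (cleared_coeff YW k l u v w) (iter_coeff YW Y l u v w))"
proof -
  let ?F = "product_series k u v w" and ?G = "iterate_series Y k u v w"
  have "?F \<in> laurent2 M \<Longrightarrow> subst_phi M ?F = ?G \<longleftrightarrow>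
     (\<forall>l. functional M l \<longrightarrow> expands (- 1) k (cleared_coeff YW k l u v w) (iter_coeff YW Y l u v w))"
  proof -
    assume "?F \<in> laurent2 M"
    then obtain N where "\<forall>m n. m < N \<or> n < N \<longrightarrow> ?F (m, n) = \<zero>"
      unfolding laurent2_def by blast
    then have N: "\<And>m n. m < N \<or> n < N \<Longrightarrow> ?F (m, n) = \<zero>" by blast
    have b: "bounded2 N (cleared_coeff YW k l u v w)" if "functional M l" for l
      using N product_series(2)[OF w that, of k u v] functional_zero[OF that] by (metis bounded2_def)
    have Q: "iter_coeff YW Y l u v w j r = 0" if "functional M l" "j < K" for l j r
      using that w by (simp add: iter_coeff_def K functional_zero)
    have "subst_phi M ?F = ?G \<longleftrightarrow> (\<forall>r j l. functional M l \<longrightarrow> l (subst_phi M ?F (r, j)) = l (?G (r, j)))"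
      using functionals_separate[OF subst_phi_product_series(1)[OF w] iterate_series(1)[where Y = Y and u = u and v = v and K = K, OF w K]]
      by (auto simp: fun_eq_iff)
    also have "\<dots> \<longleftrightarrow> (\<forall>l. functional M l \<longrightarrow> (\<forall>r j. (if j < 0 then 0 else antidiag_gen (- 1) (cleared_coeff YW k l u v w) (r - j) $ nat j) =
      (\<Sum>b<nat (j - K) + 1. (inversion ^ k) $ b * iter_coeff YW Y l u v w (j - int b) (r - int k - int b))))"
    proof -
      have "(l (subst_phi M ?F (r, j)) = l (?G (r, j))) \<longleftrightarrow> ((if j < 0 then 0 else antidiag_gen (- 1) (cleared_coeff YW k l u v w) (r - j) $ nat j) =
      (\<Sum>b<nat (j - K) + 1. (inversion ^ k) $ b * iter_coeff YW Y l u v w (j - int b) (r - int k - int b)))"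
        if l: "functional M l" for l r j
        using subst_phi_product_series(2)[OF w l b[OF l] N, of r j]
          iterate_series(2)[where Y = Y and u = u and v = v and K = K, OF w K l, of j "nat (j - K) + 1" k r]
        by simp
      then show ?thesis by blast
    qed
    also have "\<dots> \<longleftrightarrow> (\<forall>l. functional M l \<longrightarrow> expands (- 1) k (cleared_coeff YW k l u v w) (iter_coeff YW Y l u v w))"
    proof -
      have "(\<forall>r j. (if j < 0 then 0 else antidiag_gen (- 1) (cleared_coeff YW k l u v w) (r - j) $ nat j) =
        (\<Sum>b<nat (j - K) + 1. (inversion ^ k) $ b * iter_coeff YW Y l u v w (j - int b) (r - int k - int b))) \<longleftrightarrow>
        expands (- 1) k (cleared_coeff YW k l u v w) (iter_coeff YW Y l u v w)" if "functional M l" for l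
        by (rule expands_uminus_1_iff) (rule Q[OF that])
      then show ?thesis by blast
    qed
    finally show ?thesis .
  qed
  then show ?thesis
    unfolding Let_def product_series_def[symmetric] iterate_series_def[symmetric]
      product_series_laurent2_iff[OF w, symmetric] by blast
qed

end

section \<open>Identities in the vertex operator algebra\<close>

lemma type_space_simps [simp]:
  "carrier (type_space scale) = UNIV" "x \<oplus>\<^bsub>type_space scale\<^esub> y = x + y"
  "\<zero>\<^bsub>type_space scale\<^esub> = 0" "a \<odot>\<^bsub>type_space scale\<^esub> x = scale a x"
  by (simp_all add: type_space_def)

lemma sum_atMost_shift:
  fixes f :: "nat \<Rightarrow> 'a::comm_monoid_add"
  assumes "f 0 = 0" and "f (Suc B) = 0"
  shows "(\<Sum>i\<le>B. f (Suc i)) = (\<Sum>i\<le>B. f i)"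
  using sum.atMost_Suc_shift[of f B] sum.atMost_Suc[of f B] assms by simp

context vertex_operator_algebra
begin

sublocale adj: vertex_space "type_space scale" scale vac Y
  using adjoint_module by unfold_locales (simp_all add: va_module_def)

lemma Y_add_right: "Y v n (x + y) = Y v n x + Y v n y"
  using adj.YW_lin[of v n] by (auto simp: lin_maps_def)

lemma Y_scale_right: "Y v n (scale a x) = scale a (Y v n x)"
  using adj.YW_lin[of v n] by (auto simp: lin_maps_def)

lemma Y_add_left: "Y (u + v) n x = Y u n x + Y v n x"
  using adj.YW_add[of x u v n] by simp

lemma Y_scale_left: "Y (scale a v) n x = scale a (Y v n x)"
  using adj.YW_scale[of x a v n] by simp

lemma Y_zero_right [simp]: "Y v n 0 = 0"
  using Y_add_right[of v n 0 0] by simp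

lemma Y_zero_left [simp]: "Y 0 n x = 0"
  using Y_add_left[of 0 0 n x] by simp

lemma Y_bounded: "\<exists>K. \<forall>j<K. Y u j v = 0"
  using adj.YW_bounded[of v u] by simp

lemma functional_V: "functional (type_space scale) l \<longleftrightarrow>
    (\<forall>x y. l (x + y) = l x + l y) \<and> (\<forall>a x. l (scale a x) = a * l x)"
  by (simp add: functional_def)

lemma functional_V_sum:
  assumes "functional (type_space scale) l"
  shows "l (sum f A) = (\<Sum>i\<in>A. l (f i))"
proof (induction A rule: infinite_finite_induct)
  case (insert x F)
  then show ?case using assms by (simp add: functional_V)
next
  case (infinite A)
  then show ?case using adj.functional_zero[OF assms] by simp
qed (use adj.functional_zero[OF assms] in simp)

lemma functional_V_diff:
  assumes "functional (type_space scale) l"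
  shows "l (x - y) = l x - l y"
  using assms unfolding functional_V by (metis add_diff_cancel_right' diff_add_cancel)

lemma V_eqI: "(\<And>l. functional (type_space scale) l \<Longrightarrow> l x = l y) \<Longrightarrow> x = y"
  using adj.functionals_separate[of x y] by simp

lemma scalar_jacobi_V:
  assumes "functional (type_space scale) l"
  shows "scalar_jacobi (prod_coeff Y l u v w) (prod_coeff Y l v u w) (iter_coeff Y Y l u v w)"
proof -
  obtain K where K: "\<And>j. j < K \<Longrightarrow> Y u j v = 0" using Y_bounded by blast
  have "jacobi_identity Y (type_space scale) Y u v w"
    using adjoint_module by (simp add: va_module_def)
  then show ?thesis
    using adj.jacobi_identity_iff[where Y = Y and u = u and v = v and K = K and w = w, OF _ K] assms by simp
qed

text \<open>The case \<open>n = 0\<close> of the Jacobi identity. \<open>Y v (- 1 - int c)\<close>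
  is the mode \<open>v_c\<close>, and \<open>c choose p\<close> cuts the sum off at
  \<open>c\<close>. For the conformal vector, \<open>c = 1\<close> and \<open>c = 2\<close> give the
  commutators with L(0) and L(1).\<close>

lemma commutator:
  "Y v (- 1 - int c) (Y u b w) - Y u b (Y v (- 1 - int c) w) =
    (\<Sum>p\<le>c. scale (of_nat (c choose p)) (Y (Y v (- 1 - int p) u) (b - int c + int p) w))"
proof (rule V_eqI)
  fix l assume l: "functional (type_space scale) l"
  obtain N where N: "\<And>l. functional (type_space scale) l \<Longrightarrow> bounded_snd N (prod_coeff Y l v u w)"
    by (rule adj.prod_coeff_bounded[of w v u]) auto
  obtain N' where N': "\<And>l. functional (type_space scale) l \<Longrightarrow> bounded_snd N' (prod_coeff Y l u v w)"
    by (rule adj.prod_coeff_bounded[of w u v]) auto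
  have "l (Y v (- 1 - int c) (Y u b w) - Y u b (Y v (- 1 - int c) w)) =
      diff_times 0 (prod_coeff Y l v u w) (- 1 - int c) b - (- 1) powi 0 * diff_times 0 (prod_coeff Y l u v w) b (- 1 - int c)"
    by (simp add: diff_times_0[OF N[OF l]] diff_times_0[OF N'[OF l]] prod_coeff_def functional_V_diff[OF l])
  also have "\<dots> = Sum_any (\<lambda>p::nat. (of_int (- (- 1 - int c) - 1) gchoose p) *
      iter_coeff Y Y l v u w (- 0 - 1 - int p) (b + 1 + (- 1 - int c) + int p))"
    using scalar_jacobi_V[OF l, of v u w] unfolding scalar_jacobi_def by blast
  also have "\<dots> = (\<Sum>p\<le>c. (of_int (- (- 1 - int c) - 1) gchoose p) *
      iter_coeff Y Y l v u w (- 0 - 1 - int p) (b + 1 + (- 1 - int c) + int p))"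
    by (rule Sum_any.expand_superset) (auto simp: binomial_gbinomial[symmetric] binomial_eq_0_iff not_less[symmetric])
  also have "\<dots> = l (\<Sum>p\<le>c. scale (of_nat (c choose p)) (Y (Y v (- 1 - int p) u) (b - int c + int p) w))"
    unfolding functional_V_sum[OF l] using l
    by (intro sum.cong refl) (simp add: functional_V iter_coeff_def binomial_gbinomial)
  finally show "l (Y v (- 1 - int c) (Y u b w) - Y u b (Y v (- 1 - int c) w)) =
    l (\<Sum>p\<le>c. scale (of_nat (c choose p)) (Y (Y v (- 1 - int p) u) (b - int c + int p) w))" .
qed

text \<open>Applied to the vacuum at one coefficient, the Jacobi identities for (u,v) and (v,u) have
  the same left-hand side up to a sign. Equating the right-hand sides gives
  \<open>Y(u,z)v = e^(zL(-1)) Y(v,-z)u\<close>, where \<open>e^(zL(-1)) a\<close> is kept in the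
  form \<open>Y(a,z)1\<close>.\<close>

lemma skew_symmetry:
  assumes K: "\<And>j. j < K \<Longrightarrow> Y v j u = 0" and B: "j - K < int B"
  shows "Y u j v = (\<Sum>p<B. scale ((- 1) powi (j + int p)) (Y (Y v (j - int p) u) (int p) vac))"
proof (rule V_eqI)
  fix l assume l: "functional (type_space scale) l"
  define n where "n = - j - 1"
  define x where "x = diff_times n (prod_coeff Y l u v vac) (- 1) 0"
  define y where "y = diff_times n (prod_coeff Y l v u vac) 0 (- 1)"
  have "x - (- 1) powi n * y = Sum_any (\<lambda>p::nat. (of_int (- (- 1) - 1) gchoose p) * iter_coeff Y Y l u v vac (- n - 1 - int p) (0 + 1 + (- 1) + int p))"
    using scalar_jacobi_V[OF l, of u v vac] unfolding scalar_jacobi_def x_def y_def by blast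
  also have "\<dots> = (\<Sum>p\<in>{0}. (of_int (- (- 1) - 1) gchoose p) * iter_coeff Y Y l u v vac (- n - 1 - int p) (0 + 1 + (- 1) + int p))"
    by (rule Sum_any.expand_superset) (auto simp: gbinomial_0_left)
  finally have 1: "x - (- 1) powi n * y = l (Y u j v)"
    by (simp add: iter_coeff_def n_def creation)
  have "y - (- 1) powi n * x = Sum_any (\<lambda>p::nat. (of_int (- 0 - 1) gchoose p) * iter_coeff Y Y l v u vac (- n - 1 - int p) (- 1 + 1 + 0 + int p))"
    using scalar_jacobi_V[OF l, of v u vac] unfolding scalar_jacobi_def x_def y_def by blast
  also have "\<dots> = (\<Sum>p<B. (of_int (- 0 - 1) gchoose p) * iter_coeff Y Y l v u vac (- n - 1 - int p) (- 1 + 1 + 0 + int p))"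
  proof (rule Sum_any.expand_superset)
    have "iter_coeff Y Y l v u vac (- n - 1 - int p) (- 1 + 1 + 0 + int p) = 0" if "p \<ge> B" for p
      using that B by (simp add: iter_coeff_def n_def K adj.functional_zero[OF l, simplified])
    then show "{p. (of_int (- 0 - 1) gchoose p) * iter_coeff Y Y l v u vac (- n - 1 - int p) (- 1 + 1 + 0 + int p) \<noteq> 0} \<subseteq> {..<B}"
      by (auto simp: not_le[symmetric])
  qed simp
  also have "\<dots> = (\<Sum>p<B. (- 1) ^ p * l (Y (Y v (j - int p) u) (int p) vac))"
  proof (rule sum.cong[OF refl])
    fix p
    have "(- 1 gchoose p :: complex) = (- 1) ^ p"
      using gbinomial_minus[of "1 :: complex" p] by (simp add: gbinomial_of_nat_symmetric binomial_gbinomial[symmetric] of_nat_gbinomial)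
    then show "(of_int (- 0 - 1) gchoose p) * iter_coeff Y Y l v u vac (- n - 1 - int p) (- 1 + 1 + 0 + int p) = (- 1) ^ p * l (Y (Y v (j - int p) u) (int p) vac)"
      by (simp add: iter_coeff_def n_def)
  qed
  finally have 2: "y - (- 1) powi n * x = (\<Sum>p<B. (- 1) ^ p * l (Y (Y v (j - int p) u) (int p) vac))" .
  have "(- 1) powi n * (- 1) powi n = (1 :: complex)"
    by (simp add: power_int_mult_distrib[symmetric])
  then have "x - (- 1) powi n * y = (- ((- 1) powi n)) * (y - (- 1) powi n * x)"
    by (simp add: algebra_simps)
  moreover have "- ((- 1) powi n) = ((- 1) powi j :: complex)"
    using power_int_minus_one_minus[of "j + 1", where 'a = complex] by (simp add: n_def power_int_add)
  ultimately have "l (Y u j v) = (- 1) powi j * (\<Sum>p<B. (- 1) ^ p * l (Y (Y v (j - int p) u) (int p) vac))"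
    using 1 2 by simp
  also have "\<dots> = l (\<Sum>p<B. scale ((- 1) powi (j + int p)) (Y (Y v (j - int p) u) (int p) vac))"
    unfolding functional_V_sum[OF l] sum_distrib_left using l
    by (intro sum.cong refl) (simp add: functional_V power_int_add)
  finally show "l (Y u j v) = l (\<Sum>p<B. scale ((- 1) powi (j + int p)) (Y (Y v (j - int p) u) (int p) vac))" .
qed

subsection \<open>Weights and the action of L(1)\<close>

abbreviation L1 :: "'v \<Rightarrow> 'v" where "L1 \<equiv> Lop Y \<omega> 1"

abbreviation weight :: "int \<Rightarrow> 'v set" where "weight \<equiv> weight_space scale Y \<omega>"

lemma L1_add: "L1 (x + y) = L1 x + L1 y"
  by (simp add: Lop_def Y_add_right)

lemma L1_scale: "L1 (scale a x) = scale a (L1 x)"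
  by (simp add: Lop_def Y_scale_right)

lemma L1_pow_add: "(L1 ^^ i) (x + y) = (L1 ^^ i) x + (L1 ^^ i) y"
  by (induction i) (simp_all add: L1_add)

lemma L1_pow_scale: "(L1 ^^ i) (scale a x) = scale a ((L1 ^^ i) x)"
  by (induction i) (simp_all add: L1_scale)

lemma L1_pow_zero [simp]: "(L1 ^^ i) 0 = 0"
  using L1_pow_scale[of i 0 0] by simp

lemma L1_pow_sum: "(L1 ^^ i) (sum f A) = (\<Sum>x\<in>A. (L1 ^^ i) (f x))"
  by (induction A rule: infinite_finite_induct) (simp_all add: L1_pow_add)

lemma weight_iff: "v \<in> weight h \<longleftrightarrow> Lop Y \<omega> 0 v = scale (of_int h) v"
  by (simp add: weight_space_def)

lemma weight_zero [simp]: "0 \<in> weight h"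
  by (simp add: weight_iff Lop_def)

lemma weight_add: "u \<in> weight h \<Longrightarrow> v \<in> weight h \<Longrightarrow> u + v \<in> weight h"
  by (simp add: weight_iff Lop_def Y_add_right scale_right_distrib)

lemma weight_scale: "v \<in> weight h \<Longrightarrow> scale a v \<in> weight h"
  by (simp add: weight_iff Lop_def Y_scale_right mult.commute)

lemma weight_Y:
  assumes "u \<in> weight h" "v \<in> weight h'"
  shows "Y u b v \<in> weight (h + h' + b)"
proof -
  have "Lop Y \<omega> 0 (Y u b v) - Y u b (Lop Y \<omega> 0 v) =
      Y (Lop Y \<omega> (- 1) u) (b - 1) v + Y (Lop Y \<omega> 0 u) b v"
    using commutator[of \<omega> 1 u b v] by (simp add: Lop_def)
  then show ?thesis
    using assms derivative[of u "b - 1" v]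
    by (simp add: weight_iff Y_scale_left Y_scale_right scale_left_distrib algebra_simps)
qed

text \<open>The bracket of L(1) with \<open>Y(u,z)\<close> is
  \<open>Y(L(1)u + 2z L(0)u + z^2 L(-1)u, z)\<close>; the weight and the derivative property merge
  the last two terms.\<close>

lemma L1_Y:
  assumes "u \<in> weight h"
  shows "L1 (Y u b v) = Y (L1 u) b v + scale (of_int (2 * h + b - 1)) (Y u (b - 1) v) + Y u b (L1 v)"
proof -
  have "L1 (Y u b v) - Y u b (L1 v) =
      Y (Lop Y \<omega> (- 1) u) (b - 2) v + scale 2 (Y (Lop Y \<omega> 0 u) (b - 1) v) + Y (L1 u) b v"
    using commutator[of \<omega> 2 u b v] by (simp add: Lop_def eval_nat_numeral atMost_Suc algebra_simps)
  then show ?thesis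
    using assms derivative[of u "b - 2" v]
    by (simp add: weight_iff Y_scale_left scale_left_distrib scale_left_diff_distrib algebra_simps)
qed

lemma L1_weight:
  assumes "v \<in> weight h"
  shows "L1 v \<in> weight (h - 1)"
proof -
  obtain c where "\<forall>m n v. Lop Y \<omega> m (Lop Y \<omega> n v) - Lop Y \<omega> n (Lop Y \<omega> m v) =
        scale (of_int (m - n)) (Lop Y \<omega> (m + n) v) +
        (if m + n = 0 then scale (of_int (m ^ 3 - m) / 12 * c) v else 0)"
    using virasoro by blast
  from this[rule_format, of 1 0 v] have "L1 (Lop Y \<omega> 0 v) - Lop Y \<omega> 0 (L1 v) = L1 v" by simp
  then have "Lop Y \<omega> 0 (L1 v) = scale (of_int h) (L1 v) - L1 v"
    using assms by (simp add: weight_iff L1_scale algebra_simps)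
  then show ?thesis by (simp add: weight_iff scale_left_diff_distrib)
qed

lemma L1_pow_weight: "v \<in> weight h \<Longrightarrow> (L1 ^^ i) v \<in> weight (h - int i)"
proof (induction i)
  case (Suc i)
  then show ?case using L1_weight[of "(L1 ^^ i) v" "h - int i"] by (simp add: algebra_simps)
qed simp

text \<open>Each application lowers the weight by one, and the weights are bounded below.\<close>

lemma L1_nilpotent:
  assumes "v \<in> weight h"
  obtains I where "\<And>i. i \<ge> I \<Longrightarrow> (L1 ^^ i) v = 0"
proof -
  obtain N where N: "\<And>h. h < N \<Longrightarrow> weight h = {0}" using bounded_below by blast
  show ?thesis
  proof (rule that[of "Suc (nat (h - N))"])
    fix i assume "i \<ge> Suc (nat (h - N))"
    then have "h - int i < N" by linarith
    then show "(L1 ^^ i) v = 0" using N L1_pow_weight[OF assms, of i] by auto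
  qed
qed

lemma L1_vac: "L1 vac = 0"
  using creation(2)[of "- 3" \<omega>] by (simp add: Lop_def)

lemma L1_pow_vac: "i > 0 \<Longrightarrow> (L1 ^^ i) vac = 0"
  by (cases i) (simp_all add: funpow_swap1[symmetric] L1_vac del: funpow.simps(2), simp add: funpow_Suc_right L1_vac del: funpow.simps)

text \<open>Divided powers: the coefficients of the exponential of \<open>t L(1)\<close>.\<close>

definition L1_div :: "nat \<Rightarrow> 'v \<Rightarrow> 'v" where
  "L1_div i v = scale (1 / fact i) ((L1 ^^ i) v)"

lemma L1_div_0 [simp]: "L1_div 0 v = v"
  by (simp add: L1_div_def)

lemma L1_L1_div: "L1 (L1_div i v) = scale (of_nat (Suc i)) (L1_div (Suc i) v)"
proof -
  have "1 / fact i = (of_nat (Suc i) * (1 / fact (Suc i)) :: complex)"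
    by (simp add: field_simps del: of_nat_Suc)
  then show ?thesis by (simp add: L1_div_def L1_scale del: of_nat_Suc fact_Suc)
qed

lemma L1_div_weight: "v \<in> weight h \<Longrightarrow> L1_div i v \<in> weight (h - int i)"
  by (simp add: L1_div_def weight_scale L1_pow_weight)

text \<open>The coefficient of \<open>t\<^sup>N z\<^sup>m\<close> in the conjugation formula
  \<open>e\<^bsup>tL(1)\<^esup> Y(u,z) v = Y(e\<^bsup>t(1-tz)L(1)\<^esup> (1-tz)\<^bsup>-2L(0)\<^esup> u, z/(1-tz)) e\<^bsup>tL(1)\<^esup> v\<close>.\<close>

lemma L1_div_Y:
  assumes u: "u \<in> weight h"
  shows "N \<le> B \<Longrightarrow> L1_div N (Y u m v) =
    (\<Sum>i\<le>B. \<Sum>j\<le>B. if i + j \<le> N then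
       scale ((- 1) ^ j * (of_int (int i - 2 * h - m + int j) gchoose j))
         (Y (L1_div i u) (m - int j) (L1_div (N - i - j) v)) else 0)"
proof (induction N)
  case 0
  have "(\<Sum>i\<le>B. \<Sum>j\<le>B. if i + j \<le> 0 then
       scale ((- 1) ^ j * (of_int (int i - 2 * h - m + int j) gchoose j))
         (Y (L1_div i u) (m - int j) (L1_div (0 - i - j) v)) else 0) =
    (\<Sum>i\<le>B. if i = 0 then (\<Sum>j\<le>B. if j = 0 then Y u m v else 0) else 0)"
    by (intro sum.cong refl) (auto intro!: sum.cong)
  then show ?case by simp
next
  case (Suc N)
  define c where "c = (\<lambda>i j::nat. (- 1) ^ j * (of_int (int i - 2 * h - m + int j) gchoose j) :: complex)"
  define y where "y = (\<lambda>N i j. if i + j \<le> N then Y (L1_div i u) (m - int j) (L1_div (N - i - j) v) else 0)"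
  have IH: "L1_div N (Y u m v) = (\<Sum>i\<le>B. \<Sum>j\<le>B. scale (c i j) (y N i j))"
    using Suc by (simp add: c_def y_def if_distrib cong: if_cong sum.cong)
  have Ly: "L1 (y N i j) = scale (of_nat (Suc i)) (y (Suc N) (Suc i) j) +
      scale (of_int (2 * h + m - 2 * int i - int j - 1)) (y (Suc N) i (Suc j)) +
      scale (of_int (int N + 1 - int i - int j)) (y (Suc N) i j)" for i j
  proof (cases "i + j \<le> N")
    case True
    define n where "n = N - i - j"
    have l: "Suc N - Suc i - j = n" "Suc N - i - Suc j = n" "Suc N - i - j = Suc n" "N - i - j = n"
      using True by (auto simp: n_def)
    have y: "y N i j = Y (L1_div i u) (m - int j) (L1_div n v)"
      "y (Suc N) (Suc i) j = Y (L1_div (Suc i) u) (m - int j) (L1_div n v)"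
      "y (Suc N) i (Suc j) = Y (L1_div i u) (m - int j - 1) (L1_div n v)"
      "y (Suc N) i j = Y (L1_div i u) (m - int j) (L1_div (Suc n) v)"
      using True unfolding y_def l by (simp_all add: diff_diff_eq add.commute)
    have k: "(of_int (int N + 1 - int i - int j) :: complex) = of_nat (Suc n)"
      "2 * h + m - 2 * int i - int j - 1 = 2 * (h - int i) + (m - int j) - 1"
      using True by (simp_all add: n_def of_nat_diff)
    show ?thesis
      unfolding y k L1_Y[OF L1_div_weight[OF u]] L1_L1_div Y_scale_left Y_scale_right ..
  next
    case False
    \<comment> \<open>On the boundary \<open>i + j = N + 1\<close> the vector
      \<open>y (Suc N) i j\<close> need not vanish, but its coefficient does.\<close>
    have "scale (of_int (int N + 1 - int i - int j)) (y (Suc N) i j) = 0"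
    proof (cases "i + j = Suc N")
      case True
      then have "int N + 1 - int i - int j = 0" by linarith
      then show ?thesis by simp
    qed (use False in \<open>simp add: y_def\<close>)
    then show ?thesis using False by (simp add: y_def Lop_def)
  qed
  have "scale (of_nat (Suc N)) (L1_div (Suc N) (Y u m v)) = L1 (L1_div N (Y u m v))"
    by (simp add: L1_L1_div del: of_nat_Suc)
  also have "\<dots> = (\<Sum>i\<le>B. \<Sum>j\<le>B. scale (c i j) (L1 (y N i j)))"
    by (simp add: IH L1_pow_sum[of 1, simplified] L1_scale)
  also have "\<dots> = (\<Sum>i\<le>B. \<Sum>j\<le>B. scale (c i j * of_nat (Suc i)) (y (Suc N) (Suc i) j)) +
      (\<Sum>i\<le>B. \<Sum>j\<le>B. scale (c i j * of_int (2 * h + m - 2 * int i - int j - 1)) (y (Suc N) i (Suc j))) +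
      (\<Sum>i\<le>B. \<Sum>j\<le>B. scale (c i j * of_int (int N + 1 - int i - int j)) (y (Suc N) i j))"
    by (simp add: Ly scale_right_distrib sum.distrib del: of_nat_Suc)
  \<comment> \<open>In both index shifts the term gained at 0 has coefficient zero, and the term
    lost at \<open>Suc B\<close> lies outside the range where \<open>y\<close> is nonzero because
    \<open>N < B\<close>.\<close>
  also have "(\<Sum>i\<le>B. \<Sum>j\<le>B. scale (c i j * of_nat (Suc i)) (y (Suc N) (Suc i) j)) =
      (\<Sum>i\<le>B. \<Sum>j\<le>B. scale (c (i - 1) j * of_nat i) (y (Suc N) i j))"
    using sum_atMost_shift[of "\<lambda>i. \<Sum>j\<le>B. scale (c (i - 1) j * of_nat i) (y (Suc N) i j)" B] Suc.prems
    by (simp add: y_def del: of_nat_Suc)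
  also have "(\<Sum>i\<le>B. \<Sum>j\<le>B. scale (c i j * of_int (2 * h + m - 2 * int i - int j - 1)) (y (Suc N) i (Suc j))) =
      (\<Sum>i\<le>B. \<Sum>j\<le>B. scale (if j = 0 then 0 else c i (j - 1) * of_int (2 * h + m - 2 * int i - int j)) (y (Suc N) i j))"
  proof (rule sum.cong[OF refl])
    fix i
    show "(\<Sum>j\<le>B. scale (c i j * of_int (2 * h + m - 2 * int i - int j - 1)) (y (Suc N) i (Suc j))) =
      (\<Sum>j\<le>B. scale (if j = 0 then 0 else c i (j - 1) * of_int (2 * h + m - 2 * int i - int j)) (y (Suc N) i j))"
      using sum_atMost_shift[of "\<lambda>j. scale (if j = 0 then 0 else c i (j - 1) * of_int (2 * h + m - 2 * int i - int j)) (y (Suc N) i j)" B] Suc.prems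
      by (simp add: y_def algebra_simps)
  qed
  also have "(\<Sum>i\<le>B. \<Sum>j\<le>B. scale (c (i - 1) j * of_nat i) (y (Suc N) i j)) +
      (\<Sum>i\<le>B. \<Sum>j\<le>B. scale (if j = 0 then 0 else c i (j - 1) * of_int (2 * h + m - 2 * int i - int j)) (y (Suc N) i j)) +
      (\<Sum>i\<le>B. \<Sum>j\<le>B. scale (c i j * of_int (int N + 1 - int i - int j)) (y (Suc N) i j)) =
      (\<Sum>i\<le>B. \<Sum>j\<le>B. scale (of_nat (Suc N) * c i j) (y (Suc N) i j))"
    unfolding sum.distrib[symmetric] scale_left_distrib[symmetric]
  proof (intro sum.cong refl arg_cong2[where f = scale])
    fix i j
    \<comment> \<open>Comparison of coefficients: what remains is Pascal's rule and absorption for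
      binomials with upper entry \<open>x + 1\<close>.\<close>
    show "c (i - 1) j * of_nat i + (if j = 0 then 0 else c i (j - 1) * of_int (2 * h + m - 2 * int i - int j)) +
        c i j * of_int (int N + 1 - int i - int j) = of_nat (Suc N) * c i j"
    proof (cases j)
      case 0
      then show ?thesis by (simp add: c_def algebra_simps)
    next
      case (Suc j')
      define x where "x = (of_int (int i - 2 * h - m + int j') :: complex)"
      have c1: "c i j = - ((- 1) ^ j') * (x + 1 gchoose Suc j')"
        by (simp add: c_def Suc x_def algebra_simps)
      have c2: "c (i - 1) j * of_nat i = - ((- 1) ^ j') * (x gchoose Suc j') * of_nat i"
        by (cases i) (simp_all add: c_def Suc x_def algebra_simps)
      have c3: "c i (j - 1) = (- 1) ^ j' * (x gchoose j')"
        by (simp add: c_def Suc x_def)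
      have absorb: "of_nat (Suc j') * (x + 1 gchoose Suc j') = (x + 1) * (x gchoose j')"
        using gbinomial_absorption[of j' "x + 1"] by (simp del: of_nat_Suc)
      have pascal: "(x + 1 gchoose Suc j') = (x gchoose j') + (x gchoose Suc j')"
        by (rule gbinomial_Suc_Suc)
      have A: "of_int (2 * h + m - 2 * int i - int j) = - x - 1 - (of_nat i :: complex)"
        by (simp add: x_def Suc algebra_simps)
      have "c (i - 1) j * of_nat i + c i (j - 1) * of_int (2 * h + m - 2 * int i - int j) =
          - ((- 1) ^ j') * ((x + 1) * (x gchoose j') + of_nat i * ((x gchoose j') + (x gchoose Suc j')))"
        unfolding c2 c3 A by (simp add: algebra_simps)
      also have "\<dots> = of_nat (Suc j') * c i j + of_nat i * c i j"
        unfolding c1 absorb[symmetric] pascal[symmetric] by (simp add: algebra_simps)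
      finally show ?thesis using Suc by (simp add: algebra_simps)
    qed
  qed
  also have "\<dots> = scale (of_nat (Suc N)) (\<Sum>i\<le>B. \<Sum>j\<le>B. scale (c i j) (y (Suc N) i j))"
    by (simp add: scale_sum_right del: of_nat_Suc)
  finally have "L1_div (Suc N) (Y u m v) = (\<Sum>i\<le>B. \<Sum>j\<le>B. scale (c i j) (y (Suc N) i j))"
    by (simp del: of_nat_Suc)
  then show ?case by (simp add: c_def y_def if_distrib cong: if_cong sum.cong)
qed

end

section \<open>The transformed vertex operator map\<close>

lemma diff_times_add:
  "diff_times (int k) (\<lambda>m n. P m n + P' m n) = (\<lambda>m n. diff_times (int k) P m n + diff_times (int k) P' m n)"
  by (intro ext) (simp add: diff_times_nat algebra_simps sum.distrib)

lemma diff_times_scale: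
  "diff_times (int k) (\<lambda>m n. c * P m n) = (\<lambda>m n. c * diff_times (int k) P m n)"
  by (intro ext) (simp add: diff_times_nat sum_distrib_left mult_ac)

lemma diff_times_shifted_sum:
  "diff_times (int k) (\<lambda>m n. \<Sum>x\<in>A. c x * P x (m - a x) (n - b x)) =
    (\<lambda>m n. \<Sum>x\<in>A. c x * diff_times (int k) (P x) (m - a x) (n - b x))"
proof (intro ext)
  fix m n
  have "diff_times (int k) (\<lambda>m n. \<Sum>x\<in>A. c x * P x (m - a x) (n - b x)) m n =
      (\<Sum>i\<le>k. \<Sum>x\<in>A. c x * ((- 1) ^ i * of_nat (k choose i) * P x (m - a x - int k + int i) (n - b x - int i)))"
    unfolding diff_times_nat sum_distrib_left by (intro sum.cong refl) (simp add: algebra_simps)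
  also have "\<dots> = (\<Sum>x\<in>A. c x * diff_times (int k) (P x) (m - a x) (n - b x))"
    unfolding diff_times_nat sum_distrib_left by (rule sum.swap)
  finally show "diff_times (int k) (\<lambda>m n. \<Sum>x\<in>A. c x * P x (m - a x) (n - b x)) m n =
    (\<Sum>x\<in>A. c x * diff_times (int k) (P x) (m - a x) (n - b x))" .
qed

context vertex_operator_algebra
begin

subsection \<open>Homogeneous components\<close>

text \<open>Applying \<open>L(0) - h0\<close> removes the component of weight \<open>h0\<close> and
  multiplies the others by nonzero scalars.\<close>

lemma weight_independent:
  assumes "finite H"
  shows "(\<And>h. h \<in> H \<Longrightarrow> f h \<in> weight h) \<Longrightarrow> sum f H = 0 \<Longrightarrow> h \<in> H \<Longrightarrow> f h = 0"
  using assms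
proof (induction H arbitrary: f h rule: finite_induct)
  case (insert h0 H)
  have "Lop Y \<omega> 0 (f h0 + sum f H) = Lop Y \<omega> 0 (f h0) + (\<Sum>h\<in>H. Lop Y \<omega> 0 (f h))"
  proof -
    have "Lop Y \<omega> 0 (sum f H) = (\<Sum>h\<in>H. Lop Y \<omega> 0 (f h))"
      using insert(1) by (induction H rule: finite_induct) (simp_all add: Lop_def Y_add_right)
    then show ?thesis by (simp add: Lop_def Y_add_right)
  qed
  also have "\<dots> = scale (of_int h0) (f h0) + (\<Sum>h\<in>H. scale (of_int h) (f h))"
    using insert.prems(1) by (intro arg_cong2[where f = "(+)"] sum.cong refl) (auto simp: weight_iff)
  finally have 1: "scale (of_int h0) (f h0) + (\<Sum>h\<in>H. scale (of_int h) (f h)) = 0"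
    using insert by (simp add: Lop_def)
  have 2: "f h0 = - sum f H" using insert by (simp add: eq_neg_iff_add_eq_0)
  have "(\<Sum>h\<in>H. scale (of_int (h - h0)) (f h)) = 0"
    using 1 unfolding 2 by (simp add: scale_left_diff_distrib sum_subtractf scale_sum_right scale_minus_right)
  moreover have "scale (of_int (h - h0)) (f h) \<in> weight h" if "h \<in> H" for h
    using insert.prems(1) that by (intro weight_scale) auto
  ultimately have "scale (of_int (h - h0)) (f h) = 0" if "h \<in> H" for h
    using insert.IH[of "\<lambda>h. scale (of_int (h - h0)) (f h)" h] that by blast
  then have z: "f h = 0" if "h \<in> H" for h
    using that insert.hyps(2) by (metis scale_eq_0_iff of_int_eq_0_iff eq_iff_diff_eq_0)
  then have "f h0 = 0" unfolding 2 by simp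
  with z insert.prems(3) show ?case by auto
qed simp

abbreviation comp :: "'v \<Rightarrow> int \<Rightarrow> 'v" where "comp \<equiv> components scale Y \<omega>"

lemma components_eqI:
  assumes f: "\<And>h. f h \<in> weight h" "finite {h. f h \<noteq> 0}" "Sum_any f = v"
  shows "comp v = f"
  unfolding components_def
proof (rule the_equality)
  fix g assume g: "(\<forall>h. g h \<in> weight h) \<and> finite {h. g h \<noteq> 0} \<and> Sum_any g = v"
  define H where "H = {h. f h \<noteq> 0} \<union> {h. g h \<noteq> 0}"
  have H: "finite H" using f g by (simp add: H_def)
  have "Sum_any f = sum f H" "Sum_any g = sum g H"
    using H by (auto intro!: Sum_any.expand_superset simp: H_def)
  then have "(\<Sum>h\<in>H. g h + scale (- 1) (f h)) = 0"
    using f g by (simp add: sum_subtractf)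
  moreover have "g h + scale (- 1) (f h) \<in> weight h" for h
    using f(1) g by (blast intro: weight_add weight_scale)
  ultimately have "g h + scale (- 1) (f h) = 0" if "h \<in> H" for h
    using weight_independent[OF H, of "\<lambda>h. g h + scale (- 1) (f h)" h] that by blast
  then have eq: "g h = f h" if "h \<in> H" for h using that by simp
  show "g = f"
  proof
    fix h show "g h = f h" using eq[of h] by (cases "h \<in> H") (simp_all add: H_def)
  qed
qed (use f in auto)

lemma components_exist: "\<exists>f. (\<forall>h. f h \<in> weight h) \<and> finite {h. f h \<noteq> 0} \<and> Sum_any f = v"
proof -
  have "v \<in> span (\<Union>h. weight h)" using graded by simp
  then show ?thesis
  proof (induction rule: span_induct_alt)
    case base
    show ?case by (intro exI[of _ "\<lambda>_. 0"]) simp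
  next
    case (step c x y)
    then obtain h0 f where x: "x \<in> weight h0" and
      f: "\<forall>h. f h \<in> weight h" "finite {h. f h \<noteq> 0}" "Sum_any f = y" by blast
    define g where "g = (\<lambda>h. if h = h0 then scale c x else 0)"
    have fin: "finite {h. g h \<noteq> 0}" by (rule finite_subset[of _ "{h0}"]) (auto simp: g_def)
    have "g h \<in> weight h" for h using x by (simp add: g_def weight_scale)
    then have "g h + f h \<in> weight h" for h using f(1) by (blast intro: weight_add)
    moreover have "finite {h. g h + f h \<noteq> 0}"
      by (rule finite_subset[OF _ finite_UnI[OF fin f(2)]]) auto
    moreover have "Sum_any (\<lambda>h. g h + f h) = scale c x + y"
      using Sum_any.distrib[OF fin f(2)] f(3) by (simp add: g_def)
    ultimately show ?case by (intro exI[of _ "\<lambda>h. g h + f h"]) blast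
  qed
qed

lemma components:
  "comp v h \<in> weight h" "finite {h. comp v h \<noteq> 0}" "Sum_any (comp v) = v"
  using components_exist[of v] components_eqI[of _ v] by metis+

lemma components_add: "comp (u + v) = (\<lambda>h. comp u h + comp v h)"
proof (rule components_eqI)
  show "comp u h + comp v h \<in> weight h" for h by (simp add: components weight_add)
  show "finite {h. comp u h + comp v h \<noteq> 0}"
    by (rule finite_subset[OF _ finite_UnI[OF components(2)[of u] components(2)[of v]]]) auto
qed (simp add: Sum_any.distrib components)

lemma components_scale: "comp (scale a v) = (\<lambda>h. scale a (comp v h))"
proof (rule components_eqI)
  show "scale a (comp v h) \<in> weight h" for h by (simp add: components weight_scale)
  show fin: "finite {h. scale a (comp v h) \<noteq> 0}"
    by (rule finite_subset[OF _ components(2)[of v]]) auto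
  have "Sum_any (\<lambda>h. scale a (comp v h)) = (\<Sum>h\<in>{h. comp v h \<noteq> 0}. scale a (comp v h))"
    by (rule Sum_any.expand_superset) (auto simp: components)
  then show "Sum_any (\<lambda>h. scale a (comp v h)) = scale a v"
    using components(3)[of v] by (simp add: scale_sum_right[symmetric] Sum_any.expand_set)
qed

lemma components_homogeneous:
  assumes "v \<in> weight h"
  shows "comp v = (\<lambda>h'. if h' = h then v else 0)"
proof (rule components_eqI)
  show "(if h' = h then v else 0) \<in> weight h'" for h' using assms by simp
  show "finite {h'. (if h' = h then v else 0) \<noteq> 0}"
    by (rule finite_subset[of _ "{h}"]) auto
qed simp

text \<open>The finitely many pairs (weight, power of L(1)) that can contribute to the exponential
  of L(1) applied to \<open>v\<close>.\<close>

definition L1_support :: "'v \<Rightarrow> (int \<times> nat) set" where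
  "L1_support v = {(h, i). (L1 ^^ i) (comp v h) \<noteq> 0}"

lemma L1_bound: "\<exists>I. \<forall>h. \<forall>i\<ge>I. (L1 ^^ i) (comp v h) = 0"
proof -
  let ?H = "{h. comp v h \<noteq> 0}"
  have "\<forall>h. \<exists>I. \<forall>i\<ge>I. (L1 ^^ i) (comp v h) = 0"
    using L1_nilpotent components(1) by metis
  then obtain I where I: "\<And>h i. i \<ge> I h \<Longrightarrow> (L1 ^^ i) (comp v h) = 0" by metis
  have "(L1 ^^ i) (comp v h) = 0" if "i \<ge> Max (insert 0 (I ` ?H))" for h i
  proof (cases "comp v h = 0")
    case False
    then have "I h \<le> Max (insert 0 (I ` ?H))" using components(2) by (intro Max_ge) auto
    with that show ?thesis by (intro I) linarith
  qed simp
  then show ?thesis by blast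
qed

lemma finite_L1_support: "finite (L1_support v)"
proof -
  obtain I where I: "\<forall>h. \<forall>i\<ge>I. (L1 ^^ i) (comp v h) = 0" using L1_bound by blast
  have "L1_support v \<subseteq> {h. comp v h \<noteq> 0} \<times> {..<I}"
    using I by (auto simp: L1_support_def not_le[symmetric])
  then show ?thesis using components(2) by (rule finite_subset[OF _ finite_cartesian_product]) auto
qed

subsection \<open>The transformation and its inverse\<close>

text \<open>For homogeneous \<open>v\<close> of weight \<open>h\<close> this is
  \<open>Y\<^sub>W((-1)\<^sup>h x\<^bsup>2sh\<^esup> e\<^bsup>x\<^sup>-\<^sup>sL(1)\<^esup> v, x)\<close>: the case \<open>s = -1\<close> is the transformed map of the theorem, and
  \<open>s = 1\<close>, where \<open>(-x\<^sup>2)\<^bsup>L(0)\<^esup> e\<^bsup>-xL(1)\<^esup>\<close> is applied to \<open>v\<close>, is inverse to it.\<close>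

definition transform :: "int \<Rightarrow> 'w cspace \<Rightarrow> ('v, 'w) vmap \<Rightarrow> ('v, 'w) vmap" where
  "transform s M YW v n = (\<lambda>w \<in> carrier M. msum M (\<lambda>(h, i).
     ((- 1) powi h / fact i) \<odot>\<^bsub>M\<^esub> YW ((L1 ^^ i) (comp v h)) (n - s * (2 * h - int i)) w))"

context
  fixes M :: "'w cspace" (structure) and YW :: "('v, 'w) vmap"
  assumes vertex_space: "vertex_space M scale vac YW"
begin

interpretation W: vertex_space M scale vac YW by (rule vertex_space)

lemma transform_closed [simp]: "w \<in> carrier M \<Longrightarrow> transform s M YW v n w \<in> carrier M"
  unfolding transform_def by (auto split: prod.splits)

text \<open>The index set may exceed the support, so that several vectors, such as two summands and
  their sum, share one set.\<close>

lemma functional_transform: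
  assumes w: "w \<in> carrier M" and l: "functional M l" and A: "finite A" "L1_support v \<subseteq> A"
  shows "l (transform s M YW v n w) =
    (\<Sum>(h, i)\<in>A. ((- 1) powi h / fact i) * l (YW ((L1 ^^ i) (comp v h)) (n - s * (2 * h - int i)) w))"
proof -
  let ?g = "\<lambda>(h, i). ((- 1) powi h / fact i) \<odot> YW ((L1 ^^ i) (comp v h)) (n - s * (2 * h - int i)) w"
  have out: "(L1 ^^ i) (comp v h) = 0" if "(h, i) \<notin> A" for h i
    using A(2) that by (auto simp: L1_support_def)
  have "l (msum M ?g) = (\<Sum>x\<in>A. l (?g (id x)))"
    by (rule W.functional_msum[OF l])
       (use w A(1) in \<open>auto simp: out split: prod.splits\<close>)
  also have "\<dots> = (\<Sum>(h, i)\<in>A. ((- 1) powi h / fact i) * l (YW ((L1 ^^ i) (comp v h)) (n - s * (2 * h - int i)) w))"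
    using w by (intro sum.cong refl) (auto simp: W.functional_smult[OF l])
  finally show ?thesis using w by (simp add: transform_def)
qed

lemma functional_transform_homogeneous:
  assumes w: "w \<in> carrier M" and l: "functional M l" and v: "v \<in> weight h"
    and I: "\<And>i. i \<ge> I \<Longrightarrow> (L1 ^^ i) v = 0"
  shows "l (transform s M YW v n w) =
    (\<Sum>i<I. ((- 1) powi h / fact i) * l (YW ((L1 ^^ i) v) (n - s * (2 * h - int i)) w))"
proof -
  have "L1_support v \<subseteq> {h} \<times> {..<I}"
    using I by (auto simp: L1_support_def components_homogeneous[OF v] not_le[symmetric] split: if_splits)
  then have "l (transform s M YW v n w) =
      (\<Sum>(h, i)\<in>{h} \<times> {..<I}. ((- 1) powi h / fact i) * l (YW ((L1 ^^ i) (comp v h)) (n - s * (2 * h - int i)) w))"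
    by (intro functional_transform[OF w l]) auto
  also have "\<dots> = (\<Sum>i<I. ((- 1) powi h / fact i) * l (YW ((L1 ^^ i) v) (n - s * (2 * h - int i)) w))"
    by (subst sum.cartesian_product[symmetric]) (simp add: components_homogeneous[OF v])
  finally show ?thesis .
qed

lemma transform_lin_maps: "transform s M YW v n \<in> lin_maps M M"
proof -
  have "transform s M YW v n (x \<oplus> y) = transform s M YW v n x \<oplus> transform s M YW v n y"
    if "x \<in> carrier M" "y \<in> carrier M" for x y
  proof (rule W.functionals_separate)
    fix l assume l: "functional M l"
    show "l (transform s M YW v n (x \<oplus> y)) = l (transform s M YW v n x \<oplus> transform s M YW v n y)"
      using that by (simp add: W.functional_add[OF l] functional_transform[OF _ l finite_L1_support order_refl]
          W.functional_add[OF W.YW_functional[OF l]] sum.distrib[symmetric] distrib_left split_def)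
  qed (use that in auto)
  moreover have "transform s M YW v n (a \<odot> x) = a \<odot> transform s M YW v n x"
    if "x \<in> carrier M" for a x
  proof (rule W.functionals_separate)
    fix l assume l: "functional M l"
    show "l (transform s M YW v n (a \<odot> x)) = l (a \<odot> transform s M YW v n x)"
      using that by (simp add: W.functional_smult[OF l] functional_transform[OF _ l finite_L1_support order_refl]
          W.functional_smult[OF W.YW_functional[OF l]] sum_distrib_left split_def mult_ac)
  qed (use that in auto)
  ultimately show ?thesis
    unfolding lin_maps_def by (auto simp: transform_def PiE_iff split: prod.splits)
qed

lemma transform_laurent:
  assumes w: "w \<in> carrier M"
  shows "(\<lambda>n. transform s M YW v n w) \<in> laurent M"
proof -
  have "\<forall>v. \<exists>N. \<forall>n<N. YW v n w = \<zero>" using W.YW_bounded[OF w] by blast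
  then obtain N where N: "\<And>v n. n < N v \<Longrightarrow> YW v n w = \<zero>" by metis
  define B where "B = Min (insert 0 ((\<lambda>(h, i). N ((L1 ^^ i) (comp v h)) + s * (2 * h - int i)) ` L1_support v))"
  have "transform s M YW v n w = \<zero>" if "n < B" for n
  proof (rule W.functionals_separate)
    fix l assume l: "functional M l"
    have "YW ((L1 ^^ i) (comp v h)) (n - s * (2 * h - int i)) w = \<zero>" if "(h, i) \<in> L1_support v" for h i
    proof (rule N)
      have "B \<le> N ((L1 ^^ i) (comp v h)) + s * (2 * h - int i)"
        unfolding B_def using that finite_L1_support[of v] by (intro Min_le) (auto intro!: image_eqI[of _ _ "(h, i)"])
      with \<open>n < B\<close> show "n - s * (2 * h - int i) < N ((L1 ^^ i) (comp v h))" by linarith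
    qed
    then show "l (transform s M YW v n w) = l \<zero>"
      unfolding functional_transform[OF w l finite_L1_support order_refl]
      by (auto simp: W.functional_zero[OF l] intro!: sum.neutral)
  qed (use w in auto)
  then show ?thesis using w by (auto simp: laurent_def)
qed

lemma transform_vertex_space: "vertex_space M scale vac (transform s M YW)"
proof (unfold_locales, unfold vertex_map_def, intro conjI allI ballI)
  fix v n show "transform s M YW v n \<in> lin_maps M M" by (rule transform_lin_maps)
next
  fix u v n w assume w: "w \<in> carrier M"
  show "transform s M YW (u + v) n w = transform s M YW u n w \<oplus> transform s M YW v n w"
  proof (rule W.functionals_separate)
    fix l assume l: "functional M l"
    let ?A = "L1_support u \<union> L1_support v \<union> L1_support (u + v)"
    have A: "finite ?A" "L1_support u \<subseteq> ?A" "L1_support v \<subseteq> ?A" "L1_support (u + v) \<subseteq> ?A"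
      by (auto simp: finite_L1_support)
    show "l (transform s M YW (u + v) n w) = l (transform s M YW u n w \<oplus> transform s M YW v n w)"
      using w by (simp add: W.functional_add[OF l] functional_transform[OF _ l A(1,2)] functional_transform[OF _ l A(1,3)]
          functional_transform[OF _ l A(1,4)] components_add L1_pow_add W.YW_add sum.distrib[symmetric] distrib_left split_def)
  qed (use w in auto)
next
  fix a v n w assume w: "w \<in> carrier M"
  show "transform s M YW (scale a v) n w = a \<odot> transform s M YW v n w"
  proof (rule W.functionals_separate)
    fix l assume l: "functional M l"
    let ?A = "L1_support v \<union> L1_support (scale a v)"
    have A: "finite ?A" "L1_support v \<subseteq> ?A" "L1_support (scale a v) \<subseteq> ?A"
      by (auto simp: finite_L1_support)
    show "l (transform s M YW (scale a v) n w) = l (a \<odot> transform s M YW v n w)"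
      using w by (simp add: W.functional_smult[OF l] functional_transform[OF _ l A(1,2)] functional_transform[OF _ l A(1,3)]
          components_scale L1_pow_scale W.YW_scale sum_distrib_left split_def mult_ac)
  qed (use w in auto)
next
  fix v w assume "w \<in> carrier M"
  then show "(\<lambda>n. transform s M YW v n w) \<in> laurent M" by (rule transform_laurent)
next
  fix n w assume w: "w \<in> carrier M"
  show "transform s M YW vac n w = (if n = 0 then w else \<zero>)"
  proof (rule W.functionals_separate)
    fix l assume l: "functional M l"
    have "(L1 ^^ i) vac = 0" if "i \<ge> 1" for i using that by (intro L1_pow_vac) simp
    from functional_transform_homogeneous[OF w l vac_weight this, where s = s and n = n]
    show "l (transform s M YW vac n w) = l (if n = 0 then w else \<zero>)"
      using w by (simp add: W.YW_vac)
  qed (use w in auto)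
qed

text \<open>The component of weight \<open>h\<close> and the power \<open>i\<close> of L(1) together
  contribute the exponent \<open>m = i - 2h\<close>. \<open>new_map\<close> collects terms by
  \<open>m\<close> first, so the two sides differ by an interchange of finite sums.\<close>

lemma new_map_eq_transform: "new_map scale Y \<omega> M YW = transform (- 1) M YW"
proof (intro ext)
  fix v n w
  show "new_map scale Y \<omega> M YW v n w = transform (- 1) M YW v n w"
  proof (cases "w \<in> carrier M")
    case w: True
    define E where "E = exp_xL1 scale Y \<omega> (L0_factor scale Y \<omega> v)"
    define H where "H = {h. comp v h \<noteq> 0}"
    have H: "finite H" unfolding H_def by (rule components)
    obtain I where I: "\<And>h i. i \<ge> I \<Longrightarrow> (L1 ^^ i) (comp v h) = 0" using L1_bound[of v] by blast
    have f: "L0_factor scale Y \<omega> v m = (\<Sum>h\<in>H. if m = - 2 * h then scale ((- 1) powi h) (comp v h) else 0)" for m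
      unfolding L0_factor_def by (rule Sum_any.expand_superset[OF H]) (auto simp: H_def split: if_splits)
    have Lf: "(L1 ^^ i) (L0_factor scale Y \<omega> v m) = (\<Sum>h\<in>H. if m = - 2 * h then scale ((- 1) powi h) ((L1 ^^ i) (comp v h)) else 0)" for i m
      unfolding f L1_pow_sum by (intro sum.cong refl) (simp add: L1_pow_scale)
    have E: "E m = (\<Sum>i<I. \<Sum>h\<in>H. if m = int i - 2 * h then scale ((- 1) powi h / fact i) ((L1 ^^ i) (comp v h)) else 0)" for m
    proof -
      have "E m = (\<Sum>i<I. scale (1 / fact i) ((L1 ^^ i) (L0_factor scale Y \<omega> v (m - int i))))"
        unfolding E_def exp_xL1_def
      proof (rule Sum_any.expand_superset)
        have "(L1 ^^ i) (L0_factor scale Y \<omega> v (m - int i)) = 0" if "i \<ge> I" for i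
          unfolding Lf using I[OF that] by (intro sum.neutral) simp
        then show "{i. scale (1 / fact i) ((L1 ^^ i) (L0_factor scale Y \<omega> v (m - int i))) \<noteq> 0} \<subseteq> {..<I}"
          by (auto simp: not_le[symmetric])
      qed simp
      also have "\<dots> = (\<Sum>i<I. \<Sum>h\<in>H. if m = int i - 2 * h then scale ((- 1) powi h / fact i) ((L1 ^^ i) (comp v h)) else 0)"
        unfolding Lf scale_sum_right by (intro sum.cong refl) (auto simp: algebra_simps)
      finally show ?thesis .
    qed
    define A where "A = (\<lambda>(i, h). int i - 2 * h) ` ({..<I} \<times> H)"
    have A: "finite A" using H by (simp add: A_def)
    have E0: "E m = 0" if "m \<notin> A" for m
      unfolding E using that by (intro sum.neutral ballI) (auto simp: A_def)
    have lE: "l (YW (E m) r w) = (\<Sum>i<I. \<Sum>h\<in>H. if m = int i - 2 * h then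
        ((- 1) powi h / fact i) * l (YW ((L1 ^^ i) (comp v h)) r w) else 0)" if l: "functional M l" for l m r
    proof -
      have fl: "functional (type_space scale) (\<lambda>a. l (YW a r w))"
        using w by (simp add: functional_V W.YW_add W.YW_scale W.functional_add[OF l] W.functional_smult[OF l])
      show ?thesis
        unfolding E functional_V_sum[OF fl]
        using w by (intro sum.cong refl) (simp add: W.YW_scale W.functional_smult[OF l] W.functional_zero[OF l])
    qed
    show ?thesis
    proof (rule W.functionals_separate)
      show "new_map scale Y \<omega> M YW v n w \<in> carrier M"
        unfolding new_map_def using w by auto
      fix l assume l: "functional M l"
      have "l (new_map scale Y \<omega> M YW v n w) = (\<Sum>m\<in>A. l (YW (E m) (n - m) w))"
      proof -
        have "l (msum M (\<lambda>m. YW (E m) (n - m) w)) = (\<Sum>m\<in>A. l (YW (E (id m)) (n - id m) w))"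
          by (rule W.functional_msum[OF l]) (use w A E0 in auto)
        then show ?thesis using w by (simp add: new_map_def E_def)
      qed
      also have "\<dots> = (\<Sum>i<I. \<Sum>h\<in>H. \<Sum>m\<in>A. if m = int i - 2 * h then
          ((- 1) powi h / fact i) * l (YW ((L1 ^^ i) (comp v h)) (n - m) w) else 0)"
        unfolding lE[OF l] by (rule trans[OF sum.swap]) (intro sum.cong refl sum.swap)
      also have "\<dots> = (\<Sum>i<I. \<Sum>h\<in>H. ((- 1) powi h / fact i) * l (YW ((L1 ^^ i) (comp v h)) (n - (int i - 2 * h)) w))"
      proof (intro sum.cong refl)
        fix i h assume "i \<in> {..<I}" "h \<in> H"
        then have "int i - 2 * h \<in> A" by (auto simp: A_def intro!: image_eqI[of _ _ "(i, h)"])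
        then show "(\<Sum>m\<in>A. if m = int i - 2 * h then
          ((- 1) powi h / fact i) * l (YW ((L1 ^^ i) (comp v h)) (n - m) w) else 0) =
          ((- 1) powi h / fact i) * l (YW ((L1 ^^ i) (comp v h)) (n - (int i - 2 * h)) w)"
          using A by (simp add: sum.delta)
      qed
      also have "\<dots> = (\<Sum>(h, i)\<in>H \<times> {..<I}. ((- 1) powi h / fact i) * l (YW ((L1 ^^ i) (comp v h)) (n - (- 1) * (2 * h - int i)) w))"
        by (subst sum.swap, subst sum.cartesian_product) (simp add: algebra_simps)
      also have "\<dots> = l (transform (- 1) M YW v n w)"
        using H I by (intro functional_transform[OF w l, symmetric])
          (auto simp: L1_support_def H_def not_le[symmetric])
      finally show "l (new_map scale Y \<omega> M YW v n w) = l (transform (- 1) M YW v n w)" .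
    qed (use w in auto)
  qed (simp add: new_map_def transform_def)
qed

end

lemma vertex_maps_eqI:
  assumes "vertex_space M scale vac Z" "vertex_space M scale vac Z'"
    and eq: "\<And>h v n w. v \<in> weight h \<Longrightarrow> w \<in> carrier M \<Longrightarrow> Z v n w = Z' v n w"
  shows "Z = Z'"
proof (intro ext)
  interpret Z: vertex_space M scale vac Z by fact
  interpret Z': vertex_space M scale vac Z' by fact
  fix v n w
  show "Z v n w = Z' v n w"
  proof (cases "w \<in> carrier M")
    case w: True
    have "v \<in> span (\<Union>h. weight h)" using graded by simp
    then show ?thesis
      by (induction rule: span_induct_alt)
         (use w eq in \<open>auto simp: Z.YW_add Z'.YW_add Z.YW_scale Z'.YW_scale\<close>)
  next
    case False
    then show ?thesis using Z.YW_lin[of v n] Z'.YW_lin[of v n] by (auto simp: lin_maps_def PiE_iff extensional_def)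
  qed
qed

text \<open>In the double sum \<open>L(1)^i v\<close> has weight \<open>h - i\<close>, so the signs
  combine to \<open>(-1)^i\<close> and the exponents to \<open>s (i + j)\<close>. Grouping by
  \<open>N = i + j\<close> leaves the alternating sum of \<open>(-1)^i / (i! j!)\<close>, which is
  zero for \<open>N > 0\<close>: the two exponentials of L(1) cancel.\<close>

lemma transform_inverse:
  assumes "vertex_space M scale vac YW"
  shows "transform (- s) M (transform s M YW) = YW"
proof (rule vertex_maps_eqI)
  interpret W: vertex_space M scale vac YW by fact
  note T = transform_vertex_space[OF assms, of s]
  show "vertex_space M scale vac (transform (- s) M (transform s M YW))"
    by (rule transform_vertex_space[OF T])
  show "vertex_space M scale vac YW" by fact
  fix h v n w assume v: "v \<in> weight h" and w: "w \<in> carrier M"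
  obtain I where I: "\<And>i. i \<ge> I \<Longrightarrow> (L1 ^^ i) v = 0" using L1_nilpotent[OF v] by blast
  show "transform (- s) M (transform s M YW) v n w = YW v n w"
  proof (rule W.functionals_separate)
    fix l assume l: "functional M l"
    define g where "g = (\<lambda>N. l (YW ((L1 ^^ N) v) (n + s * int N) w))"
    have g0: "g N = 0" if "N \<ge> I" for N using I[OF that] w by (simp add: g_def W.functional_zero[OF l])
    have "l (transform (- s) M (transform s M YW) v n w) =
        (\<Sum>i<I. ((- 1) powi h / fact i) * l (transform s M YW ((L1 ^^ i) v) (n - (- s) * (2 * h - int i)) w))"
      by (rule functional_transform_homogeneous[OF T w l v I])
    also have "\<dots> = (\<Sum>i<I. \<Sum>j<I. (- 1) ^ i / (fact i * fact j) * g (i + j))"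
    proof (rule sum.cong[OF refl])
      fix i
      have Ij: "(L1 ^^ j) ((L1 ^^ i) v) = 0" if "j \<ge> I" for j
        using I[of "j + i"] that by (simp add: funpow_add)
      have sg: "(- 1) powi h * (- 1) powi (h - int i) = ((- 1) ^ i :: complex)"
      proof -
        have "(- 1) powi (h - int i) = ((- 1) powi h * (- 1) powi (- int i) :: complex)"
          using power_int_add[of "- 1 :: complex" h "- int i"] by simp
        moreover have "(- 1) powi (- int i) = ((- 1) ^ i :: complex)"
          by (subst power_int_minus_one_minus) (rule power_int_of_nat)
        moreover have "(- 1) powi h * (- 1) powi h = (1 :: complex)"
          by (simp add: power_int_mult_distrib[symmetric])
        ultimately show ?thesis by (simp add: mult.assoc[symmetric] del: power_int_of_nat)
      qed
      have "l (transform s M YW ((L1 ^^ i) v) (n - (- s) * (2 * h - int i)) w) =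
          (\<Sum>j<I. ((- 1) powi (h - int i) / fact j) * l (YW ((L1 ^^ j) ((L1 ^^ i) v)) (n - (- s) * (2 * h - int i) - s * (2 * (h - int i) - int j)) w))"
        by (rule functional_transform_homogeneous[OF assms w l L1_pow_weight[OF v] Ij])
      also have "\<dots> = (\<Sum>j<I. ((- 1) powi (h - int i) / fact j) * g (i + j))"
        by (intro sum.cong refl) (simp add: g_def funpow_add[symmetric, THEN fun_cong, simplified] algebra_simps)
      finally show "((- 1) powi h / fact i) * l (transform s M YW ((L1 ^^ i) v) (n - (- s) * (2 * h - int i)) w) =
          (\<Sum>j<I. (- 1) ^ i / (fact i * fact j) * g (i + j))"
        unfolding sg[symmetric] by (simp add: sum_distrib_left mult_ac)
    qed
    also have "\<dots> = (\<Sum>N<I. \<Sum>i\<le>N. (- 1) ^ i / (fact i * fact (N - i)) * g N)"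
    proof -
      have "(\<Sum>i<I. \<Sum>j<I. (- 1) ^ i / (fact i * fact j) * g (i + j)) =
          (\<Sum>(i, j)\<in>{..<I} \<times> {..<I}. (- 1) ^ i / (fact i * fact j) * g (i + j))"
        by (simp add: sum.cartesian_product)
      also have "\<dots> = (\<Sum>(i, j)\<in>{(i, j). i + j < I}. (- 1) ^ i / (fact i * fact j) * g (i + j))"
      proof (rule sum.mono_neutral_right)
        have "i + j < I" if "g (i + j) \<noteq> 0" for i j using g0[of "i + j"] that by (meson not_le)
        then show "\<forall>x\<in>{..<I} \<times> {..<I} - {(i, j). i + j < I}.
            (case x of (i, j) \<Rightarrow> (- 1) ^ i / (fact i * fact j) * g (i + j)) = 0"
          by auto
      qed auto
      also have "\<dots> = (\<Sum>N<I. \<Sum>i\<le>N. (- 1) ^ i / (fact i * fact (N - i)) * g (i + (N - i)))"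
        by (rule sum.triangle_reindex)
      finally show ?thesis by simp
    qed
    also have "\<dots> = (\<Sum>N<I. if N = 0 then g 0 else 0)"
    proof (rule sum.cong[OF refl])
      fix N
      show "(\<Sum>i\<le>N. (- 1) ^ i / (fact i * fact (N - i)) * g N) = (if N = 0 then g 0 else 0)"
      proof (cases "N = 0")
        case False
        have "(\<Sum>i\<le>N. (- 1) ^ i / (fact i * fact (N - i)) :: complex) = (\<Sum>i\<le>N. (- 1) ^ i * of_nat (N choose i)) / fact N"
          unfolding sum_divide_distrib by (intro sum.cong refl) (simp add: binomial_fact)
        also have "\<dots> = 0" using choose_alternating_sum[of N, where 'a = complex] False by simp
        finally show ?thesis using False
          unfolding sum_distrib_right[symmetric] by (simp only: mult_zero_left if_False)
      qed simp
    qed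
    also have "\<dots> = g 0"
      using g0[of 0] by (cases I) auto
    finally show "l (transform (- s) M (transform s M YW) v n w) = l (YW v n w)" by (simp add: g_def)
  qed (use w transform_closed[OF T] in auto)
qed

end

context vertex_operator_algebra
begin

subsection \<open>Associativity in both coordinates\<close>

text \<open>For \<open>s = 1\<close> and \<open>s = -1\<close> this is the condition defining modules and modules
  coordinated by \<open>x / (1 + z x)\<close>, respectively. Requiring it for all large \<open>k\<close> makes it linear
  in \<open>u\<close> and \<open>v\<close>.\<close>

definition associative_at :: "int \<Rightarrow> nat \<Rightarrow> 'w cspace \<Rightarrow> ('v, 'w) vmap \<Rightarrow> 'v \<Rightarrow> 'v \<Rightarrow> 'w \<Rightarrow> bool" where
  "associative_at s k M YW u v w \<longleftrightarrow>
     (\<exists>N. \<forall>l. functional M l \<longrightarrow> bounded2 N (cleared_coeff YW k l u v w)) \<and>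
     (\<forall>l. functional M l \<longrightarrow> expands s k (cleared_coeff YW k l u v w) (iter_coeff YW Y l u v w))"

definition associative :: "int \<Rightarrow> 'w cspace \<Rightarrow> ('v, 'w) vmap \<Rightarrow> 'v \<Rightarrow> 'v \<Rightarrow> bool" where
  "associative s M YW u v \<longleftrightarrow> (\<exists>K::nat. \<forall>k\<ge>K. \<forall>w\<in>carrier M. associative_at s k M YW u v w)"

text \<open>The hypotheses speak of coefficients only, so the same lemma serves for linearity in the
  first and in the second vector; a threshold for \<open>k\<close> is the larger of the two.\<close>

lemma associative_linear:
  assumes p: "\<And>l w m n. functional M l \<Longrightarrow> w \<in> carrier M \<Longrightarrow>
      prod_coeff YW l u'' v'' w m n = c * prod_coeff YW l u v w m n + prod_coeff YW l u' v' w m n"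
    and i: "\<And>l w j r. functional M l \<Longrightarrow> w \<in> carrier M \<Longrightarrow>
      iter_coeff YW Y l u'' v'' w j r = c * iter_coeff YW Y l u v w j r + iter_coeff YW Y l u' v' w j r"
    and a: "associative s M YW u v" "associative s M YW u' v'"
  shows "associative s M YW u'' v''"
proof -
  obtain K1 where 1: "\<And>k w. k \<ge> K1 \<Longrightarrow> w \<in> carrier M \<Longrightarrow> associative_at s k M YW u v w"
    using a(1) unfolding associative_def by blast
  obtain K2 where 2: "\<And>k w. k \<ge> K2 \<Longrightarrow> w \<in> carrier M \<Longrightarrow> associative_at s k M YW u' v' w"
    using a(2) unfolding associative_def by blast
  show ?thesis
    unfolding associative_def
  proof (intro exI[of _ "max K1 K2"] allI impI ballI)
    fix k w assume k: "k \<ge> max K1 K2" and w: "w \<in> carrier M"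
    obtain N1 where N1: "\<And>l. functional M l \<Longrightarrow> bounded2 N1 (cleared_coeff YW k l u v w)"
      using 1[of k w] k w unfolding associative_at_def by auto
    obtain N2 where N2: "\<And>l. functional M l \<Longrightarrow> bounded2 N2 (cleared_coeff YW k l u' v' w)"
      using 2[of k w] k w unfolding associative_at_def by auto
    define N where "N = min N1 N2"
    have b: "bounded2 N (cleared_coeff YW k l u v w)"
      "bounded2 N (cleared_coeff YW k l u' v' w)" if "functional M l" for l
      using bounded2_mono[OF N1[OF that], of N] bounded2_mono[OF N2[OF that], of N] by (simp_all add: N_def)
    have P: "cleared_coeff YW k l u'' v'' w =
        (\<lambda>m n. c * cleared_coeff YW k l u v w m n + cleared_coeff YW k l u' v' w m n)"
      if "functional M l" for l
    proof -
      have "prod_coeff YW l u'' v'' w = (\<lambda>m n. c * prod_coeff YW l u v w m n + prod_coeff YW l u' v' w m n)"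
        by (intro ext) (rule p[OF that w])
      then show ?thesis by (simp only: diff_times_add diff_times_scale)
    qed
    have Q: "iter_coeff YW Y l u'' v'' w = (\<lambda>j r. c * iter_coeff YW Y l u v w j r + iter_coeff YW Y l u' v' w j r)"
      if "functional M l" for l
      by (intro ext) (rule i[OF that w])
    have "bounded2 N (cleared_coeff YW k l u'' v'' w)" if "functional M l" for l
      unfolding P[OF that] using b[OF that] by (simp add: bounded2_def)
    moreover have "expands s k (cleared_coeff YW k l u'' v'' w) (iter_coeff YW Y l u'' v'' w)"
      if "functional M l" for l
      unfolding P[OF that] Q[OF that]
    proof (rule expands_add[OF _ b(2)[OF that] expands_scale[OF b(1)[OF that]]])
      show "bounded2 N (\<lambda>m n. c * cleared_coeff YW k l u v w m n)"
        using b(1)[OF that] by (simp add: bounded2_def)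
    qed (use 1[of k w] 2[of k w] k w that in \<open>auto simp: associative_at_def\<close>)
    ultimately show "associative_at s k M YW u'' v'' w"
      unfolding associative_at_def by blast
  qed
qed

context
  fixes M :: "'w cspace" (structure) and YW :: "('v, 'w) vmap"
  assumes vertex_space: "vertex_space M scale vac YW"
begin

interpretation W: vertex_space M scale vac YW by (rule vertex_space)

lemma associative_zero:
  assumes "u = 0 \<or> v = 0"
  shows "associative s M YW u v"
proof -
  have P: "prod_coeff YW l u v w = (\<lambda>_ _. 0)" and Q: "iter_coeff YW Y l u v w = (\<lambda>_ _. 0)"
    if "functional M l" "w \<in> carrier M" for l w
    using assms that by (auto simp: prod_coeff_def iter_coeff_def W.functional_zero intro!: ext)
  have "diff_times (int k) (\<lambda>_ _. 0) = (\<lambda>_ _. 0)" for k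
    by (intro ext) (simp add: diff_times_nat)
  moreover have "expansion_series s k (\<lambda>_ _. 0) d = 0" "antidiag_gen s (\<lambda>_ _. 0) d = 0" for k d
    by (auto simp: expansion_series_def antidiag_gen_def intro!: fps_ext)
  ultimately show ?thesis
    unfolding associative_def associative_at_def by (simp add: P Q bounded2_def expands_def)
qed

lemma associative_of_homogeneous:
  assumes h: "\<And>h h' u v. u \<in> weight h \<Longrightarrow> v \<in> weight h' \<Longrightarrow> associative s M YW u v"
  shows "associative s M YW u v"
proof -
  have v: "associative s M YW u v" if u: "u \<in> weight h" for h u v
  proof -
    have "v \<in> span (\<Union>h. weight h)" using graded by simp
    then show ?thesis
    proof (induction rule: span_induct_alt)
      case base
      show ?case by (rule associative_zero) simp
    next
      case (step c x y)
      then obtain h' where x: "x \<in> weight h'" by blast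
      show ?case
        by (rule associative_linear[where c = c, OF _ _ h[OF u x] step(2)])
           (simp_all add: prod_coeff_def iter_coeff_def W.YW_add W.YW_scale Y_add_right Y_scale_right
             W.functional_add W.functional_smult W.functional_add[OF W.YW_functional] W.functional_smult[OF W.YW_functional])
    qed
  qed
  have "u \<in> span (\<Union>h. weight h)" using graded by simp
  then show ?thesis
  proof (induction rule: span_induct_alt)
    case base
    show ?case by (rule associative_zero) simp
  next
    case (step c x y)
    then obtain h where x: "x \<in> weight h" by blast
    show ?case
      by (rule associative_linear[where c = c, OF _ _ v[OF x, of v] step(2)])
         (simp_all add: prod_coeff_def iter_coeff_def W.YW_add W.YW_scale Y_add_left Y_scale_left
           W.functional_add W.functional_smult)
  qed
qed

text \<open>\<open>phi_module\<close> asks for one \<open>k\<close> and \<open>associative\<close>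
  for all large ones. Induction with \<open>expands_Suc\<close> passes from the former to the latter
  and keeps \<open>k\<close> independent of the vector \<open>w\<close>.\<close>

lemma phi_module_iff: "phi_module scale Y vac M YW \<longleftrightarrow> (\<forall>u v. associative (- 1) M YW u v)"
proof -
  define C where "C = (\<lambda>u v k. \<forall>w\<in>carrier M. associative_at (- 1) k M YW u v w)"
  have cond: "(\<forall>w \<in> carrier M.
       (let F = fmul M (diff_pow (int k)) (\<lambda>(m, n). YW u m (YW v n w)) in
         F \<in> laurent2 M \<and>
         subst_phi M F = fmul M (cpow phi_minus_x k) (\<lambda>(r, j). YW (Y u j v) r w))) \<longleftrightarrow> C u v k" for u v k
  proof -
    obtain K where K: "\<And>j. j < K \<Longrightarrow> Y u j v = 0" using Y_bounded by blast
    show ?thesis unfolding C_def associative_at_def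
      by (intro ball_cong refl W.phi_condition_iff[where K = K]) (auto intro: K)
  qed
  have up: "C u v (Suc k)" if c: "C u v k" for u v k
    unfolding C_def
  proof (intro ballI)
    fix w assume w: "w \<in> carrier M"
    obtain N where N: "\<And>l. functional M l \<Longrightarrow> bounded_snd N (prod_coeff YW l u v w)"
      by (rule W.prod_coeff_bounded[OF w, of u v]) auto
    obtain N' where N': "\<And>l. functional M l \<Longrightarrow> bounded2 N' (cleared_coeff YW k l u v w)"
      using c w unfolding C_def associative_at_def by blast
    define B where "B = min N N'"
    have "bounded2 B (diff_times (int (Suc k)) (prod_coeff YW l u v w)) \<and>
        expands (- 1) (Suc k) (diff_times (int (Suc k)) (prod_coeff YW l u v w)) (iter_coeff YW Y l u v w)"
      if l: "functional M l" for l
    proof -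
      have 1: "bounded_snd B (prod_coeff YW l u v w)"
        using N[OF l] by (auto simp: bounded_snd_def B_def)
      have 2: "bounded2 B (cleared_coeff YW k l u v w)"
        using N'[OF l] by (rule bounded2_mono) (simp add: B_def)
      have 3: "expands (- 1) k (cleared_coeff YW k l u v w) (iter_coeff YW Y l u v w)"
        using c w l unfolding C_def associative_at_def by blast
      show ?thesis using expands_Suc[OF _ 1 2 3] by simp
    qed
    then show "associative_at (- 1) (Suc k) M YW u v w"
      unfolding associative_at_def by blast
  qed
  have assoc: "associative (- 1) M YW u v \<longleftrightarrow> (\<exists>K. \<forall>k\<ge>K. C u v k)" for u v
    by (simp add: associative_def C_def)
  have "(\<exists>k. C u v k) \<longleftrightarrow> (\<exists>K. \<forall>k\<ge>K. C u v k)" for u v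
  proof
    assume "\<exists>k. C u v k"
    then obtain K where "C u v K" ..
    have "C u v k" if "k \<ge> K" for k
      using that
    proof (induction k rule: dec_induct)
      case base
      show ?case by fact
    next
      case (step k)
      then show ?case by (intro up)
    qed
    then show "\<exists>K. \<forall>k\<ge>K. C u v k" by blast
  qed blast
  then show ?thesis
    unfolding phi_module_def cond assoc
    using W.cvector_space W.vertex_map by simp
qed

text \<open>A bound on the pole order of \<open>Y(u,z)v\<close> serves as threshold for
  \<open>k\<close>; it does not depend on \<open>w\<close>.\<close>

lemma associative_of_va_module:
  assumes "va_module scale Y vac M YW"
  shows "associative 1 M YW u v"
proof -
  obtain K where K: "\<And>j. j < K \<Longrightarrow> Y u j v = 0" using Y_bounded by blast
  show ?thesis
    unfolding associative_def
  proof (intro exI[of _ "nat (- K)"] allI impI ballI)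
    fix k w assume k: "k \<ge> nat (- K)" and w: "w \<in> carrier M"
    obtain N1 where N1: "\<And>l. functional M l \<Longrightarrow> bounded_snd N1 (prod_coeff YW l u v w)"
      by (rule W.prod_coeff_bounded[OF w, of u v]) auto
    obtain N2 where N2: "\<And>l. functional M l \<Longrightarrow> bounded_snd N2 (prod_coeff YW l v u w)"
      by (rule W.prod_coeff_bounded[OF w, of v u]) auto
    define N where "N = min N1 N2"
    have "bounded2 N (cleared_coeff YW k l u v w) \<and>
        expands 1 k (cleared_coeff YW k l u v w) (iter_coeff YW Y l u v w)"
      if l: "functional M l" for l
    proof -
      have 1: "bounded_snd N (prod_coeff YW l u v w)" "bounded_snd N (prod_coeff YW l v u w)"
        using N1[OF l] N2[OF l] by (auto simp: bounded_snd_def N_def)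
      have 2: "iter_coeff YW Y l u v w j r = 0" if "j < - int k" for j r
      proof -
        have "Y u j v = 0" using that k by (intro K) linarith
        then show ?thesis using w by (simp add: iter_coeff_def W.functional_zero[OF l])
      qed
      have 3: "scalar_jacobi (prod_coeff YW l u v w) (prod_coeff YW l v u w) (iter_coeff YW Y l u v w)"
        using assms w l W.jacobi_identity_iff[where Y = Y and u = u and v = v and K = K, OF w K]
        by (simp add: va_module_def)
      show ?thesis using expands_of_jacobi[OF 1 2 3] by blast
    qed
    then show "associative_at 1 k M YW u v w"
      unfolding associative_at_def by blast
  qed
qed

text \<open>Associativity with the vacuum gives \<open>Y_W(Y(a,z)1,x) = Y_W(a,x+z)\<close>. Since
  skew symmetry in V is expressed through \<open>Y(a,z)1\<close>, this is what carries it over to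
  W.\<close>

lemma translation_covariance:
  assumes a: "associative 1 M YW a vac" and l: "functional M l" and w: "w \<in> carrier M"
  shows "l (YW (Y a (int i) vac) r w) = (of_int (r + int i) gchoose i) * l (YW a (r + int i) w)"
proof -
  obtain k where e: "expands 1 k (cleared_coeff YW k l a vac w) (iter_coeff YW Y l a vac w)"
    using a l w unfolding associative_def associative_at_def by blast
  obtain N where N: "\<And>m. m < N \<Longrightarrow> YW a m w = \<zero>" using W.YW_bounded[OF w] by blast
  have "iter_coeff YW Y l a vac w (int i) r = (of_int (r + int i) gchoose i) * l (YW a (r + int i) w)"
  proof (rule expands_vacuum[OF _ _ e])
    show "l (YW a m w) = 0" if "m < N" for m using N[OF that] by (simp add: W.functional_zero[OF l])
    show "prod_coeff YW l a vac w = (\<lambda>m n. if n = 0 then l (YW a m w) else 0)"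
      using w by (intro ext) (simp add: prod_coeff_def W.YW_vac W.functional_zero[OF l])
  qed
  then show ?thesis by (simp add: iter_coeff_def)
qed

lemma va_module_of_associative:
  assumes a: "\<And>u v. associative 1 M YW u v"
  shows "va_module scale Y vac M YW"
  unfolding va_module_def
proof (intro conjI allI ballI)
  show "cvector_space M" by (rule W.cvector_space)
  show "vertex_map scale vac M YW" by (rule W.vertex_map)
  fix u v w assume w: "w \<in> carrier M"
  obtain K0 where K0: "\<And>j. j < K0 \<Longrightarrow> Y u j v = 0" using Y_bounded by blast
  obtain K1 where K1: "\<And>j. j < K1 \<Longrightarrow> Y v j u = 0" using Y_bounded by blast
  obtain k1 where k1: "\<And>k. k \<ge> k1 \<Longrightarrow> associative_at 1 k M YW u v w"
    using a[of u v] w unfolding associative_def by blast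
  obtain k2 where k2: "\<And>k. k \<ge> k2 \<Longrightarrow> associative_at 1 k M YW v u w"
    using a[of v u] w unfolding associative_def by blast
  \<comment> \<open>Besides both associativity thresholds, \<open>k\<close> bounds the pole order of
    \<open>Y(v,z)u\<close>; this restricts the sum in skew symmetry to
    \<open>p <= n\<close>.\<close>
  define k where "k = max (max k1 k2) (nat (- K1))"
  have k: "k \<ge> k1" "k \<ge> k2" "- int k \<le> K1" by (auto simp: k_def)
  have iff: "jacobi_identity Y M YW u v w \<longleftrightarrow> (\<forall>l. functional M l \<longrightarrow>
      scalar_jacobi (prod_coeff YW l u v w) (prod_coeff YW l v u w) (iter_coeff YW Y l u v w))"
    by (rule W.jacobi_identity_iff[where K = K0, OF w]) (rule K0)
  show "jacobi_identity Y M YW u v w"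
    unfolding iff
  proof (intro allI impI)
    fix l assume l: "functional M l"
    obtain N1 where N1: "bounded2 N1 (cleared_coeff YW k l u v w)"
      using k1[OF k(1)] l unfolding associative_at_def by blast
    obtain N2 where N2: "bounded2 N2 (cleared_coeff YW k l v u w)"
      using k2[OF k(2)] l unfolding associative_at_def by blast
    obtain N3 where N3: "bounded_snd N3 (prod_coeff YW l u v w)"
      by (rule W.prod_coeff_bounded[OF w, of u v]) (use l in blast)
    obtain N4 where N4: "bounded_snd N4 (prod_coeff YW l v u w)"
      by (rule W.prod_coeff_bounded[OF w, of v u]) (use l in blast)
    define N where "N = min (min N1 N2) (min N3 N4)"
    have b: "bounded2 N (cleared_coeff YW k l u v w)"
      "bounded2 N (cleared_coeff YW k l v u w)"
      using N1 N2 by (auto simp: bounded2_def N_def)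
    have s: "bounded_snd N (prod_coeff YW l u v w)" "bounded_snd N (prod_coeff YW l v u w)"
      using N3 N4 by (auto simp: bounded_snd_def N_def)
    have e: "expands 1 k (cleared_coeff YW k l u v w) (iter_coeff YW Y l u v w)"
      "expands 1 k (cleared_coeff YW k l v u w) (iter_coeff YW Y l v u w)"
      using k1[OF k(1)] k2[OF k(2)] l unfolding associative_at_def by auto
    have fl: "functional (type_space scale) (\<lambda>a. l (YW a r w))" for r
      using w by (simp add: functional_V W.YW_add W.YW_scale W.functional_add[OF l] W.functional_smult[OF l])
    \<comment> \<open>Skew symmetry of V seen on W: each \<open>Y(a,z)1\<close> is resolved by
      \<open>translation_covariance\<close>, and \<open>i = n - p\<close> puts the sum into the form
      needed for commutativity.\<close>
    have skew: "iter_coeff YW Y l u v w (int n - int k) r =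
      (\<Sum>i\<le>n. (- 1) ^ (i + k) * (of_int (r + int (n - i)) gchoose (n - i)) *
         iter_coeff YW Y l v u w (int i - int k) (r + int (n - i)))" for n r
    proof -
      define j where "j = int n - int k"
      have "Y u j v = (\<Sum>p<Suc n. scale ((- 1) powi (j + int p)) (Y (Y v (j - int p) u) (int p) vac))"
        by (rule skew_symmetry[of "- int k"]) (use K1 k(3) in \<open>auto simp: j_def\<close>)
      then have "l (YW (Y u j v) r w) = l (YW (\<Sum>p<Suc n. scale ((- 1) powi (j + int p)) (Y (Y v (j - int p) u) (int p) vac)) r w)"
        by (rule arg_cong)
      also have "\<dots> = (\<Sum>p<Suc n. (- 1) powi (j + int p) * ((of_int (r + int p) gchoose p) * l (YW (Y v (j - int p) u) (r + int p) w)))"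
        unfolding functional_V_sum[OF fl] using w
        by (intro sum.cong refl) (simp add: W.YW_scale W.functional_smult[OF l] translation_covariance[OF a l])
      also have "\<dots> = (\<Sum>i\<le>n. (- 1) ^ (i + k) * (of_int (r + int (n - i)) gchoose (n - i)) *
         iter_coeff YW Y l v u w (int i - int k) (r + int (n - i)))"
      proof (rule sum.reindex_bij_witness[of _ "\<lambda>i. n - i" "\<lambda>p. n - p"])
        fix p assume p: "p \<in> {..<Suc n}"
        have one: "((- 1) powi 2) powi i = (1 :: complex)" for i :: int by simp
        have pw: "(- 1) powi (a + b) = ((- 1) powi a * (- 1) powi b :: complex)" for a b :: int
          by (simp add: power_int_add)
        have "j + int p = int (n - p + k) + 2 * (int p - int k)" using p by (simp add: j_def of_nat_diff)
        then have sg: "(- 1) powi (j + int p) = ((- 1) ^ (n - p + k) :: complex)"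
          by (simp only: pw power_int_mult power_int_of_nat one mult_1_right)
        have jp: "int (n - p) - int k = j - int p" "n - (n - p) = p"
          using p by (simp_all add: j_def of_nat_diff)
        show "(- 1) ^ (n - p + k) * (of_int (r + int (n - (n - p))) gchoose (n - (n - p))) *
           iter_coeff YW Y l v u w (int (n - p) - int k) (r + int (n - (n - p))) =
          (- 1) powi (j + int p) * ((of_int (r + int p) gchoose p) * l (YW (Y v (j - int p) u) (r + int p) w))"
          unfolding sg jp iter_coeff_def by (simp only: mult.assoc)
      qed auto
      finally show ?thesis by (simp add: iter_coeff_def j_def)
    qed
    show "scalar_jacobi (prod_coeff YW l u v w) (prod_coeff YW l v u w) (iter_coeff YW Y l u v w)"
      by (rule jacobi_of_expands[OF s commutativity_of_expands[OF b e skew] b(1) e(1)])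
  qed
qed

lemma va_module_iff: "va_module scale Y vac M YW \<longleftrightarrow> (\<forall>u v. associative 1 M YW u v)"
  using associative_of_va_module va_module_of_associative by blast

end

end

section \<open>Transport of associativity along the transformation\<close>

lemma sum_shifted_lessThan:
  fixes f :: "nat \<Rightarrow> 'a::comm_monoid_add"
  shows "(\<Sum>N<B. if c \<le> N then f (N - c) else 0) = (\<Sum>l<B - c. f l)"
proof -
  have "(\<Sum>N<B. if c \<le> N then f (N - c) else 0) = (\<Sum>N\<in>{c..<B}. f (N - c))"
    by (rule sum.mono_neutral_cong_right) auto
  also have "\<dots> = (\<Sum>l<B - c. f l)"
    by (rule sum.reindex_bij_witness[of _ "\<lambda>l. l + c" "\<lambda>N. N - c"]) auto
  finally show ?thesis .
qed

context vertex_operator_algebra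
begin

text \<open>The conjugation formula \<open>L1_div_Y\<close> brought into the shape required of
  \<open>Q'\<close> in \<open>expands_transform\<close>, with \<open>\<alpha> = 2h - i\<close> and
  \<open>\<beta> = 2h' - i'\<close>. The power \<open>q\<close> by which the formula lowers the
  exponent of \<open>z\<close> becomes the distance between \<open>n\<close> and the summation
  index.\<close>

lemma iter_coeff_transform:
  assumes "vertex_space M scale vac YW"
    and u: "u \<in> weight h" and v: "v \<in> weight h'" and l: "functional M l" and w: "w \<in> carrier M"
    and I: "\<And>i. i \<ge> I \<Longrightarrow> (L1 ^^ i) u = 0" "\<And>i. i \<ge> I \<Longrightarrow> (L1 ^^ i) v = 0"
    and K: "\<And>i i' j. i < I \<Longrightarrow> i' < I \<Longrightarrow> j < - int k \<Longrightarrow> Y ((L1 ^^ i) u) j ((L1 ^^ i') v) = 0"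
  shows "iter_coeff (transform s M YW) Y l u v w (int n - int k) r =
    (\<Sum>x\<in>{..<I} \<times> {..<I}. ((- 1) powi h / fact (fst x)) * ((- 1) powi h' / fact (snd x)) *
      (\<Sum>i\<le>n. (- 1) ^ (i + k) *
        (of_int (- (2 * h - int (fst x)) - (int i - int k)) gchoose (n - i)) *
        iter_coeff YW Y l ((L1 ^^ fst x) u) ((L1 ^^ snd x) v) w (int i - int k)
          (r - s * ((int n - int k) + (int i - int k) + (2 * h - int (fst x)) + (2 * h' - int (snd x))))))"
proof -
  interpret W: vertex_space M scale vac YW by fact
  let ?t = "\<lambda>i i' p. (- 1) ^ (p + k) *
        (of_int (- (2 * h - int i) - (int p - int k)) gchoose (n - p)) *
        iter_coeff YW Y l ((L1 ^^ i) u) ((L1 ^^ i') v) w (int p - int k)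
          (r - s * ((int n - int k) + (int p - int k) + (2 * h - int i) + (2 * h' - int i')))"
  define j where "j = int n - int k"
  define H where "H = h + h' + j"
  have v': "Y u j v \<in> weight H" unfolding H_def by (rule weight_Y[OF u v])
  obtain J where J: "\<And>i. i \<ge> J \<Longrightarrow> (L1 ^^ i) (Y u j v) = 0" using L1_nilpotent[OF v'] by blast
  \<comment> \<open>\<open>J\<close> makes the exponential on \<open>Y u j v\<close> complete. The
    second entry ensures that the inner range, shortened by \<open>i + q\<close> with
    \<open>i < I\<close> and \<open>q <= n\<close>, still contains all
    \<open>i' < I\<close>.\<close>
  define B where "B = max J (2 * I + n + 1)"
  define c where "c = (\<lambda>i q::nat. (- 1) ^ q * (of_int (int i - 2 * h - j + int q) gchoose q) :: complex)"
  define G where "G = (\<lambda>i q i'. c i q * l (YW (Y (L1_div i u) (j - int q) (L1_div i' v)) (r - s * (2 * H - int (i + q + i'))) w))"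
  have fl: "functional (type_space scale) (\<lambda>a. l (YW a r w))" for r
    using w by (simp add: functional_V W.YW_add W.YW_scale W.functional_add[OF l] W.functional_smult[OF l])
  have fls: "l (YW (scale a b) r w) = a * l (YW b r w)" for a b r
    using w by (simp add: W.YW_scale W.functional_smult[OF l])
  have l0: "l (YW 0 r w) = 0" for r using w by (simp add: W.functional_zero[OF l])
  have div0: "L1_div i u = 0" "L1_div i v = 0" if "i \<ge> I" for i
    using I that by (simp_all add: L1_div_def)
  have G0: "G i q i' = 0" if "i \<ge> I \<or> i' \<ge> I \<or> q > n" for i q i'
  proof (cases "i \<ge> I \<or> i' \<ge> I")
    case True
    then show ?thesis by (auto simp: G_def div0 l0)
  next
    case False
    then have "Y ((L1 ^^ i) u) (j - int q) ((L1 ^^ i') v) = 0"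
      using that by (intro K) (auto simp: j_def)
    then show ?thesis by (simp add: G_def L1_div_def Y_scale_left Y_scale_right l0)
  qed
  have "l (transform s M YW (Y u j v) r w) =
      (\<Sum>N<B. ((- 1) powi H / fact N) * l (YW ((L1 ^^ N) (Y u j v)) (r - s * (2 * H - int N)) w))"
    by (rule functional_transform_homogeneous[OF assms(1) w l v']) (use J in \<open>simp add: B_def\<close>)
  also have "\<dots> = (\<Sum>N<B. (- 1) powi H * l (YW (L1_div N (Y u j v)) (r - s * (2 * H - int N)) w))"
    by (simp add: L1_div_def fls)
  also have "\<dots> = (\<Sum>N<B. \<Sum>i\<le>B. \<Sum>q\<le>B. if i + q \<le> N then (- 1) powi H * G i q (N - (i + q)) else 0)"
  proof (rule sum.cong[OF refl])
    fix N assume N: "N \<in> {..<B}"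
    show "(- 1) powi H * l (YW (L1_div N (Y u j v)) (r - s * (2 * H - int N)) w) =
        (\<Sum>i\<le>B. \<Sum>q\<le>B. if i + q \<le> N then (- 1) powi H * G i q (N - (i + q)) else 0)"
      using N unfolding L1_div_Y[OF u, of N B j v, OF less_imp_le[OF N[unfolded lessThan_iff]]] functional_V_sum[OF fl] sum_distrib_left
      by (intro sum.cong refl) (auto simp: G_def c_def fls l0 of_nat_diff algebra_simps)
  qed
  also have "\<dots> = (\<Sum>i\<le>B. \<Sum>q\<le>B. \<Sum>N<B. if i + q \<le> N then (- 1) powi H * G i q (N - (i + q)) else 0)"
    by (rule trans[OF sum.swap]) (intro sum.cong refl sum.swap)
  also have "\<dots> = (\<Sum>i\<le>B. \<Sum>q\<le>B. \<Sum>i'<B - (i + q). (- 1) powi H * G i q i')"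
    by (intro sum.cong refl sum_shifted_lessThan)
  also have "\<dots> = (\<Sum>i<I. \<Sum>q\<le>n. \<Sum>i'<I. (- 1) powi H * G i q i')"
  proof (rule sum.mono_neutral_cong_right)
    show "(\<Sum>q\<le>B. \<Sum>i'<B - (i + q). (- 1) powi H * G i q i') = (\<Sum>q\<le>n. \<Sum>i'<I. (- 1) powi H * G i q i')"
      if "i \<in> {..<I}" for i
    proof (rule sum.mono_neutral_cong_right)
      show "(\<Sum>i'<B - (i + q). (- 1) powi H * G i q i') = (\<Sum>i'<I. (- 1) powi H * G i q i')"
        if "q \<in> {..n}" for q
        by (rule sum.mono_neutral_right) (use \<open>i \<in> {..<I}\<close> that in \<open>auto simp: B_def G0\<close>)
    qed (auto simp: B_def G0)
  qed (auto simp: B_def G0)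
  also have "\<dots> = (\<Sum>i<I. \<Sum>i'<I. \<Sum>q\<le>n. (- 1) powi H * G i q i')"
    by (intro sum.cong refl sum.swap)
  also have "\<dots> = (\<Sum>i<I. \<Sum>i'<I. ((- 1) powi h / fact i) * ((- 1) powi h' / fact i') * (\<Sum>p\<le>n. ?t i i' p))"
  proof (rule sum.cong[OF refl], rule sum.cong[OF refl])
    fix i i'
    show "(\<Sum>q\<le>n. (- 1) powi H * G i q i') = ((- 1) powi h / fact i) * ((- 1) powi h' / fact i') * (\<Sum>p\<le>n. ?t i i' p)"
      unfolding sum_distrib_left
    proof (rule sum.reindex_bij_witness[of _ "\<lambda>p. n - p" "\<lambda>q. n - q"])
      fix q assume q: "q \<in> {..n}"
      have one: "((- 1) powi 2) powi i = (1 :: complex)" for i :: int by simp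
      have pw: "(- 1) powi (a + b) = ((- 1) powi a * (- 1) powi b :: complex)" for a b :: int
        by (simp add: power_int_add)
      have "(- 1) powi H * (- 1) ^ q = ((- 1) powi (H + int q) :: complex)"
        by (simp only: pw power_int_of_nat)
      \<comment> \<open>The even summand is split off because \<open>(-1) powi\<close> ignores it;
        what remains has the sign pattern \<open>(-1)^(p+k)\<close> with
        \<open>p = n - q\<close>.\<close>
      also have "H + int q = h + h' + int (n - q + k) + 2 * (int q - int k)"
        using q by (simp add: H_def j_def of_nat_diff)
      also have "(- 1) powi (h + h' + int (n - q + k) + 2 * (int q - int k)) =
          ((- 1) powi h * (- 1) powi h' * (- 1) ^ (n - q + k) :: complex)"
        by (simp only: pw power_int_mult power_int_of_nat one mult_1_right)
      finally have sg: "(- 1) powi H * (- 1) ^ q = ((- 1) powi h * (- 1) powi h' * (- 1) ^ (n - q + k) :: complex)" .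
      have e: "int (n - q) - int k = j - int q" "n - (n - q) = q"
        "of_int (- (2 * h - int i) - (j - int q)) = (of_int (int i - 2 * h - j + int q) :: complex)"
        "r - s * ((int n - int k) + (j - int q) + (2 * h - int i) + (2 * h' - int i')) = r - s * (2 * H - int (i + q + i'))"
        using q by (simp_all add: j_def H_def of_nat_diff)
      have "(- 1) powi H * G i q i' = ((- 1) powi H * (- 1) ^ q) * ((1 / fact i) * (1 / fact i') *
          ((of_int (int i - 2 * h - j + int q) gchoose q) *
           l (YW (Y ((L1 ^^ i) u) (j - int q) ((L1 ^^ i') v)) (r - s * (2 * H - int (i + q + i'))) w)))"
        by (simp add: G_def c_def L1_div_def Y_scale_left Y_scale_right fls mult_ac)
      also have "\<dots> = ((- 1) powi h / fact i) * ((- 1) powi h' / fact i') * ((- 1) ^ (n - q + k) *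
        (of_int (int i - 2 * h - j + int q) gchoose q) *
        iter_coeff YW Y l ((L1 ^^ i) u) ((L1 ^^ i') v) w (j - int q) (r - s * (2 * H - int (i + q + i'))))"
        unfolding sg iter_coeff_def by (simp add: mult_ac)
      finally show "((- 1) powi h / fact i) * ((- 1) powi h' / fact i') * ?t i i' (n - q) =
        (- 1) powi H * G i q i'"
        unfolding e by (rule sym)
    qed auto
  qed
  finally show ?thesis
    by (simp add: iter_coeff_def j_def sum.cartesian_product split_def)
qed

text \<open>A functional composed with an operator \<open>YW u m\<close> is again a functional, so
  the inner operator is expanded by the same lemma as the outer one.\<close>

lemma prod_coeff_transform:
  assumes "vertex_space M scale vac YW"
    and u: "u \<in> weight h" and v: "v \<in> weight h'" and l: "functional M l" and w: "w \<in> carrier M"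
    and I: "\<And>i. i \<ge> I \<Longrightarrow> (L1 ^^ i) u = 0" "\<And>i. i \<ge> I \<Longrightarrow> (L1 ^^ i) v = 0"
  shows "prod_coeff (transform s M YW) l u v w m n =
    (\<Sum>x\<in>{..<I} \<times> {..<I}. ((- 1) powi h / fact (fst x)) * ((- 1) powi h' / fact (snd x)) *
      prod_coeff YW l ((L1 ^^ fst x) u) ((L1 ^^ snd x) v) w
        (m - s * (2 * h - int (fst x))) (n - s * (2 * h' - int (snd x))))"
proof -
  interpret W: vertex_space M scale vac YW by fact
  let ?T = "transform s M YW"
  have "l (?T u m (?T v n w)) =
      (\<Sum>i<I. ((- 1) powi h / fact i) * l (YW ((L1 ^^ i) u) (m - s * (2 * h - int i)) (?T v n w)))"
    by (rule functional_transform_homogeneous[OF assms(1) transform_closed[OF assms(1) w] l u I(1)])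
  also have "\<dots> = (\<Sum>i<I. ((- 1) powi h / fact i) * (\<Sum>i'<I. ((- 1) powi h' / fact i') *
      l (YW ((L1 ^^ i) u) (m - s * (2 * h - int i)) (YW ((L1 ^^ i') v) (n - s * (2 * h' - int i')) w))))"
    by (intro sum.cong refl arg_cong2[where f = "(*)"]
        functional_transform_homogeneous[OF assms(1) w W.YW_functional[OF l] v I(2)])
  finally show ?thesis
    by (simp add: prod_coeff_def sum_distrib_left sum.cartesian_product split_def mult_ac)
qed

text \<open>For homogeneous \<open>u\<close> and \<open>v\<close>, product and iterate of the
  transformed map are finite combinations over the pairs \<open>L(1)^i u\<close>,
  \<open>L(1)^j v\<close> with the same coefficients and matching monomials, and
  \<open>expands_transform\<close> carries each pair from one coordinate to the other. Associativity
  is thus used for all these pairs at a common \<open>k\<close>.\<close>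

lemma associative_transform:
  assumes s: "s = 1 \<or> s = - 1" and vs: "vertex_space M scale vac YW"
    and a: "\<And>u v. associative s M YW u v"
  shows "associative (- s) M (transform s M YW) u v"
proof (rule associative_of_homogeneous[OF transform_vertex_space[OF vs]])
  interpret W: vertex_space M scale vac YW by fact
  interpret T: vertex_space M scale vac "transform s M YW" by (rule transform_vertex_space[OF vs])
  fix h h' u v assume u: "u \<in> weight h" and v: "v \<in> weight h'"
  obtain I1 where I1: "\<And>i. i \<ge> I1 \<Longrightarrow> (L1 ^^ i) u = 0" using L1_nilpotent[OF u] by blast
  obtain I2 where I2: "\<And>i. i \<ge> I2 \<Longrightarrow> (L1 ^^ i) v = 0" using L1_nilpotent[OF v] by blast
  define I where "I = max I1 I2"
  have I: "(L1 ^^ i) u = 0" "(L1 ^^ i) v = 0" if "i \<ge> I" for i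
    using that I1 I2 by (simp_all add: I_def)
  define A where "A = {..<I} \<times> {..<I}"
  have A: "finite A" by (simp add: A_def)
  let ?u = "\<lambda>x :: nat \<times> nat. (L1 ^^ fst x) u" and ?v = "\<lambda>x :: nat \<times> nat. (L1 ^^ snd x) v"
  have "\<forall>x. \<exists>K::nat. \<forall>k\<ge>K. \<forall>w\<in>carrier M. associative_at s k M YW (?u x) (?v x) w"
    using a unfolding associative_def by blast
  then obtain K :: "nat \<times> nat \<Rightarrow> nat" where K: "\<And>x k w. k \<ge> K x \<Longrightarrow> w \<in> carrier M \<Longrightarrow> associative_at s k M YW (?u x) (?v x) w"
    by metis
  have "\<forall>x. \<exists>K. \<forall>j<K. Y (?u x) j (?v x) = 0" using Y_bounded by blast
  then obtain K' where K': "\<And>x j. j < K' x \<Longrightarrow> Y (?u x) j (?v x) = 0" by metis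
  obtain K'' where K'': "\<And>j. j < K'' \<Longrightarrow> Y u j v = 0" using Y_bounded by blast
  \<comment> \<open>Three demands are met at once: associativity for each pair, a bound on the pole
    of \<open>Y\<close> on each pair, and the pole condition for \<open>Y u j v\<close>
    itself.\<close>
  define K0 where "K0 = Max (insert (nat (- K'')) ((\<lambda>x. max (K x) (nat (- K' x))) ` A))"
  have K0: "nat (- K'') \<le> K0" "\<And>x. x \<in> A \<Longrightarrow> max (K x) (nat (- K' x)) \<le> K0"
    unfolding K0_def using A by (intro Max_ge; blast)+
  show "associative (- s) M (transform s M YW) u v"
    unfolding associative_def
  proof (intro exI[of _ K0] allI impI ballI)
    fix k w assume k: "k \<ge> K0" and w: "w \<in> carrier M"
    let ?F = "\<lambda>l x. cleared_coeff YW k l (?u x) (?v x) w"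
    let ?F' = "\<lambda>l. cleared_coeff (transform s M YW) k l u v w"
    define \<alpha> where "\<alpha> = (\<lambda>x :: nat \<times> nat. 2 * h - int (fst x))"
    define \<beta> where "\<beta> = (\<lambda>x :: nat \<times> nat. 2 * h' - int (snd x))"
    define c where "c = (\<lambda>x :: nat \<times> nat. ((- 1) powi h / fact (fst x)) * ((- 1) powi h' / fact (snd x)) :: complex)"
    have Kx: "k \<ge> K x" "- int k \<le> K' x" if "x \<in> A" for x
      using K0(2)[OF that] k by auto
    have "\<forall>x. \<exists>N. x \<in> A \<longrightarrow> (\<forall>l. functional M l \<longrightarrow> bounded2 N (?F l x))"
      using K[OF Kx(1) w] unfolding associative_at_def by blast
    then obtain N where N: "\<And>x l. x \<in> A \<Longrightarrow> functional M l \<Longrightarrow> bounded2 (N x) (?F l x)" by metis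
    define N0 where "N0 = Min (insert 0 (N ` A))"
    have b: "bounded2 N0 (?F l x)" if "x \<in> A" "functional M l" for x l
      by (rule bounded2_mono[OF N[OF that]]) (use A that in \<open>auto simp: N0_def intro!: Min_le\<close>)
    have F': "?F' l m n = (\<Sum>x\<in>A. c x * ?F l x (m - s * \<alpha> x) (n - s * \<beta> x))" if l: "functional M l" for l m n
    proof -
      have "prod_coeff (transform s M YW) l u v w =
          (\<lambda>m n. \<Sum>x\<in>A. c x * prod_coeff YW l (?u x) (?v x) w (m - s * \<alpha> x) (n - s * \<beta> x))"
        unfolding A_def c_def \<alpha>_def \<beta>_def
        by (intro ext prod_coeff_transform[OF vs u v l w I])
      then show ?thesis
        using diff_times_shifted_sum[of k c "\<lambda>x. prod_coeff YW l (?u x) (?v x) w" "\<lambda>x. s * \<alpha> x" "\<lambda>x. s * \<beta> x" A]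
        by (simp only:)
    qed
    define N1 where "N1 = Min (insert 0 ((\<lambda>x. N0 + s * \<alpha> x) ` A \<union> (\<lambda>x. N0 + s * \<beta> x) ` A))"
    have N1: "N1 \<le> N0 + s * \<alpha> x" "N1 \<le> N0 + s * \<beta> x" if "x \<in> A" for x
      unfolding N1_def using A that by (auto intro!: Min_le)
    have "bounded2 N1 (?F' l)" if l: "functional M l" for l
      unfolding bounded2_def
    proof (intro allI impI)
      fix m n assume mn: "m < N1 \<or> n < N1"
      have "?F l x (m - s * \<alpha> x) (n - s * \<beta> x) = 0" if "x \<in> A" for x
      proof -
        have "m - s * \<alpha> x < N0 \<or> n - s * \<beta> x < N0" using N1[OF that] mn by linarith
        then show ?thesis using b[OF that l] unfolding bounded2_def by blast
      qed
      then show "?F' l m n = 0" unfolding F'[OF l] by simp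
    qed
    moreover have "expands (- s) k (?F' l) (iter_coeff (transform s M YW) Y l u v w)" if l: "functional M l" for l
    proof (rule expands_transform[OF s A])
      fix x assume x: "x \<in> A"
      show "bounded2 N0 (?F l x)" by (rule b[OF x l])
      show "expands s k (?F l x) (iter_coeff YW Y l (?u x) (?v x) w)"
        using K[OF Kx(1)[OF x] w] l unfolding associative_at_def by blast
    next
      fix j r assume "j < - int k"
      then have "Y u j v = 0" using k K0(1) by (intro K'') linarith
      then show "iter_coeff (transform s M YW) Y l u v w j r = 0"
        using w by (simp add: iter_coeff_def W.functional_zero[OF l])
    next
      fix n r
      show "iter_coeff (transform s M YW) Y l u v w (int n - int k) r = (\<Sum>x\<in>A. c x * (\<Sum>i\<le>n. (- 1) ^ (i + k) *
        (of_int (- \<alpha> x - (int i - int k)) gchoose (n - i)) *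
        iter_coeff YW Y l (?u x) (?v x) w (int i - int k) (r - s * ((int n - int k) + (int i - int k) + \<alpha> x + \<beta> x))))"
        unfolding A_def c_def \<alpha>_def \<beta>_def
      proof (rule iter_coeff_transform[OF vs u v l w I])
        fix i i' j assume "i < I" "i' < I" "j < - int k"
        then show "Y ((L1 ^^ i) u) j ((L1 ^^ i') v) = 0"
          using K'[of j "(i, i')"] Kx(2)[of "(i, i')"] by (simp add: A_def)
      qed
    next
      fix m n
      show "?F' l m n = (\<Sum>x\<in>A. c x * ?F l x (m - s * \<alpha> x) (n - s * \<beta> x))" by (rule F'[OF l])
    qed
    ultimately show "associative_at (- s) k M (transform s M YW) u v w"
      unfolding associative_at_def by blast
  qed
qed

text \<open>One implication is the transport with \<open>s = -1\<close>; the other is the transport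
  with \<open>s = 1\<close> applied to the transformed map, which returns the original one by
  \<open>transform_inverse\<close>.\<close>

lemma phi_module_iff_va_module_new_map:
  assumes vs: "vertex_space M scale vac YW"
  shows "phi_module scale Y vac M YW \<longleftrightarrow> va_module scale Y vac M (new_map scale Y \<omega> M YW)"
  unfolding new_map_eq_transform[OF vs] phi_module_iff[OF vs] va_module_iff[OF transform_vertex_space[OF vs]]
  using associative_transform[OF _ vs, of "- 1"]
    associative_transform[OF _ transform_vertex_space[OF vs, of "- 1"], of 1] transform_inverse[OF vs, of "- 1"]
  by (auto simp del: mult_minus1)

text \<open>A functional on the target composed with the morphism is a functional on the source, and
  the transformed operators are combinations of the original ones with coefficients that do not
  depend on the space.\<close>

lemma vmor_transform:
  assumes A: "vertex_space (fst A) scale vac (snd A)" and B: "vertex_space (fst B) scale vac (snd B)"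
    and \<theta>: "\<theta> \<in> vmor A B"
  shows "\<theta> \<in> vmor (fst A, transform s (fst A) (snd A)) (fst B, transform s (fst B) (snd B))"
proof -
  interpret A: vertex_space "fst A" scale vac "snd A" by fact
  interpret B: vertex_space "fst B" scale vac "snd B" by fact
  have lin: "\<theta> \<in> lin_maps (fst A) (fst B)" using \<theta> by (simp add: vmor_def)
  then have closed: "\<theta> w \<in> carrier (fst B)" if "w \<in> carrier (fst A)" for w
    using that by (auto simp: lin_maps_def)
  have comm: "\<theta> (snd A v n w) = snd B v n (\<theta> w)" if "w \<in> carrier (fst A)" for v n w
    using \<theta> that by (simp add: vmor_def)
  have "\<theta> (transform s (fst A) (snd A) v n w) = transform s (fst B) (snd B) v n (\<theta> w)"
    if w: "w \<in> carrier (fst A)" for v n w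
  proof (rule B.functionals_separate)
    fix l assume l: "functional (fst B) l"
    show "l (\<theta> (transform s (fst A) (snd A) v n w)) = l (transform s (fst B) (snd B) v n (\<theta> w))"
      unfolding functional_transform[OF A w functional_lin_maps[OF l lin] finite_L1_support order_refl]
        functional_transform[OF B closed[OF w] l finite_L1_support order_refl]
      using w by (simp add: comm)
  qed (use w closed transform_closed[OF A] transform_closed[OF B] in auto)
  with lin show ?thesis by (simp add: vmor_def)
qed

end

section \<open>Isomorphism of the categories\<close>

lemma vcat_simps:
  "obj (vcat P) = {A. P (fst A) (snd A)}" "mor (vcat P) = vmor"
  "idn (vcat P) A = (\<lambda>w \<in> carrier (fst A). w)"
  "cmp (vcat P) A B D g f = compose (carrier (fst A)) g f"
  by (simp_all add: vcat_def)

text \<open>Morphisms are normalised outside the carrier, so the category laws hold as equations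
  between functions.\<close>

lemma is_category_vcat:
  assumes P: "\<And>M YW. P M YW \<Longrightarrow> cvector_space M \<and> (\<forall>v n. YW v n \<in> lin_maps M M)"
  shows "is_category (vcat P)"
proof -
  have id: "(\<lambda>w \<in> carrier (fst A). w) \<in> vmor A A" if "P (fst A) (snd A)" for A
  proof -
    interpret complex_space "fst A" using P[OF that] by unfold_locales blast
    have "snd A v n \<in> lin_maps (fst A) (fst A)" for v n
      using P[OF that] by blast
    then have "snd A v n w \<in> carrier (fst A)" if "w \<in> carrier (fst A)" for v n w
      using that unfolding lin_maps_def by blast
    then show ?thesis by (auto simp: vmor_def lin_maps_def)
  qed
  have comp: "compose (carrier (fst A)) g f \<in> vmor A D" if "P (fst A) (snd A)" "f \<in> vmor A B" "g \<in> vmor B D" for A B D f g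
  proof -
    interpret complex_space "fst A" using P[OF that(1)] by unfold_locales blast
    have "snd A v n \<in> lin_maps (fst A) (fst A)" for v n
      using P[OF that(1)] by blast
    then have c: "snd A v n w \<in> carrier (fst A)" if "w \<in> carrier (fst A)" for v n w
      using that unfolding lin_maps_def by blast
    have f: "f w \<in> carrier (fst B)" if "w \<in> carrier (fst A)" for w
      using \<open>f \<in> vmor A B\<close> that by (auto simp: vmor_def lin_maps_def)
    have g: "g w \<in> carrier (fst D)" if "w \<in> carrier (fst B)" for w
      using \<open>g \<in> vmor B D\<close> that by (auto simp: vmor_def lin_maps_def)
    show ?thesis
      using that(2,3) c f g by (auto simp: vmor_def lin_maps_def compose_def)
  qed
  have maps: "f \<in> carrier (fst A) \<rightarrow>\<^sub>E carrier (fst B)" if "f \<in> vmor A B" for A B f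
    using that by (simp add: vmor_def lin_maps_def)
  show ?thesis
    unfolding is_category_def vcat_simps
  proof (intro conjI ballI)
    fix A assume "A \<in> {A. P (fst A) (snd A)}"
    then show "(\<lambda>w \<in> carrier (fst A). w) \<in> vmor A A" by (intro id) simp
  next
    fix A B D f g
    assume "A \<in> {A. P (fst A) (snd A)}" "f \<in> vmor A B" "g \<in> vmor B D"
    then show "compose (carrier (fst A)) g f \<in> vmor A D" by (intro comp) simp_all
  next
    fix A B f assume f: "f \<in> vmor A B"
    show "compose (carrier (fst A)) f (\<lambda>w\<in>carrier (fst A). w) = f"
      using maps[OF f] by (auto simp: compose_def PiE_iff extensional_def fun_eq_iff)
    show "compose (carrier (fst A)) (\<lambda>w\<in>carrier (fst B). w) f = f"
      using maps[OF f] by (auto simp: compose_def PiE_iff extensional_def fun_eq_iff)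
  next
    fix A B D E f g h assume f: "f \<in> vmor A B"
    show "compose (carrier (fst A)) h (compose (carrier (fst A)) g f) =
        compose (carrier (fst A)) (compose (carrier (fst B)) h g) f"
      using maps[OF f] by (auto simp: compose_def fun_eq_iff)
  qed
qed

theorem proposition3p8:
  fixes scale :: "complex \<Rightarrow> 'v::ab_group_add \<Rightarrow> 'v"
    and Y :: "'v \<Rightarrow> int \<Rightarrow> 'v \<Rightarrow> 'v"
    and vac \<omega> :: 'v
  assumes "vertex_operator_algebra scale Y vac \<omega>"
  shows "(\<forall>(W :: (complex, 'w) module) YW.
            cvector_space W \<and> vertex_map scale vac W YW \<longrightarrow>
            (phi_module scale Y vac W YW \<longleftrightarrow>
             va_module scale Y vac W (new_map scale Y \<omega> W YW))) \<and>
         category_isomorphism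
           (phi_module_cat scale Y vac :: (('v, 'w) vobj, 'w \<Rightarrow> 'w) cat)
           (va_module_cat scale Y vac)
           (\<lambda>(W, YW). (W, new_map scale Y \<omega> W YW))
           (\<lambda>_ _ \<theta>. \<theta>)"
proof -
  interpret vertex_operator_algebra scale Y vac \<omega> by fact
  have vs: "vertex_space W scale vac YW \<longleftrightarrow> cvector_space W \<and> vertex_map scale vac W YW"
    for W :: "'w cspace" and YW
    by (auto simp: vertex_space_def vertex_space_axioms_def complex_space_def)
  let ?F = "\<lambda>(W :: 'w cspace, YW). (W, new_map scale Y \<omega> W YW)"
  let ?G = "\<lambda>(W :: 'w cspace, YW). (W, transform 1 W YW)"
  have phi: "vertex_space W scale vac YW" if "phi_module scale Y vac W YW" for W :: "'w cspace" and YW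
    using that unfolding vs phi_module_def by blast
  have va: "vertex_space W scale vac YW" if "va_module scale Y vac W YW" for W :: "'w cspace" and YW
    using that unfolding vs va_module_def by blast
  \<comment> \<open>The two transformations are strictly inverse on all vertex maps and leave the
    spaces and morphisms untouched; this gives an isomorphism of categories and not only an
    equivalence.\<close>
  have GF: "transform 1 W (new_map scale Y \<omega> W YW) = YW" if "vertex_space W scale vac YW" for W :: "'w cspace" and YW
    using transform_inverse[OF that, of "- 1"] by (simp add: new_map_eq_transform[OF that])
  have FG: "new_map scale Y \<omega> W (transform 1 W YW) = YW" if "vertex_space W scale vac YW" for W :: "'w cspace" and YW
    using transform_inverse[OF that, of 1] by (simp add: new_map_eq_transform[OF transform_vertex_space[OF that]])
  have F: "va_module scale Y vac W (new_map scale Y \<omega> W YW)" if "phi_module scale Y vac W YW" for W :: "'w cspace" and YW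
    using that phi_module_iff_va_module_new_map[OF phi[OF that]] by simp
  have G: "phi_module scale Y vac W (transform 1 W YW)" if "va_module scale Y vac W YW" for W :: "'w cspace" and YW
    using that phi_module_iff_va_module_new_map[OF transform_vertex_space[OF va[OF that], of 1]] by (simp add: FG[OF va[OF that]])
  have lin: "cvector_space W \<and> (\<forall>v n. YW v n \<in> lin_maps W W)" if "vertex_space W scale vac YW" for W :: "'w cspace" and YW
    using that unfolding vs vertex_map_def by blast
  have cats: "is_category (phi_module_cat scale Y vac :: (('v, 'w) vobj, 'w \<Rightarrow> 'w) cat)"
    "is_category (va_module_cat scale Y vac :: (('v, 'w) vobj, 'w \<Rightarrow> 'w) cat)"
    unfolding phi_module_cat_def va_module_cat_def
    by (rule is_category_vcat; rule lin; erule phi va)+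
  have Fmor: "\<theta> \<in> vmor (?F A) (?F B)"
    if "phi_module scale Y vac (fst A) (snd A)" "phi_module scale Y vac (fst B) (snd B)" "\<theta> \<in> vmor A B" for A B \<theta>
    using vmor_transform[OF phi[OF that(1)] phi[OF that(2)] that(3), of "- 1"]
    by (simp add: new_map_eq_transform[OF phi[OF that(1)]] new_map_eq_transform[OF phi[OF that(2)]] split_def)
  have Gmor: "\<theta> \<in> vmor (?G A) (?G B)"
    if "va_module scale Y vac (fst A) (snd A)" "va_module scale Y vac (fst B) (snd B)" "\<theta> \<in> vmor A B" for A B \<theta>
    using vmor_transform[OF va[OF that(1)] va[OF that(2)] that(3), of 1] by (simp add: split_def)
  have "is_functor (phi_module_cat scale Y vac) (va_module_cat scale Y vac) ?F (\<lambda>_ _ \<theta>. \<theta>)"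
    unfolding is_functor_def phi_module_cat_def va_module_cat_def vcat_simps
    using F Fmor by (auto simp: split_def)
  moreover have "is_functor (va_module_cat scale Y vac) (phi_module_cat scale Y vac) ?G (\<lambda>_ _ \<theta>. \<theta>)"
    unfolding is_functor_def phi_module_cat_def va_module_cat_def vcat_simps
    using G Gmor by (auto simp: split_def)
  moreover have "\<forall>A \<in> obj (phi_module_cat scale Y vac). ?G (?F A) = A"
    unfolding phi_module_cat_def vcat_simps using GF[OF phi] by auto
  moreover have "\<forall>A \<in> obj (va_module_cat scale Y vac). ?F (?G A) = A"
    unfolding va_module_cat_def vcat_simps using FG[OF va] by auto
  ultimately have "category_isomorphism (phi_module_cat scale Y vac :: (('v, 'w) vobj, 'w \<Rightarrow> 'w) cat)
      (va_module_cat scale Y vac) ?F (\<lambda>_ _ \<theta>. \<theta>)"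
    unfolding category_isomorphism_def using cats
    by (intro conjI exI[of _ ?G] exI[of _ "\<lambda>_ _ \<theta>. \<theta>"]) auto
  then show ?thesis using phi_module_iff_va_module_new_map vs by blast
qed

end
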